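(* Let Assumptions 1 and 2 and the feasibility assumption (all stated in the context) hold. Let $\{\tau_t\}_{t\ge 1}\subseteq(0,+\infty)$ be a non-increasing sequence of event-triggering thresholds, let $\Psi_t=\sum_{k=1}^t\tau_k$, let $\kappa\in(0,1)$ be a constant, and let $\{x_{i,t}\}$ be the sequences generated by Algorithm 1 (described in the context) with $$\alpha_t=\sqrt{\frac{\Psi_t}{t}},\quad \beta_t=\frac{1}{t^{\kappa}},\quad \gamma_t=\frac{1}{t^{1-\kappa}},\quad \xi_t=\frac{1}{t+1},\quad \delta_t=\frac{r(\mathbb{X})}{t+1},\qquad \forall t\in\mathbb{N}_+.$$ Then for any $T\in\mathbb{N}_+$ and any comparator sequence $y_{[T]}=(y_1,\dots,y_T)\in\mathcal{X}_T$, $$\mathbf{E}[\mathrm{Net\text{-}Reg}(\{x_{i,t}\},y_{[T]})]=\mathcal{O}\big(T^{\kappa}+\sqrt{\Psi_T T}+\sqrt{\Psi_T^{-1}T}\,P_T\big),$$ $$\mathbf{E}[\mathrm{Net\text{-}CCV}(\{x_{i,t}\})]=\mathcal{O}\big(T^{1-\kappa/2}+\Psi_T^{1/4}T^{3/4}\big),$$ where $P_T=\sum_{t=1}^{T-1}\|y_{t+1}-y_t\|$ is the path-length of $y_{[T]}$.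
   Context: Setting. There are $n$ agents, $i\in[n]=\{1,\dots,n\}$, and a set $\mathbb{X}\subseteq\mathbb{R}^p$. For each $t\in\mathbb{N}_+$ and $i\in[n]$ there are a local loss function $f_{i,t}:\mathbb{X}\to\mathbb{R}$ and a local constraint function $g_{i,t}:\mathbb{X}\to\mathbb{R}^{m_i}$. Set $f_t(x)=\frac1n\sum_{j=1}^n f_{j,t}(x)$, $g_t(x)=\mathrm{col}(g_{1,t}(x),\dots,g_{n,t}(x))\in\mathbb{R}^m$, $m=\sum_i m_i$. $\|\cdot\|$ is the Euclidean norm (spectral norm for matrices), $[\cdot]_+$ is the componentwise positive part, $\mathcal{P}_{\mathbb{K}}$ is Euclidean projection onto $\mathbb{K}$, $\mathbb{B}^p$ and $\mathbb{S}^p$ are the unit ball and unit sphere of $\mathbb{R}^p$ centered at the origin, vector inequalities are componentwise. Performance measures: $\mathrm{Net\text{-}Reg}(\{x_{i,t}\},y_{[T]})=\frac1n\sum_{i=1}^n\sum_{t=1}^T f_t(x_{i,t})-\sum_{t=1}^T f_t(y_t)$ and $\mathrm{Net\text{-}CCV}(\{x_{i,t}\})=\frac1n\sum_{i=1}^n\sum_{t=1}^T\|[g_t(x_{i,t})]_+\|$. $\mathcal{X}_T=\{(x_1,\dots,x_T): x_t\in\mathbb{X},\ g_t(x_t)\le \mathbf{0}_m\ \forall t\in[T]\}$ is the set of feasible decision sequences. Feasibility assumption (standing): for every $T\in\mathbb{N}_+$, $\mathcal{X}_T$ is non-empty, and so is the set of feasible static sequences $\{(x,\dots,x): x\in\mathbb{X},\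 g_t(x)\le\mathbf{0}_m\ \forall t\in[T]\}$. Assumption 1. (i) $\mathbb{X}$ is convex and closed, and $r(\mathbb{X})\mathbb{B}^p\subseteq\mathbb{X}\subseteq R(\mathbb{X})\mathbb{B}^p$ for constants $r(\mathbb{X}),R(\mathbb{X})>0$. (ii) All $f_{i,t}$ and $g_{i,t}$ are convex (the latter componentwise), and there is a constant $F_1$ with $|f_{i,t}(x)-f_{i,t}(y)|\le F_1$ and $\|g_{i,t}(x)\|\le F_1$ for all $x,y\in\mathbb{X}$, $i$, $t$. (iii) Subgradients $\partial f_{i,t}(x)\in\mathbb{R}^p$ and $\partial g_{i,t}(x)\in\mathbb{R}^{p\times m_i}$ exist and there is a constant $F_2$ with $\|\partial f_{i,t}(x)\|\le F_2$, $\|\partial g_{i,t}(x)\|\le F_2$ for all $x\in\mathbb{X}$, $i$, $t$. Assumption 2. For $t\in\mathbb{N}_+$, $\mathcal{G}_t=([n],\mathcal{E}_t)$ is a directed graph with mixing matrix $W_t\in\mathbb{R}^{n\times n}$ such that: (i) there is a constant $w\in(0,1)$ with $[W_t]_{ij}\ge w$ if $(j,i)\in\mathcal{E}_t$ or $i=j$, and $[W_t]_{ij}=0$ otherwise; (ii) $W_t$ is doubly stochastic; (iii) there is an integer $B>0$ such that $([n],\cup_{l=0}^{B-1}\mathcal{E}_{t+l})$ is strongly connected for every $t$. Algorithm 1. Inputs: $r(\mathbb{X})$ and non-increasing sequences $\{\alpha_t\},\{\beta_t\},\{\gamma_t\},\{\tau_t\}\subseteq(0,+\infty)$, $\{\xi_t\}\subseteq(0,1)$,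 $\{\delta_t\}$ with $\delta_t\in(0,r(\mathbb{X})\xi_t]$. Initialization: $x_{i,1}\in(1-\xi_1)\mathbb{X}$, $\hat x_{i,1}=x_{i,1}$, $q_{i,1}=\mathbf{0}_{m_i}$. For $t=1,2,\dots$ and each $i\in[n]$: draw $u_{i,t}$ uniformly from $\mathbb{S}^p$ (all draws over $i,t$ independent), and set $\hat\partial f_{i,t}(x_{i,t})=\frac{p}{\delta_t}\big(f_{i,t}(x_{i,t}+\delta_tu_{i,t})-f_{i,t}(x_{i,t})\big)u_{i,t}\in\mathbb{R}^p$, $\hat\partial[g_{i,t}(x_{i,t})]_+=\frac{p}{\delta_t}\,u_{i,t}\big([g_{i,t}(x_{i,t}+\delta_tu_{i,t})]_+-[g_{i,t}(x_{i,t})]_+\big)^T\in\mathbb{R}^{p\times m_i}$, $z_{i,t+1}=\sum_{j=1}^n[W_t]_{ij}\hat x_{j,t}$, $\hat\omega_{i,t+1}=\hat\partial f_{i,t}(x_{i,t})+\hat\partial[g_{i,t}(x_{i,t})]_+\,q_{i,t}$, $x_{i,t+1}=\mathcal{P}_{(1-\xi_{t+1})\mathbb{X}}(z_{i,t+1}-\alpha_{t+1}\hat\omega_{i,t+1})$, $q_{i,t+1}=\big[(1-\beta_{t+1}\gamma_{t+1})q_{i,t}+\gamma_{t+1}\big([g_{i,t}(x_{i,t})]_++(\hat\partial[g_{i,t}(x_{i,t})]_+)^T(x_{i,t+1}-x_{i,t})\big)\big]_+$, and $\hat x_{i,t+1}=x_{i,t+1}$ if $\|x_{i,t+1}-\hat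 x_{i,t}\|\ge\tau_{t+1}$, otherwise $\hat x_{i,t+1}=\hat x_{i,t}$. $\mathbf{E}$ is expectation over the random vectors $u_{i,t}$. The constants hidden in $\mathcal{O}(\cdot)$ do not depend on $T$ or on the comparator sequence; they may depend on the other problem data and algorithm parameters. *)

theory Defs
  imports "HOL-Probability.Probability"
begin

text \<open>
  Agents are the elements of a finite type \<open>'n\<close> and decisions live in \<open>real ^ 'p\<close>.  The dimension
  \<open>m i\<close> of the constraint values of agent \<open>i\<close> varies with the agent, so a vector in the space of
  dimension \<open>m i\<close> is a function \<open>nat \<Rightarrow> real\<close> of which only the components \<open>k < m i\<close> matter, and its
  Euclidean norm is \<open>L2_set v {..<m i}\<close>.  A matrix with \<open>CARD('p)\<close> rows and \<open>m i\<close> columns is the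
  function \<open>nat \<Rightarrow> real ^ 'p\<close> of its columns.  Time starts at 1; values at time 0 are never used.
\<close>

definition mat_apply :: "nat \<Rightarrow> (nat \<Rightarrow> real ^ 'p) \<Rightarrow> (nat \<Rightarrow> real) \<Rightarrow> real ^ 'p" where
  "mat_apply d A v = (\<Sum>k<d. v k *\<^sub>R A k)"

definition spectral_norm :: "nat \<Rightarrow> (nat \<Rightarrow> real ^ 'p) \<Rightarrow> real" where
  "spectral_norm d A = (SUP v \<in> {v. L2_set v {..<d} \<le> 1}. norm (mat_apply d A v))"

definition subgradient_on :: "(real ^ 'p) set \<Rightarrow> (real ^ 'p \<Rightarrow> real) \<Rightarrow> real ^ 'p \<Rightarrow> real ^ 'p \<Rightarrow> bool" where
  "subgradient_on X h x s \<longleftrightarrow> (\<forall>y\<in>X. h y \<ge> h x + s \<bullet> (y - x))"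

definition doubly_stochastic :: "real ^ 'n ^ 'n \<Rightarrow> bool" where
  "doubly_stochastic A \<longleftrightarrow> (\<forall>i j. 0 \<le> A $ i $ j) \<and>
     (\<forall>i. (\<Sum>j\<in>UNIV. A $ i $ j) = 1) \<and> (\<forall>j. (\<Sum>i\<in>UNIV. A $ i $ j) = 1)"

definition strongly_connected :: "('n \<times> 'n) set \<Rightarrow> bool" where
  "strongly_connected E \<longleftrightarrow> (\<forall>i j. (i, j) \<in> E\<^sup>*)"

text \<open>
  The normalized surface measure of the unit sphere: the measure of a Borel set \<open>A\<close> of unit vectors
  is the volume of the cone \<open>{r *\<^sub>R a | r a. 0 < r \<and> r \<le> 1 \<and> a \<in> A}\<close> divided by the volume of
  the unit ball.
\<close>

definition sphere_uniform :: "(real ^ 'p) measure" where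
  "sphere_uniform = distr (uniform_measure lborel (cball 0 1)) borel (\<lambda>v. v /\<^sub>R norm v)"

definition global_loss :: "('n::finite \<Rightarrow> nat \<Rightarrow> real ^ 'p \<Rightarrow> real) \<Rightarrow> nat \<Rightarrow> real ^ 'p \<Rightarrow> real" where
  "global_loss f t x = 1 / real CARD('n) * (\<Sum>j\<in>UNIV. f j t x)"

definition net_reg :: "('n::finite \<Rightarrow> nat \<Rightarrow> real ^ 'p \<Rightarrow> real) \<Rightarrow> nat \<Rightarrow>
    ('n \<Rightarrow> nat \<Rightarrow> real ^ 'p) \<Rightarrow> (nat \<Rightarrow> real ^ 'p) \<Rightarrow> real" where
  "net_reg f T x y =
     1 / real CARD('n) * (\<Sum>i\<in>UNIV. \<Sum>t=1..T. global_loss f t (x i t)) - (\<Sum>t=1..T. global_loss f t (y t))"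

text \<open>The stacked vector of all constraint values is indexed by the pairs \<open>(j, k)\<close> with \<open>k < m j\<close>.\<close>

definition net_ccv :: "('n::finite \<Rightarrow> nat) \<Rightarrow> ('n \<Rightarrow> nat \<Rightarrow> real ^ 'p \<Rightarrow> nat \<Rightarrow> real) \<Rightarrow> nat \<Rightarrow>
    ('n \<Rightarrow> nat \<Rightarrow> real ^ 'p) \<Rightarrow> real" where
  "net_ccv m g T x =
     1 / real CARD('n) * (\<Sum>i\<in>UNIV. \<Sum>t=1..T.
       L2_set (\<lambda>(j, k). max 0 (g j t (x i t) k)) (SIGMA j:UNIV. {..<m j}))"

text \<open>Decision sequences of length \<open>T\<close> are functions on \<open>nat\<close> restricted to \<open>{1..T}\<close>.\<close>

definition feasible_seqs :: "(real ^ 'p) set \<Rightarrow> ('n \<Rightarrow> nat) \<Rightarrow>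
    ('n \<Rightarrow> nat \<Rightarrow> real ^ 'p \<Rightarrow> nat \<Rightarrow> real) \<Rightarrow> nat \<Rightarrow> (nat \<Rightarrow> real ^ 'p) set" where
  "feasible_seqs X m g T = {y. \<forall>t\<in>{1..T}. y t \<in> X \<and> (\<forall>i. \<forall>k<m i. g i t (y t) k \<le> 0)}"

definition path_length :: "nat \<Rightarrow> (nat \<Rightarrow> real ^ 'p) \<Rightarrow> real" where
  "path_length T y = (\<Sum>t=1..<T. norm (y (t + 1) - y t))"

definition feasibility :: "(real ^ 'p) set \<Rightarrow> ('n \<Rightarrow> nat) \<Rightarrow>
    ('n \<Rightarrow> nat \<Rightarrow> real ^ 'p \<Rightarrow> nat \<Rightarrow> real) \<Rightarrow> bool" where
  "feasibility X m g \<longleftrightarrow> (\<forall>T\<ge>1. feasible_seqs X m g T \<noteq> {} \<and>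
     (\<exists>x. (\<lambda>_. x) \<in> feasible_seqs X m g T))"

text \<open>
  The subgradient bound concerns one subgradient at each point, not the whole subdifferential: at a
  boundary point of the bounded set \<open>X\<close> the subdifferential relative to \<open>X\<close> is unbounded.
\<close>

definition convex_problem :: "(real ^ 'p) set \<Rightarrow> real \<Rightarrow> real \<Rightarrow> ('n \<Rightarrow> nat) \<Rightarrow>
    ('n \<Rightarrow> nat \<Rightarrow> real ^ 'p \<Rightarrow> real) \<Rightarrow> ('n \<Rightarrow> nat \<Rightarrow> real ^ 'p \<Rightarrow> nat \<Rightarrow> real) \<Rightarrow> bool" where
  "convex_problem X r R m f g \<longleftrightarrow>
     convex X \<and> closed X \<and> 0 < r \<and> 0 < R \<and> cball 0 r \<subseteq> X \<and> X \<subseteq> cball 0 R \<and>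
     (\<forall>i. \<forall>t\<ge>1. convex_on X (f i t)) \<and>
     (\<forall>i. \<forall>t\<ge>1. \<forall>k<m i. convex_on X (\<lambda>x. g i t x k)) \<and>
     (\<exists>F1. \<forall>i. \<forall>t\<ge>1. \<forall>x\<in>X. \<forall>y\<in>X.
        \<bar>f i t x - f i t y\<bar> \<le> F1 \<and> L2_set (g i t x) {..<m i} \<le> F1) \<and>
     (\<exists>F2. \<forall>i. \<forall>t\<ge>1. \<forall>x\<in>X.
        (\<exists>s. subgradient_on X (f i t) x s \<and> norm s \<le> F2) \<and>
        (\<exists>G. (\<forall>k<m i. subgradient_on X (\<lambda>y. g i t y k) x (G k)) \<and> spectral_norm (m i) G \<le> F2))"

definition mixing_network :: "(nat \<Rightarrow> ('n \<times> 'n) set) \<Rightarrow> (nat \<Rightarrow> real ^ 'n ^ 'n) \<Rightarrow> bool" where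
  "mixing_network E W \<longleftrightarrow>
     (\<exists>w. 0 < w \<and> w < 1 \<and> (\<forall>t\<ge>1. \<forall>i j.
        (if (j, i) \<in> E t \<or> i = j then W t $ i $ j \<ge> w else W t $ i $ j = 0))) \<and>
     (\<forall>t\<ge>1. doubly_stochastic (W t)) \<and>
     (\<exists>B>0. \<forall>t\<ge>1. strongly_connected (\<Union>l<B. E (t + l)))"

definition grad_est :: "real \<Rightarrow> (real ^ 'p \<Rightarrow> real) \<Rightarrow> real ^ 'p \<Rightarrow> real ^ 'p \<Rightarrow> real ^ 'p" where
  "grad_est d h x u = (real CARD('p) / d * (h (x + d *\<^sub>R u) - h x)) *\<^sub>R u"

definition grad_est_pos :: "real \<Rightarrow> (real ^ 'p \<Rightarrow> nat \<Rightarrow> real) \<Rightarrow> real ^ 'p \<Rightarrow> real ^ 'p \<Rightarrow> (nat \<Rightarrow> real ^ 'p)" where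
  "grad_est_pos d h x u = (\<lambda>k. grad_est d (\<lambda>y. max 0 (h y k)) x u)"

text \<open>
  The sequences \<open>x\<close>, \<open>xh\<close> (last broadcast decision) and \<open>q\<close> (dual variable) are those generated by
  the algorithm from the starting points \<open>x1\<close> along one realization \<open>u\<close> of the random directions.
\<close>

definition generated :: "(real ^ 'p) set \<Rightarrow> ('n::finite \<Rightarrow> nat) \<Rightarrow> ('n \<Rightarrow> nat \<Rightarrow> real ^ 'p \<Rightarrow> real) \<Rightarrow>
    ('n \<Rightarrow> nat \<Rightarrow> real ^ 'p \<Rightarrow> nat \<Rightarrow> real) \<Rightarrow> (nat \<Rightarrow> real ^ 'n ^ 'n) \<Rightarrow>
    (nat \<Rightarrow> real) \<Rightarrow> (nat \<Rightarrow> real) \<Rightarrow> (nat \<Rightarrow> real) \<Rightarrow> (nat \<Rightarrow> real) \<Rightarrow> (nat \<Rightarrow> real) \<Rightarrow> (nat \<Rightarrow> real) \<Rightarrow>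
    ('n \<Rightarrow> real ^ 'p) \<Rightarrow> ('n \<Rightarrow> nat \<Rightarrow> real ^ 'p) \<Rightarrow>
    ('n \<Rightarrow> nat \<Rightarrow> real ^ 'p) \<Rightarrow> ('n \<Rightarrow> nat \<Rightarrow> real ^ 'p) \<Rightarrow> ('n \<Rightarrow> nat \<Rightarrow> nat \<Rightarrow> real) \<Rightarrow> bool" where
  "generated X m f g W \<alpha> \<beta> \<gamma> \<tau> \<xi> \<delta> x1 u x xh q \<longleftrightarrow>
     (\<forall>i. x i 1 = x1 i \<and> xh i 1 = x i 1 \<and> (\<forall>k<m i. q i 1 k = 0)) \<and>
     (\<forall>t\<ge>1. \<forall>i.
        let df = grad_est (\<delta> t) (f i t) (x i t) (u i t);
            dg = grad_est_pos (\<delta> t) (g i t) (x i t) (u i t);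
            z = (\<Sum>j\<in>UNIV. W t $ i $ j *\<^sub>R xh j t);
            \<omega> = df + mat_apply (m i) dg (q i t)
        in x i (t + 1) = closest_point ((\<lambda>v. (1 - \<xi> (t + 1)) *\<^sub>R v) ` X) (z - \<alpha> (t + 1) *\<^sub>R \<omega>) \<and>
           (\<forall>k<m i. q i (t + 1) k = max 0 ((1 - \<beta> (t + 1) * \<gamma> (t + 1)) * q i t k +
              \<gamma> (t + 1) * (max 0 (g i t (x i t) k) + dg k \<bullet> (x i (t + 1) - x i t)))) \<and>
           xh i (t + 1) = (if norm (x i (t + 1) - xh i t) \<ge> \<tau> (t + 1) then x i (t + 1) else xh i t))"

end

theory Submission
  imports Defs
begin

text \<open>
  For a convex, Lipschitz function the two-point estimate with radius \<open>\<delta>\<close> is, in expectation, a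
  subgradient up to an error \<open>2 L \<delta>\<close>.  Divide by \<open>s\<close> the change of the integral of the function
  over a ball translated by \<open>s e\<close>: by convexity this is at most the difference of the two function
  values (plus the error), and as \<open>s\<close> tends to \<open>0\<close> it becomes an integral over the sphere.

  Along each realization, the projection inequality for the primal step and the expansion of the
  squared dual variable are added; the coupling term \<open>q \<bullet> [g]\<^sub>+\<close> cancels.  The telescoping distances
  to the comparator cost the path-length term, the event trigger costs \<open>\<tau> / \<alpha>\<close> per round, and the
  network disagreement is linear in the step lengths, which Young's inequality absorbs into their
  squares at the price \<open>\<Sum> \<alpha>\<close>.  What remains on the left is the regret together with the energy
  \<open>S = \<Sum> \<beta> |q|\<^sup>2 / 2 + |q\<^sub>T|\<^sup>2 / (2 \<gamma>) + \<Sum> eps\<^sup>2 / (4 \<alpha>)\<close>.  Dropping \<open>S\<close> yields the regret bound.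
  With a static feasible comparator the same inequality bounds the expectation of \<open>S\<close> by a multiple
  of \<open>T\<close>.  The dual recursion bounds the total violation by an expression linear in \<open>q\<close> and
  in the step lengths, and Young's inequality with weights \<open>lam\<close> and \<open>mu\<close> turns the bound on \<open>S\<close> into
  the violation rate, without any choice of a random multiplier.
\<close>

section \<open>Gradient estimates on the sphere\<close>

text \<open>Losses and constraints need not be differentiable and mean something only on
  \<open>X\<close>. Hence the estimates are treated through convexity alone, and everything happens
  in the shrunk sets: with \<open>\<delta> = r * \<xi>\<close> the balls around an iterate and
  around the shrunk comparator stay in \<open>X\<close>. The shrunk comparator may violate the
  constraints by order \<xi>, and this violation is weighted by a dual variable that may grow like
  \<open>t powr \<kappa>\<close>. Since \<xi> is about 1 / t, the bias of a round has order
  \<open>t powr (\<kappa> - 1)\<close>; the biases sum to the order \<open>T powr \<kappa>\<close>,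
  as does \<gamma>. The step size \<alpha> gives the sums of \<alpha> and of \<tau> / \<alpha> the
  same order \<open>sqrt (\<Psi> T * T)\<close>. Constants are fixed before the realization.
  Randomness matters only in the term \<open>gap\<close>, where the state is a function of past
  directions and independent of the current one; this is used as a product law with Fubini's theorem
  instead of conditional expectations. The weights \<open>lam\<close> and \<open>mu\<close> each
  balance two contributions to the violation: one from the linear growth of the energy, one from the
  remainder of Young's inequality.\<close>

lemma integral_lborel_scaleR:
  fixes F :: "'a::euclidean_space \<Rightarrow> real"
  assumes [measurable]: "F \<in> borel_measurable borel" and "0 < c"
  shows "(\<integral>x. F x \<partial>lborel) = c ^ DIM('a) * (\<integral>x. F (c *\<^sub>R x) \<partial>lborel)"
  using assms(2) by (subst lborel_affine[of c 0])
    (simp_all add: integral_density integral_distr)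

lemma integral_lborel_translate:
  fixes F :: "'a::euclidean_space \<Rightarrow> real"
  assumes [measurable]: "F \<in> borel_measurable borel"
  shows "(\<integral>x. F (c + x) \<partial>lborel) = (\<integral>x. F x \<partial>lborel)"
proof -
  have "(\<integral>x. F x \<partial>lborel) = (\<integral>x. F x \<partial>distr lborel borel ((+) c))"
    by (simp add: lborel_distr_plus)
  also have "\<dots> = (\<integral>x. F (c + x) \<partial>lborel)"
    by (rule integral_distr) simp_all
  finally show ?thesis by simp
qed

lemma integrable_lborel_bounded_support:
  fixes F :: "'a::euclidean_space \<Rightarrow> real"
  assumes [measurable]: "F \<in> borel_measurable borel"
    and "\<And>w. \<bar>F w\<bar> \<le> C * indicator (cball 0 \<rho>) w"
  shows "integrable lborel F"
proof (rule Bochner_Integration.integrable_bound)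
  show "integrable lborel (\<lambda>w::'a. C * indicator (cball 0 \<rho>) w :: real)"
    using emeasure_lborel_cball_finite[of "0::'a" \<rho>]
    by (intro integrable_mult_right integrable_real_indicator) auto
  show "AE x in lborel. norm (F x) \<le> norm (C * indicator (cball 0 \<rho>) x :: real)"
    using assms(2) by (intro AE_I2) (smt (verit) real_norm_def)
qed simp

lemma sphere_null_lborel: "sphere (0::'a::euclidean_space) \<rho> \<in> null_sets lborel"
  using negligible_sphere[of "0::'a" \<rho>]
  by (auto simp: null_sets_completion_iff negligible_iff_null_sets)

lemma AE_lborel_norm_neq: "AE w in (lborel :: 'a::euclidean_space measure). norm w \<noteq> \<rho>"
  by (rule AE_I'[OF sphere_null_lborel[of \<rho>]]) auto

lemma norm_ray_derivative:
  fixes w e :: "'a::real_inner"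
  assumes "w \<noteq> 0"
  shows "((\<lambda>s. norm (w - s *\<^sub>R e)) has_real_derivative - (w \<bullet> e) / norm w) (at 0)"
proof -
  have 1: "((\<lambda>s. w - s *\<^sub>R e) has_derivative (\<lambda>h. - h *\<^sub>R e)) (at 0)"
    by (auto intro!: derivative_eq_intros)
  have 2: "(norm has_derivative (\<lambda>h. h \<bullet> sgn w)) (at (w - 0 *\<^sub>R e))"
    using has_derivative_norm[OF assms] by simp
  have "((\<lambda>s. norm (w - s *\<^sub>R e)) has_derivative (\<lambda>h. (- h *\<^sub>R e) \<bullet> sgn w)) (at 0)"
    by (rule has_derivative_compose[OF 1 2])
  then show ?thesis
    unfolding has_field_derivative_def
    by (rule has_derivative_eq_rhs)
      (auto simp: sgn_div_norm inner_commute field_simps)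
qed

text \<open>A Lipschitz cutoff in place of the indicator of the ball makes the difference quotients in the shift
  bounded, so that dominated convergence applies.\<close>

definition cutoff :: "real \<Rightarrow> 'a::real_normed_vector \<Rightarrow> real" where
  "cutoff \<epsilon> w = max 0 (min 1 ((1 - norm w) / \<epsilon>))"

lemma cutoff_measurable [measurable]: "cutoff \<epsilon> \<in> borel_measurable borel"
  unfolding cutoff_def by measurable

lemma cutoff_bounds: "0 \<le> cutoff \<epsilon> w" "cutoff \<epsilon> w \<le> 1"
  by (auto simp: cutoff_def)

lemma cutoff_eq_0: "0 < \<epsilon> \<Longrightarrow> 1 \<le> norm w \<Longrightarrow> cutoff \<epsilon> w = 0"
  by (auto simp: cutoff_def zero_le_divide_iff max_def min_def)

lemma cutoff_eq_1: "0 < \<epsilon> \<Longrightarrow> norm w \<le> 1 - \<epsilon> \<Longrightarrow> cutoff \<epsilon> w = 1"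
  by (auto simp: cutoff_def field_simps max_def min_def)

lemma cutoff_eq_mid: "0 < \<epsilon> \<Longrightarrow> 1 - \<epsilon> \<le> norm w \<Longrightarrow> norm w \<le> 1 \<Longrightarrow> cutoff \<epsilon> w = (1 - norm w) / \<epsilon>"
  by (auto simp: cutoff_def field_simps max_def min_def)

lemma cutoff_lipschitz:
  assumes "0 < \<epsilon>"
  shows "\<bar>cutoff \<epsilon> v - cutoff \<epsilon> w\<bar> \<le> norm (v - w) / \<epsilon>"
proof -
  have "\<bar>cutoff \<epsilon> v - cutoff \<epsilon> w\<bar> \<le> \<bar>(1 - norm v) / \<epsilon> - (1 - norm w) / \<epsilon>\<bar>"
    unfolding cutoff_def by linarith
  also have "\<dots> = \<bar>norm w - norm v\<bar> / \<epsilon>"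
    using assms by (simp flip: diff_divide_distrib)
  also have "\<dots> \<le> norm (v - w) / \<epsilon>"
    using assms by (intro divide_right_mono) (metis norm_minus_commute norm_triangle_ineq3, simp)
  finally show ?thesis .
qed

text \<open>The derivative of the cutoff as its centre moves in direction \<open>e\<close>: a
  multiple of the normal component of \<open>e\<close>, living on a shell of width \<epsilon> inside
  the unit sphere. It stands in for the surface measure.\<close>

definition cutoff_slope :: "real \<Rightarrow> 'a::real_inner \<Rightarrow> 'a \<Rightarrow> real" where
  "cutoff_slope \<epsilon> e w = (if 1 - \<epsilon> \<le> norm w \<and> norm w < 1 then (w \<bullet> e) / (\<epsilon> * norm w) else 0)"

text \<open>Inside, outside and within the shell the cutoff is locally constant or affine in the
  norm. Its kinks sit on two spheres, which are null sets, so their exclusion costs nothing under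
  the integral.\<close>

lemma cutoff_ray_derivative:
  fixes w e :: "'a::real_inner"
  assumes \<epsilon>: "0 < \<epsilon>" "\<epsilon> < 1" and w: "norm w \<noteq> 1 - \<epsilon>" "norm w \<noteq> 1"
  shows "((\<lambda>s. cutoff \<epsilon> (w - s *\<^sub>R e)) has_real_derivative cutoff_slope \<epsilon> e w) (at 0)"
proof -
  have cont: "((\<lambda>s. norm (w - s *\<^sub>R e)) \<longlongrightarrow> norm w) (at 0)"
    by (auto intro!: tendsto_eq_intros)
  consider "norm w < 1 - \<epsilon>" | "1 < norm w" | "1 - \<epsilon> < norm w" "norm w < 1"
    using w by linarith
  then show ?thesis
  proof cases
    case 1
    have "\<forall>\<^sub>F s in at 0. norm (w - s *\<^sub>R e) < 1 - \<epsilon>"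
      using cont 1 by (rule order_tendstoD)
    then have "\<forall>\<^sub>F s in at 0. cutoff \<epsilon> (w - s *\<^sub>R e) = 1"
      by eventually_elim (simp add: cutoff_eq_1 \<epsilon>)
    moreover have "((\<lambda>s. 1) has_real_derivative cutoff_slope \<epsilon> e w) (at (0::real))"
      using 1 by (simp add: cutoff_slope_def)
    ultimately show ?thesis
      using 1 \<epsilon> by (subst DERIV_cong_ev[OF refl _ refl]) (auto simp: eventually_nhds_conv_at cutoff_eq_1)
  next
    case 2
    have "\<forall>\<^sub>F s in at 0. 1 < norm (w - s *\<^sub>R e)"
      using cont 2 by (rule order_tendstoD)
    then have "\<forall>\<^sub>F s in at 0. cutoff \<epsilon> (w - s *\<^sub>R e) = 0"
      by eventually_elim (simp add: cutoff_eq_0 \<epsilon>)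
    moreover have "((\<lambda>s. 0) has_real_derivative cutoff_slope \<epsilon> e w) (at (0::real))"
      using 2 by (simp add: cutoff_slope_def)
    ultimately show ?thesis
      using 2 \<epsilon> by (subst DERIV_cong_ev[OF refl _ refl]) (auto simp: eventually_nhds_conv_at cutoff_eq_0)
  next
    case 3
    have "\<forall>\<^sub>F s in at 0. 1 - \<epsilon> < norm (w - s *\<^sub>R e)" "\<forall>\<^sub>F s in at 0. norm (w - s *\<^sub>R e) < 1"
      using cont 3 by (auto intro: order_tendstoD)
    then have ev: "\<forall>\<^sub>F s in at 0. cutoff \<epsilon> (w - s *\<^sub>R e) = (1 - norm (w - s *\<^sub>R e)) / \<epsilon>"
      by eventually_elim (simp add: cutoff_eq_mid \<epsilon>)
    have "w \<noteq> 0" using 3 \<epsilon> by auto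
    from norm_ray_derivative[OF this]
    have "((\<lambda>s. (1 - norm (w - s *\<^sub>R e)) / \<epsilon>) has_real_derivative cutoff_slope \<epsilon> e w) (at 0)"
      using 3 \<epsilon> \<open>w \<noteq> 0\<close> by (auto intro!: derivative_eq_intros simp: cutoff_slope_def)
    then show ?thesis
      using 3 \<epsilon> ev by (subst DERIV_cong_ev[OF refl _ refl]) (auto simp: eventually_nhds_conv_at cutoff_eq_mid)
  qed
qed

text \<open>Moving the cutoff by \<open>s *\<^sub>R e\<close> amounts, by translation invariance, to
  moving \<open>F\<close>. Convexity on the segment from \<open>w\<close> to \<open>w + e\<close>
  bounds the increment of \<open>F\<close> by the fraction \<open>s\<close> of the full one, and the
  Lipschitz bound removes \<open>w\<close> from both end values, each time at cost \<open>L\<close>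
  since \<open>norm w \<le> 1\<close>. The second claim provides a dominating function that does not
  depend on \<open>s\<close>.\<close>

lemma convex_on_average_bound:
  fixes F :: "'a::euclidean_space \<Rightarrow> real"
  assumes F [measurable]: "F \<in> borel_measurable borel"
    and S: "convex S" "cball 0 1 \<subseteq> S" "cball e 1 \<subseteq> S"
    and conv: "convex_on S F" and lip: "\<And>v w. v \<in> S \<Longrightarrow> w \<in> S \<Longrightarrow> \<bar>F v - F w\<bar> \<le> L * norm (v - w)"
    and L: "0 \<le> L" and s: "0 < s" "s \<le> 1" and \<epsilon>: "0 < \<epsilon>" "\<epsilon> < 1"
  defines "K \<equiv> \<bar>F 0\<bar> + L * (1 + norm e)"
  shows "(\<integral>w. F w * ((cutoff \<epsilon> (w - s *\<^sub>R e) - cutoff \<epsilon> w) / s) \<partial>lborel)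
      \<le> (F e - F 0 + 2 * L) * (\<integral>w. cutoff \<epsilon> (w::'a) \<partial>lborel)" (is "?thesis1")
    and "\<And>w. \<bar>F w * ((cutoff \<epsilon> (w - s *\<^sub>R e) - cutoff \<epsilon> w) / s)\<bar>
      \<le> K * norm e / \<epsilon> * indicator (cball 0 (1 + norm e)) w" (is "PROP ?thesis2")
    and "\<And>w. w \<in> cball 0 1 \<Longrightarrow> \<bar>F w\<bar> \<le> K"
proof -
  \<comment> \<open>The whole segment from \<open>w\<close> to \<open>w + e\<close> lies in
    \<open>S\<close> because its ends lie in the two balls. This covers the unit ball as well as its
    translates.\<close>
  have K: "\<bar>F (w + t *\<^sub>R e)\<bar> \<le> K" "w + t *\<^sub>R e \<in> S" if "norm w \<le> 1" "0 \<le> t" "t \<le> 1" for w t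
  proof -
    have "w \<in> S" "w + e \<in> S"
      using that S by (auto simp: subset_eq dist_norm)
    then have "(1 - t) *\<^sub>R w + t *\<^sub>R (w + e) \<in> S"
      using S(1) that by (intro convexD) auto
    then show *: "w + t *\<^sub>R e \<in> S"
      by (simp add: algebra_simps)
    have "0 \<in> S" using S by auto
    have "\<bar>F (w + t *\<^sub>R e) - F 0\<bar> \<le> L * norm (w + t *\<^sub>R e - 0)"
      by (rule lip) fact+
    also have "\<dots> \<le> L * (1 + norm e)"
    proof (rule mult_left_mono[OF _ L])
      have "t * norm e \<le> 1 * norm e" using that by (intro mult_right_mono) auto
      then show "norm (w + t *\<^sub>R e - 0) \<le> 1 + norm e"
        using norm_triangle_ineq[of w "t *\<^sub>R e"] that by simp
    qed
    finally show "\<bar>F (w + t *\<^sub>R e)\<bar> \<le> K"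
      unfolding K_def by linarith
  qed
  show K0: "\<bar>F w\<bar> \<le> K" if "w \<in> cball 0 1" for w
    using K(1)[of w 0] that by simp
  have "0 \<le> K" unfolding K_def using L by simp
  have Ks: "\<bar>F w\<bar> \<le> K" if "norm (w - s *\<^sub>R e) \<le> 1" for w
    using K(1)[of "w - s *\<^sub>R e" s] that s by simp
  show bd: "\<bar>F w * ((cutoff \<epsilon> (w - s *\<^sub>R e) - cutoff \<epsilon> w) / s)\<bar>
      \<le> K * norm e / \<epsilon> * indicator (cball 0 (1 + norm e)) w" for w
  proof (cases "norm w \<le> 1 \<or> norm (w - s *\<^sub>R e) \<le> 1")
    case True
    then have 1: "\<bar>F w\<bar> \<le> K" using K0 Ks by auto
    have "s * norm e \<le> 1 * norm e" using s by (intro mult_right_mono) auto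
    then have "norm w \<le> 1 + norm e"
      using True norm_triangle_ineq[of "w - s *\<^sub>R e" "s *\<^sub>R e"] s by (auto simp: add_increasing2)
    moreover have "\<bar>(cutoff \<epsilon> (w - s *\<^sub>R e) - cutoff \<epsilon> w) / s\<bar> \<le> norm e / \<epsilon>"
      using cutoff_lipschitz[OF \<epsilon>(1), of "w - s *\<^sub>R e" w] s \<epsilon> by (simp add: field_simps)
    with 1 have "\<bar>F w * ((cutoff \<epsilon> (w - s *\<^sub>R e) - cutoff \<epsilon> w) / s)\<bar> \<le> K * (norm e / \<epsilon>)"
      unfolding abs_mult by (intro mult_mono) (use \<open>0 \<le> K\<close> in auto)
    ultimately show ?thesis by simp
  next
    case False
    then have "cutoff \<epsilon> (w - s *\<^sub>R e) = 0" "cutoff \<epsilon> w = 0"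
      by (auto intro!: cutoff_eq_0 \<epsilon>)
    then show ?thesis
      using \<open>0 \<le> K\<close> \<epsilon> by simp
  qed
  have bd1: "\<bar>F w * cutoff \<epsilon> w\<bar> \<le> K * indicator (cball 0 1) w" for w
    using K0[of w] \<open>0 \<le> K\<close> cutoff_bounds[of \<epsilon> w] mult_mono[of "\<bar>F w\<bar>" K "cutoff \<epsilon> w" 1] cutoff_eq_0[OF \<epsilon>(1), of w]
    by (cases "norm w \<le> 1") (auto simp: abs_mult)
  have int1: "integrable lborel (\<lambda>w. F w * cutoff \<epsilon> w)"
    by (rule integrable_lborel_bounded_support[OF _ bd1]) simp
  have bd2: "\<bar>F (s *\<^sub>R e + w) * cutoff \<epsilon> w\<bar> \<le> K * indicator (cball 0 1) w" for w
    using K(1)[of w s] s \<open>0 \<le> K\<close> cutoff_bounds[of \<epsilon> w] mult_mono[of "\<bar>F (s *\<^sub>R e + w)\<bar>" K "cutoff \<epsilon> w" 1] cutoff_eq_0[OF \<epsilon>(1), of w]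
    by (cases "norm w \<le> 1") (auto simp: abs_mult add.commute)
  have int2: "integrable lborel (\<lambda>w. F (s *\<^sub>R e + w) * cutoff \<epsilon> w)"
    by (rule integrable_lborel_bounded_support[OF _ bd2]) simp
  have bd3: "\<bar>F w * cutoff \<epsilon> (w - s *\<^sub>R e)\<bar> \<le> K * indicator (cball 0 (1 + norm e)) w" for w
  proof (cases "norm (w - s *\<^sub>R e) \<le> 1")
    case True
    have "s * norm e \<le> 1 * norm e" using s by (intro mult_right_mono) auto
    then have "norm w \<le> 1 + norm e"
      using True norm_triangle_ineq[of "w - s *\<^sub>R e" "s *\<^sub>R e"] s by auto
    then show ?thesis
      using Ks[OF True] \<open>0 \<le> K\<close> cutoff_bounds[of \<epsilon> "w - s *\<^sub>R e"]
        mult_mono[of "\<bar>F w\<bar>" K "cutoff \<epsilon> (w - s *\<^sub>R e)" 1]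
      by (auto simp: abs_mult)
  next
    case False
    then show ?thesis
      using cutoff_eq_0[OF \<epsilon>(1), of "w - s *\<^sub>R e"] \<open>0 \<le> K\<close> by simp
  qed
  have int3: "integrable lborel (\<lambda>w. F w * cutoff \<epsilon> (w - s *\<^sub>R e))"
    by (rule integrable_lborel_bounded_support[OF _ bd3]) simp
  have intc: "integrable lborel (\<lambda>w::'a. cutoff \<epsilon> w)"
  proof (rule integrable_lborel_bounded_support)
    show "\<bar>cutoff \<epsilon> w\<bar> \<le> 1 * indicator (cball 0 1) w" for w :: 'a
      using cutoff_bounds[of \<epsilon> w] cutoff_eq_0[OF \<epsilon>(1), of w] by (cases "norm w \<le> 1") auto
  qed simp
  have "(\<integral>w. F w * (cutoff \<epsilon> (w - s *\<^sub>R e) - cutoff \<epsilon> w) \<partial>lborel)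
      = (\<integral>w. F w * cutoff \<epsilon> (w - s *\<^sub>R e) \<partial>lborel) - (\<integral>w. F w * cutoff \<epsilon> w \<partial>lborel)"
    using int1 int3 by (simp add: right_diff_distrib)
  also have "(\<integral>w. F w * cutoff \<epsilon> (w - s *\<^sub>R e) \<partial>lborel) = (\<integral>w. F (s *\<^sub>R e + w) * cutoff \<epsilon> w \<partial>lborel)"
    by (subst integral_lborel_translate[symmetric, where c = "s *\<^sub>R e"]) simp_all
  also have "\<dots> - (\<integral>w. F w * cutoff \<epsilon> w \<partial>lborel) = (\<integral>w. (F (s *\<^sub>R e + w) - F w) * cutoff \<epsilon> w \<partial>lborel)"
    using int1 int2 by (simp add: left_diff_distrib)
  also have "\<dots> \<le> (\<integral>w. s * ((F e - F 0 + 2 * L) * cutoff \<epsilon> (w::'a)) \<partial>lborel)"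
  proof (rule Bochner_Integration.integral_mono)
    show "integrable lborel (\<lambda>w. (F (s *\<^sub>R e + w) - F w) * cutoff \<epsilon> w)"
      using int1 int2 by (simp add: left_diff_distrib)
    show "integrable lborel (\<lambda>w::'a. s * ((F e - F 0 + 2 * L) * cutoff \<epsilon> w))"
      using intc by simp
    fix w :: 'a
    show "(F (s *\<^sub>R e + w) - F w) * cutoff \<epsilon> w \<le> s * ((F e - F 0 + 2 * L) * cutoff \<epsilon> w)"
    proof (cases "norm w \<le> 1")
      case True
      then have w: "w \<in> S" "w + e \<in> S" "0 \<in> S" "e \<in> S"
        using S by (auto simp: subset_eq dist_norm)
      have "F ((1 - s) *\<^sub>R w + s *\<^sub>R (w + e)) \<le> (1 - s) * F w + s * F (w + e)"
        using conv w s by (intro convex_onD) auto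
      then have 1: "F (s *\<^sub>R e + w) - F w \<le> s * (F (w + e) - F w)"
        by (simp add: algebra_simps)
      have "\<bar>F (w + e) - F e\<bar> \<le> L * norm w" "\<bar>F w - F 0\<bar> \<le> L * norm w"
        using lip[of "w + e" e] lip[of w 0] w by auto
      moreover have "L * norm w \<le> L" using mult_left_mono[OF True L] by simp
      ultimately have "F (w + e) - F w \<le> F e - F 0 + 2 * L"
        by linarith
      then have "F (s *\<^sub>R e + w) - F w \<le> s * (F e - F 0 + 2 * L)"
        using 1 s by (meson less_eq_real_def mult_left_mono order_trans)
      then show ?thesis
        using mult_right_mono[OF _ cutoff_bounds(1)[of \<epsilon> w]] by (fastforce simp: mult.assoc)
    next
      case False
      then show ?thesis using cutoff_eq_0[OF \<epsilon>(1), of w] by simp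
    qed
  qed
  finally have *: "(\<integral>w. F w * (cutoff \<epsilon> (w - s *\<^sub>R e) - cutoff \<epsilon> w) \<partial>lborel)
      \<le> s * ((F e - F 0 + 2 * L) * (\<integral>w. cutoff \<epsilon> (w::'a) \<partial>lborel))"
    by simp
  have "(\<integral>w. F w * ((cutoff \<epsilon> (w - s *\<^sub>R e) - cutoff \<epsilon> w) / s) \<partial>lborel)
      = (\<integral>w. F w * (cutoff \<epsilon> (w - s *\<^sub>R e) - cutoff \<epsilon> w) \<partial>lborel) / s"
    by simp
  with * s show ?thesis1
    by (simp add: field_simps)
qed

lemma cutoff_slope_measurable [measurable]:
  fixes e :: "'a::euclidean_space"
  shows "cutoff_slope \<epsilon> e \<in> borel_measurable borel"
  unfolding cutoff_slope_def by measurable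

text \<open>The limit of the preceding estimate as \<open>s\<close> tends to 0: the difference
  quotients of the cutoff converge off two null spheres and are dominated uniformly in
  \<open>s\<close>.\<close>

lemma shell_integral_bound:
  fixes F :: "'a::euclidean_space \<Rightarrow> real"
  assumes F [measurable]: "F \<in> borel_measurable borel"
    and S: "convex S" "cball 0 1 \<subseteq> S" "cball e 1 \<subseteq> S"
    and conv: "convex_on S F" and lip: "\<And>v w. v \<in> S \<Longrightarrow> w \<in> S \<Longrightarrow> \<bar>F v - F w\<bar> \<le> L * norm (v - w)"
    and L: "0 \<le> L" and \<epsilon>: "0 < \<epsilon>" "\<epsilon> < 1"
  shows "(\<integral>w. F w * cutoff_slope \<epsilon> e w \<partial>lborel)
      \<le> (F e - F 0 + 2 * L) * (\<integral>w. cutoff \<epsilon> (w::'a) \<partial>lborel)"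
proof (rule LIMSEQ_le_const2)
  define K where "K = \<bar>F 0\<bar> + L * (1 + norm e)"
  define s :: "nat \<Rightarrow> real" where "s n = inverse (real (Suc n))" for n
  have s: "0 < s n" "s n \<le> 1" for n
    by (auto simp: s_def field_simps)
  note bnds = convex_on_average_bound[OF F S conv lip L s \<epsilon>]
  show "(\<lambda>n. \<integral>w. F w * ((cutoff \<epsilon> (w - s n *\<^sub>R e) - cutoff \<epsilon> w) / s n) \<partial>lborel)
      \<longlonglongrightarrow> (\<integral>w. F w * cutoff_slope \<epsilon> e w \<partial>lborel)"
  proof (rule integral_dominated_convergence)
    have "integrable lborel (\<lambda>w::'a. K * norm e / \<epsilon> * indicator (cball 0 (1 + norm e)) w)"
      using emeasure_lborel_cball_finite[of "0::'a" "1 + norm e"]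
      by (intro integrable_mult_right integrable_real_indicator) auto
    then show "integrable lborel (\<lambda>w::'a. K * norm e / \<epsilon> * indicator (cball 0 (1 + norm e)) w)" .
    show "AE w in lborel. norm (F w * ((cutoff \<epsilon> (w - s n *\<^sub>R e) - cutoff \<epsilon> w) / s n))
        \<le> K * norm e / \<epsilon> * indicator (cball 0 (1 + norm e)) w" for n
      using bnds(2) unfolding K_def by (intro AE_I2) simp
    have s0: "filterlim s (at 0) sequentially"
      unfolding filterlim_at s_def using LIMSEQ_inverse_real_of_nat by (auto intro!: always_eventually)
    show "AE w in lborel. (\<lambda>n. F w * ((cutoff \<epsilon> (w - s n *\<^sub>R e) - cutoff \<epsilon> w) / s n))
        \<longlonglongrightarrow> F w * cutoff_slope \<epsilon> e w"
      using AE_lborel_norm_neq[of 1] AE_lborel_norm_neq[of "1 - \<epsilon>"]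
    proof eventually_elim
      case (elim w)
      from cutoff_ray_derivative[OF \<epsilon> elim(2,1), of e]
      have "((\<lambda>t. (cutoff \<epsilon> (w - t *\<^sub>R e) - cutoff \<epsilon> w) / t) \<longlongrightarrow> cutoff_slope \<epsilon> e w) (at 0)"
        by (simp add: DERIV_def)
      from filterlim_compose[OF this s0]
      show ?case by (rule tendsto_mult_left)
    qed
  qed simp_all
  show "\<exists>N. \<forall>n\<ge>N. (\<integral>w. F w * ((cutoff \<epsilon> (w - s n *\<^sub>R e) - cutoff \<epsilon> w) / s n) \<partial>lborel)
      \<le> (F e - F 0 + 2 * L) * (\<integral>w. cutoff \<epsilon> (w::'a) \<partial>lborel)"
    using bnds(1) by auto
qed

text \<open>For functions of the direction alone, this turns an integral over a thin shell into a
  multiple of the integral over the unit ball.\<close>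

lemma integral_ball_homogeneous:
  fixes H :: "'a::euclidean_space \<Rightarrow> real"
  assumes [measurable]: "H \<in> borel_measurable borel"
    and "\<And>c w. 0 < c \<Longrightarrow> H (c *\<^sub>R w) = H w" and "0 < \<rho>"
  shows "(\<integral>w. H w * indicator (ball 0 \<rho>) w \<partial>lborel) = \<rho> ^ DIM('a) * (\<integral>w. H w * indicator (ball 0 1) w \<partial>lborel)"
  using assms(2,3) by (subst integral_lborel_scaleR[of _ \<rho>]) (auto simp: indicator_def)

text \<open>Let the shell shrink. On it \<open>F\<close> may be replaced by its value at the radial
  projection, at distance at most \<epsilon>; divided by \<epsilon> the error stays below
  \<open>L * norm e\<close>, and it is integrated over a vanishing volume. The new integrand depends
  on the direction only, so the shell contributes the fraction \<open>a \<epsilon>\<close> of the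
  ball integral. The factor \<open>DIM('a)\<close> is the limit of
  \<open>a \<epsilon> / \<epsilon>\<close> and matches the factor \<open>CARD('p)\<close> in
  \<open>grad_est\<close>.\<close>

lemma sphere_average_bound:
  fixes F :: "'a::euclidean_space \<Rightarrow> real"
  assumes F [measurable]: "F \<in> borel_measurable borel"
    and S: "convex S" "cball 0 1 \<subseteq> S" "cball e 1 \<subseteq> S"
    and conv: "convex_on S F" and lip: "\<And>v w. v \<in> S \<Longrightarrow> w \<in> S \<Longrightarrow> \<bar>F v - F w\<bar> \<le> L * norm (v - w)"
    and L: "0 \<le> L"
  shows "DIM('a) * (\<integral>w. F (w /\<^sub>R norm w) * ((w /\<^sub>R norm w) \<bullet> e) * indicator (ball 0 1) w \<partial>lborel)
      \<le> (F e - F 0 + 2 * L) * measure lborel (ball (0::'a) 1)"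
proof -
  define H where "H w = F (w /\<^sub>R norm w) * ((w /\<^sub>R norm w) \<bullet> e)" for w
  define I where "I = (\<integral>w. H w * indicator (ball 0 1) w \<partial>lborel)"
  define V where "V = measure lborel (ball (0::'a) 1)"
  define D where "D = F e - F 0 + 2 * L"
  define K where "K = \<bar>F 0\<bar> + L * (1 + norm e)"
  define p where "p = DIM('a)"
  \<comment> \<open>The fraction of the volume of the unit ball that lies in the shell.\<close>
  define a where "a \<epsilon> = 1 - (1 - \<epsilon>) ^ p" for \<epsilon> :: real
  have H [measurable]: "H \<in> borel_measurable borel"
    unfolding H_def by measurable
  have Hhom: "H (c *\<^sub>R w) = H w" if "0 < c" for c w
  proof -
    have "inverse c * inverse (norm w) * c = inverse (norm w)"
      using that by (simp add: field_simps)
    then have "(c *\<^sub>R w) /\<^sub>R norm (c *\<^sub>R w) = w /\<^sub>R norm w"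
      using that by (simp only: norm_scaleR abs_of_pos inverse_mult_distrib scaleR_scaleR)
    then show ?thesis by (simp only: H_def)
  qed
  have K0: "\<bar>F w\<bar> \<le> K" if "w \<in> cball 0 1" for w
    using convex_on_average_bound(3)[OF F S conv lip L, of 1 "1/2" w] that by (simp add: K_def)
  then have "0 \<le> K" using abs_ge_zero[of "F 0"] by (smt (verit) mem_cball dist_self)
  have Hbd: "\<bar>H w\<bar> \<le> K * norm e" for w
  proof -
    have n: "norm (w /\<^sub>R norm w) \<le> 1" by (cases "w = 0") auto
    have "\<bar>(w /\<^sub>R norm w) \<bullet> e\<bar> \<le> norm (w /\<^sub>R norm w) * norm e"
      by (rule Cauchy_Schwarz_ineq2)
    also have "\<dots> \<le> 1 * norm e"
      by (rule mult_right_mono[OF n]) simp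
    finally have "\<bar>(w /\<^sub>R norm w) \<bullet> e\<bar> \<le> norm e" by simp
    moreover have "\<bar>F (w /\<^sub>R norm w)\<bar> \<le> K"
      using n by (intro K0) simp
    ultimately show ?thesis
      unfolding H_def abs_mult by (intro mult_mono) (use \<open>0 \<le> K\<close> in auto)
  qed
  have [measurable]: "ball (0::'a) \<rho> \<in> sets borel" for \<rho>
    by simp
  have intH: "integrable lborel (\<lambda>w. H w * indicator (ball 0 \<rho>) w)" for \<rho>
  proof (rule integrable_lborel_bounded_support)
    show "\<bar>H w * indicator (ball 0 \<rho>) w\<bar> \<le> K * norm e * indicator (cball 0 \<rho>) w" for w
      using Hbd[of w] by (auto simp: indicator_def)
  qed measurable
  have ball_meas: "measure lborel (ball (0::'a) \<rho>) = \<rho> ^ p * V" if "0 < \<rho>" for \<rho>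
    using content_ball_conv_unit_ball[of \<rho> "0::'a"] that unfolding V_def p_def by simp
  have step: "a \<epsilon> / \<epsilon> * I \<le> D * (\<integral>w. cutoff \<epsilon> (w::'a) \<partial>lborel) + L * norm e * (a \<epsilon> * V)"
    if \<epsilon>: "0 < \<epsilon>" "\<epsilon> < 1" for \<epsilon>
  proof -
    let ?sh = "\<lambda>w::'a. indicator (ball 0 1) w - indicator (ball 0 (1 - \<epsilon>)) w :: real"
    have sh: "?sh w = (if 1 - \<epsilon> \<le> norm w \<and> norm w < 1 then 1 else 0)" for w
      using \<epsilon> by (auto simp: indicator_def)
    have int_ball: "integrable lborel (indicator (ball (0::'a) \<rho>) :: 'a \<Rightarrow> real)" for \<rho>
      using emeasure_lborel_ball_finite[of "0::'a" \<rho>] by (intro integrable_real_indicator) auto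
    have int_sh: "integrable lborel ?sh"
      using int_ball by simp
    have bdG: "\<bar>F w * cutoff_slope \<epsilon> e w\<bar> \<le> K * (norm e / \<epsilon>) * indicator (cball 0 1) w" for w
    proof (cases "1 - \<epsilon> \<le> norm w \<and> norm w < 1")
      case True
      then have "w \<noteq> 0" using \<epsilon> by auto
      then have "\<bar>cutoff_slope \<epsilon> e w\<bar> \<le> norm e / \<epsilon>"
        using True \<epsilon> Cauchy_Schwarz_ineq2[of w e] by (auto simp: cutoff_slope_def field_simps abs_mult)
      then have "\<bar>F w * cutoff_slope \<epsilon> e w\<bar> \<le> K * (norm e / \<epsilon>)"
        unfolding abs_mult using True \<open>0 \<le> K\<close> by (intro mult_mono K0) auto
      then show ?thesis using True by simp
    next
      case False
      then show ?thesis using \<epsilon> \<open>0 \<le> K\<close> by (auto simp: cutoff_slope_def)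
    qed
    have intG: "integrable lborel (\<lambda>w. F w * cutoff_slope \<epsilon> e w)"
      by (rule integrable_lborel_bounded_support[OF _ bdG]) simp
    have intS: "integrable lborel (\<lambda>w. H w / \<epsilon> * ?sh w)"
      using intH[of 1] intH[of "1 - \<epsilon>"] by (simp add: right_diff_distrib)
    have "a \<epsilon> / \<epsilon> * I = (\<integral>w. H w / \<epsilon> * ?sh w \<partial>lborel)"
    proof -
      have "(\<integral>w. H w / \<epsilon> * ?sh w \<partial>lborel) = (\<integral>w. (H w * indicator (ball 0 1) w - H w * indicator (ball 0 (1 - \<epsilon>)) w) / \<epsilon> \<partial>lborel)"
        by (intro Bochner_Integration.integral_cong) (auto simp: right_diff_distrib diff_divide_distrib)
      also have "\<dots> = (I - (1 - \<epsilon>) ^ p * I) / \<epsilon>"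
        using intH[of 1] intH[of "1 - \<epsilon>"] integral_ball_homogeneous[OF H Hhom, of "1 - \<epsilon>"] \<epsilon>
        by (simp add: I_def p_def)
      finally show ?thesis by (simp only: a_def left_diff_distrib times_divide_eq_left mult_1_left)
    qed
    also have "\<dots> \<le> (\<integral>w. F w * cutoff_slope \<epsilon> e w + L * norm e * ?sh w \<partial>lborel)"
    proof (rule Bochner_Integration.integral_mono[OF intS])
      show "integrable lborel (\<lambda>w. F w * cutoff_slope \<epsilon> e w + L * norm e * ?sh w)"
        using intG int_sh by simp
      fix w :: 'a
      show "H w / \<epsilon> * ?sh w \<le> F w * cutoff_slope \<epsilon> e w + L * norm e * ?sh w"
      proof (cases "1 - \<epsilon> \<le> norm w \<and> norm w < 1")
        case True
        then have "w \<noteq> 0" using \<epsilon> by auto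
        define v where "v = w /\<^sub>R norm w"
        have Hv: "H w = F v * (v \<bullet> e)" by (simp add: H_def v_def)
        have v: "norm v = 1" using \<open>w \<noteq> 0\<close> by (simp add: v_def)
        have sl: "cutoff_slope \<epsilon> e w = (v \<bullet> e) / \<epsilon>"
          using True \<open>w \<noteq> 0\<close> by (simp add: cutoff_slope_def v_def field_simps)
        have "norm (v - w) = 1 - norm w"
        proof -
          have "v - w = (1 - norm w) *\<^sub>R v"
            using \<open>w \<noteq> 0\<close> by (simp add: v_def algebra_simps)
          then show ?thesis using True v by simp
        qed
        moreover have "\<bar>F v - F w\<bar> \<le> L * norm (v - w)"
          using S(2) True v by (intro lip) auto
        moreover have "L * (1 - norm w) \<le> L * \<epsilon>"
          using True L by (intro mult_left_mono) auto
        ultimately have 1: "\<bar>F v - F w\<bar> \<le> L * \<epsilon>" by simp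
        have "\<bar>v \<bullet> e\<bar> \<le> norm e"
          using Cauchy_Schwarz_ineq2[of v e] v by simp
        with 1 have "\<bar>F v - F w\<bar> * \<bar>v \<bullet> e\<bar> \<le> L * \<epsilon> * norm e"
          by (rule mult_mono) (use L \<epsilon> in auto)
        then have "(F v - F w) * (v \<bullet> e) \<le> L * \<epsilon> * norm e"
          unfolding abs_mult[symmetric] by linarith
        then show ?thesis
          using True \<epsilon> unfolding sh sl Hv by (simp add: field_simps)
      next
        case False
        then show ?thesis unfolding sh by (auto simp: cutoff_slope_def)
      qed
    qed
    also have "\<dots> = (\<integral>w. F w * cutoff_slope \<epsilon> e w \<partial>lborel) + L * norm e * (a \<epsilon> * V)"
    proof -
      have "(\<integral>w. ?sh w \<partial>lborel) = a \<epsilon> * V"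
        using int_ball ball_meas[of "1 - \<epsilon>"] \<epsilon> by (simp add: a_def V_def left_diff_distrib)
      then show ?thesis
        using intG int_sh by (simp del: Bochner_Integration.integral_diff)
    qed
    also have "(\<integral>w. F w * cutoff_slope \<epsilon> e w \<partial>lborel) \<le> D * (\<integral>w. cutoff \<epsilon> (w::'a) \<partial>lborel)"
      unfolding D_def by (rule shell_integral_bound[OF F S conv lip L \<epsilon>])
    finally show ?thesis by simp
  qed
  have cutV: "(1 - \<epsilon>) ^ p * V \<le> (\<integral>w. cutoff \<epsilon> (w::'a) \<partial>lborel)" "(\<integral>w. cutoff \<epsilon> (w::'a) \<partial>lborel) \<le> V"
    if \<epsilon>: "0 < \<epsilon>" "\<epsilon> < 1" for \<epsilon>
  proof -
    have int_ball: "integrable lborel (indicator (ball (0::'a) \<rho>) :: 'a \<Rightarrow> real)" for \<rho>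
      using emeasure_lborel_ball_finite[of "0::'a" \<rho>] by (intro integrable_real_indicator) auto
    have le1: "cutoff \<epsilon> w \<le> indicator (ball 0 1) w" for w :: 'a
      using cutoff_bounds[of \<epsilon> w] cutoff_eq_0[OF \<epsilon>(1), of w] by (auto simp: indicator_def)
    have intc: "integrable lborel (\<lambda>w::'a. cutoff \<epsilon> w)"
      by (rule Bochner_Integration.integrable_bound[OF int_ball[of 1]])
        (use le1 in \<open>auto intro!: AE_I2 simp: abs_of_nonneg[OF cutoff_bounds(1)]\<close>)
    have "(\<integral>w. indicator (ball 0 (1 - \<epsilon>)) (w::'a) \<partial>lborel) \<le> (\<integral>w. cutoff \<epsilon> (w::'a) \<partial>lborel)"
      by (rule Bochner_Integration.integral_mono[OF int_ball intc])
        (auto simp: indicator_def cutoff_bounds cutoff_eq_1[OF \<epsilon>(1)])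
    then show "(1 - \<epsilon>) ^ p * V \<le> (\<integral>w. cutoff \<epsilon> (w::'a) \<partial>lborel)"
      using ball_meas[of "1 - \<epsilon>"] \<epsilon> by simp
    have "(\<integral>w. cutoff \<epsilon> (w::'a) \<partial>lborel) \<le> (\<integral>w. indicator (ball 0 1) (w::'a) \<partial>lborel)"
      by (rule Bochner_Integration.integral_mono[OF intc int_ball le1])
    then show "(\<integral>w. cutoff \<epsilon> (w::'a) \<partial>lborel) \<le> V"
      by (simp add: V_def)
  qed
  define \<epsilon> :: "nat \<Rightarrow> real" where "\<epsilon> n = inverse (real (Suc (Suc n)))" for n
  have \<epsilon>: "0 < \<epsilon> n" "\<epsilon> n < 1" for n
    by (auto simp: \<epsilon>_def field_simps)
  have \<epsilon>0: "\<epsilon> \<longlonglongrightarrow> 0"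
    unfolding \<epsilon>_def using LIMSEQ_inverse_real_of_nat LIMSEQ_Suc by blast
  then have \<epsilon>at: "filterlim \<epsilon> (at 0) sequentially"
    unfolding filterlim_at using \<epsilon>(1) by (auto intro!: always_eventually simp: less_imp_neq[symmetric])
  have "((\<lambda>x. (1 - x) ^ p) has_real_derivative - real p) (at 0)"
    by (auto intro!: derivative_eq_intros)
  then have "((\<lambda>x. - (((1 - x) ^ p - 1) / x)) \<longlongrightarrow> - (- real p)) (at 0)"
    unfolding DERIV_def by (intro tendsto_minus) simp
  then have "((\<lambda>x. a x / x) \<longlongrightarrow> real p) (at 0)"
    by (simp add: a_def minus_divide_left)
  then have lim1: "(\<lambda>n. a (\<epsilon> n) / \<epsilon> n) \<longlonglongrightarrow> real p"
    using \<epsilon>at by (rule filterlim_compose)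
  have lim2: "(\<lambda>n. a (\<epsilon> n)) \<longlonglongrightarrow> 0"
    unfolding a_def using \<epsilon>0 by (auto intro!: tendsto_eq_intros)
  have lim3: "(\<lambda>n. \<integral>w. cutoff (\<epsilon> n) (w::'a) \<partial>lborel) \<longlonglongrightarrow> V"
  proof (rule tendsto_sandwich)
    show "(\<lambda>n. (1 - \<epsilon> n) ^ p * V) \<longlonglongrightarrow> V"
      using \<epsilon>0 by (auto intro!: tendsto_eq_intros)
    show "(\<lambda>n. V) \<longlonglongrightarrow> V" by simp
  qed (use cutV \<epsilon> in auto)
  have "real p * I \<le> D * V + L * norm e * (0 * V)"
  proof (rule LIMSEQ_le)
    show "(\<lambda>n. a (\<epsilon> n) / \<epsilon> n * I) \<longlonglongrightarrow> real p * I"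
      using lim1 by (rule tendsto_mult_right)
    show "(\<lambda>n. D * (\<integral>w. cutoff (\<epsilon> n) (w::'a) \<partial>lborel) + L * norm e * (a (\<epsilon> n) * V))
        \<longlonglongrightarrow> D * V + L * norm e * (0 * V)"
      using lim2 lim3 by (intro tendsto_intros)
    show "\<exists>N. \<forall>n\<ge>N. a (\<epsilon> n) / \<epsilon> n * I
        \<le> D * (\<integral>w. cutoff (\<epsilon> n) (w::'a) \<partial>lborel) + L * norm e * (a (\<epsilon> n) * V)"
      using step \<epsilon> by blast
  qed
  then show ?thesis
    by (simp add: p_def I_def H_def D_def V_def)
qed

section \<open>The uniform law on the unit sphere and the bias of the two-point estimate\<close>

lemma measure_unit_ball_pos: "0 < measure lborel (ball (0::'a::euclidean_space) 1)"
  using content_ball_pos[of 1 "0::'a"] by simp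

lemma cball_unit_emeasure:
  "emeasure lborel (cball (0::'a::euclidean_space) 1) = ennreal (measure lborel (ball (0::'a) 1))"
proof -
  have "emeasure lborel (ball (0::'a) 1 \<union> sphere 0 1) = emeasure lborel (ball (0::'a) 1)"
    by (intro emeasure_Un_null_set sphere_null_lborel) auto
  moreover have "ball (0::'a) 1 \<union> sphere 0 1 = cball 0 1"
    by auto
  ultimately show ?thesis
    using emeasure_lborel_ball_finite[of "0::'a" 1] by (auto simp: emeasure_eq_ennreal_measure)
qed

lemma prob_space_sphere_uniform: "prob_space (sphere_uniform :: (real ^ 'p) measure)"
proof -
  have "prob_space (uniform_measure lborel (cball (0::real^'p) 1))"
    using measure_unit_ball_pos[where 'a = "real^'p"]
    by (intro prob_space_uniform_measure) (simp_all add: cball_unit_emeasure)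
  then show ?thesis
    unfolding sphere_uniform_def by (rule prob_space.prob_space_distr) simp
qed

lemma sets_sphere_uniform [measurable_cong]: "sets sphere_uniform = sets borel"
  by (simp add: sphere_uniform_def)

lemma integral_sphere_uniform:
  fixes H :: "real ^ 'p \<Rightarrow> real"
  assumes [measurable]: "H \<in> borel_measurable borel"
  shows "(\<integral>u. H u \<partial>sphere_uniform)
    = (\<integral>w. H (w /\<^sub>R norm w) * indicator (ball 0 1) w \<partial>lborel) / measure lborel (ball (0::real ^ 'p) 1)"
proof -
  define V where "V = measure lborel (ball (0::real ^ 'p) 1)"
  have V: "0 < V" unfolding V_def by (rule measure_unit_ball_pos)
  have [measurable]: "ball (0::real^'p) 1 \<in> sets borel" "cball (0::real^'p) 1 \<in> sets borel"
    by simp_all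
  have "(\<integral>u. H u \<partial>sphere_uniform) = (\<integral>w. H (w /\<^sub>R norm w) \<partial>uniform_measure lborel (cball 0 1))"
    unfolding sphere_uniform_def by (rule integral_distr) simp_all
  also have "uniform_measure lborel (cball 0 1)
      = density lborel (\<lambda>w::real^'p. ennreal (indicator (cball 0 1) w / V))"
    unfolding uniform_measure_def using V
    by (intro density_cong) (auto simp: cball_unit_emeasure V_def[symmetric] indicator_def divide_ennreal ennreal_1[symmetric] simp del: ennreal_1)
  also have "(\<integral>w. H (w /\<^sub>R norm w) \<partial>density lborel (\<lambda>w::real^'p. ennreal (indicator (cball 0 1) w / V)))
      = (\<integral>w. (indicator (cball 0 1) w / V) *\<^sub>R H (w /\<^sub>R norm w) \<partial>lborel)"
  proof (rule integral_density)
    show "AE w in lborel. 0 \<le> (indicator (cball 0 1) w / V :: real)"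
      using V by (intro AE_I2) simp
  qed measurable
  \<comment> \<open>\<open>sphere_uniform\<close> is built on the closed ball, the estimates above
    on the open one; the sphere between them is a null set.\<close>
  also have "\<dots> = (\<integral>w. (H (w /\<^sub>R norm w) * indicator (ball 0 1) w) / V \<partial>lborel)"
  proof (rule integral_cong_AE)
    show "AE w in lborel. (indicator (cball 0 1) w / V) *\<^sub>R H (w /\<^sub>R norm w)
        = (H (w /\<^sub>R norm w) * indicator (ball 0 1) w) / V"
      using AE_lborel_norm_neq[of 1]
    proof eventually_elim
      case (elim w)
      then have "indicator (cball 0 1) w = (indicator (ball 0 1) w :: real)"
        by (auto simp: indicator_def)
      then show ?case by simp
    qed
  qed measurable
  finally show ?thesis by (simp add: V_def)
qed

text \<open>Rescaling by \<open>d\<close> reduces this to \<open>sphere_average_bound\<close>: the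
  balls around \<open>x\<close> and \<open>y\<close> become the unit balls around 0 and
  \<open>e\<close>, and the rescaled function has Lipschitz constant \<open>L * d\<close>, whence
  the error \<open>2 * L * d\<close>. The factor \<open>d\<close> in
  \<open>y - x = d *\<^sub>R e\<close> cancels the \<open>1 / d\<close> of
  \<open>grad_est\<close>.\<close>

lemma integral_grad_est_le:
  fixes h :: "real ^ 'p \<Rightarrow> real"
  assumes h [measurable]: "h \<in> borel_measurable borel"
    and X: "convex X" and conv: "convex_on X h"
    and lip: "\<And>v w. v \<in> X \<Longrightarrow> w \<in> X \<Longrightarrow> \<bar>h v - h w\<bar> \<le> L * norm (v - w)"
    and L: "0 \<le> L" and d: "0 < d" and balls: "cball x d \<subseteq> X" "cball y d \<subseteq> X"
  shows "(\<integral>u. grad_est d h x u \<bullet> (y - x) \<partial>sphere_uniform) \<le> h y - h x + 2 * L * d"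
proof -
  define F where "F w = h (x + d *\<^sub>R w) - h x" for w
  define S where "S = {w. x + d *\<^sub>R w \<in> X}"
  define e where "e = (y - x) /\<^sub>R d"
  let ?V = "measure lborel (ball (0::real ^ 'p) 1)"
  have V: "0 < ?V" by (rule measure_unit_ball_pos)
  have comb: "x + d *\<^sub>R (s *\<^sub>R v + t *\<^sub>R w) = s *\<^sub>R (x + d *\<^sub>R v) + t *\<^sub>R (x + d *\<^sub>R w)" if "s + t = 1" for s t v w
  proof -
    have "x = s *\<^sub>R x + t *\<^sub>R x" using that by (simp flip: scaleR_left_distrib)
    then show ?thesis by (simp add: algebra_simps)
  qed
  have [measurable]: "F \<in> borel_measurable borel"
    unfolding F_def by measurable
  have de: "d *\<^sub>R e = y - x"
    using d by (simp add: e_def)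
  have S: "convex S"
    unfolding S_def convex_def by (auto simp: comb convexD[OF X])
  have S1: "cball 0 1 \<subseteq> S"
    using balls(1) d unfolding S_def by (auto simp: subset_eq dist_norm)
  have S2: "cball e 1 \<subseteq> S"
  proof
    fix w assume "w \<in> cball e 1"
    then have "norm (w - e) \<le> 1" by (simp add: dist_norm norm_minus_commute)
    then have "d * norm (w - e) \<le> d" using d by simp
    moreover have "x + d *\<^sub>R w - y = d *\<^sub>R (w - e)"
      using de by (simp add: algebra_simps)
    ultimately have "norm (x + d *\<^sub>R w - y) \<le> d"
      using d by simp
    then show "w \<in> S"
      using balls(2) unfolding S_def by (auto simp: dist_norm norm_minus_commute)
  qed
  have "convex_on S F"
    unfolding convex_on_def
  proof (intro conjI S ballI allI impI)
    fix v w s t assume *: "v \<in> S" "w \<in> S" "(0::real) \<le> s" "0 \<le> t" "s + t = 1"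
    then have "h (s *\<^sub>R (x + d *\<^sub>R v) + t *\<^sub>R (x + d *\<^sub>R w)) \<le> s * h (x + d *\<^sub>R v) + t * h (x + d *\<^sub>R w)"
      using conv unfolding convex_on_def S_def by blast
    moreover have "h x = s * h x + t * h x"
      using * by (simp flip: distrib_right)
    ultimately show "F (s *\<^sub>R v + t *\<^sub>R w) \<le> s * F v + t * F w"
      unfolding F_def comb[OF *(5)] by (simp add: algebra_simps)
  qed
  moreover have "\<bar>F v - F w\<bar> \<le> L * d * norm (v - w)" if "v \<in> S" "w \<in> S" for v w
    using lip[of "x + d *\<^sub>R v" "x + d *\<^sub>R w"] that d
    by (simp add: F_def S_def mult.assoc flip: scaleR_diff_right)
  ultimately have "DIM(real^'p) * (\<integral>w. F (w /\<^sub>R norm w) * ((w /\<^sub>R norm w) \<bullet> e) * indicator (ball 0 1) w \<partial>lborel)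
      \<le> (F e - F 0 + 2 * (L * d)) * ?V"
    using L d by (intro sphere_average_bound[OF _ S S1 S2]) simp_all
  moreover have "F e - F 0 = h y - h x"
    using de by (simp add: F_def)
  ultimately have *: "CARD('p) * (\<integral>w. F (w /\<^sub>R norm w) * ((w /\<^sub>R norm w) \<bullet> e) * indicator (ball 0 1) w \<partial>lborel) / ?V
      \<le> h y - h x + 2 * L * d"
    using V by (simp add: field_simps)
  have "grad_est d h x u \<bullet> (y - x) = CARD('p) * (F u * (u \<bullet> e))" for u
    using d by (simp add: grad_est_def F_def flip: de)
  then have "(\<integral>u. grad_est d h x u \<bullet> (y - x) \<partial>sphere_uniform) = CARD('p) * (\<integral>u. F u * (u \<bullet> e) \<partial>sphere_uniform)"
    by simp
  also have "\<dots> = CARD('p) * (\<integral>w. F (w /\<^sub>R norm w) * ((w /\<^sub>R norm w) \<bullet> e) * indicator (ball 0 1) w \<partial>lborel) / ?V"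
    by (subst integral_sphere_uniform) simp_all
  finally show ?thesis using * by simp
qed

section \<open>Consensus under perturbations\<close>

text \<open>The entry (i, j) of the matrix product W (t + k - 1) ... W t: the weight with which the
  value of \<open>j\<close> at time \<open>t\<close> enters that of \<open>i\<close> at time
  \<open>t + k\<close>.\<close>

fun transition :: "(nat \<Rightarrow> real ^ 'n ^ 'n) \<Rightarrow> nat \<Rightarrow> nat \<Rightarrow> 'n::finite \<Rightarrow> 'n \<Rightarrow> real" where
  "transition W t 0 i j = (if i = j then 1 else 0)"
| "transition W t (Suc k) i j = (\<Sum>l\<in>UNIV. W (t + k) $ i $ l * transition W t k l j)"

lemma transition_nonneg:
  assumes "\<And>s. t \<le> s \<Longrightarrow> doubly_stochastic (W s)"
  shows "0 \<le> transition W t k i j"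
proof (induction k arbitrary: i)
  case (Suc k)
  then show ?case
    using assms[of "t + k"] by (auto intro!: sum_nonneg simp: doubly_stochastic_def)
qed simp

lemma transition_row_sum:
  assumes "\<And>s. t \<le> s \<Longrightarrow> doubly_stochastic (W s)"
  shows "(\<Sum>j\<in>UNIV. transition W t k i j) = 1"
proof (induction k arbitrary: i)
  case (Suc k)
  have "(\<Sum>j\<in>UNIV. transition W t (Suc k) i j)
      = (\<Sum>l\<in>UNIV. W (t + k) $ i $ l * (\<Sum>j\<in>UNIV. transition W t k l j))"
    unfolding transition.simps by (subst sum.swap) (simp add: sum_distrib_left)
  also have "\<dots> = 1"
    using Suc assms[of "t + k"] by (simp add: doubly_stochastic_def)
  finally show ?case .
qed simp

context
  fixes E :: "nat \<Rightarrow> ('n::finite \<times> 'n) set" and W :: "nat \<Rightarrow> real ^ 'n ^ 'n" and w :: real and B :: nat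
  assumes w: "0 < w" "w < 1"
    and weights: "\<And>t i j. 1 \<le> t \<Longrightarrow> (j, i) \<in> E t \<or> i = j \<Longrightarrow> w \<le> W t $ i $ j"
    and stoch: "\<And>t. 1 \<le> t \<Longrightarrow> doubly_stochastic (W t)"
    and B: "0 < B" and conn: "\<And>t. 1 \<le> t \<Longrightarrow> strongly_connected (\<Union>l<B. E (t + l))"
begin

text \<open>The threshold loses one factor \<open>w\<close> per step, which is what an edge or an
  agent's own weight can cost. Hence a reached agent stays reached.\<close>

definition reached :: "nat \<Rightarrow> 'n \<Rightarrow> nat \<Rightarrow> 'n set" where
  "reached t j k = {i. w ^ k \<le> transition W t k i j}"

lemma reached_step:
  assumes "1 \<le> t" "l \<in> reached t j k" "(l, i) \<in> E (t + k) \<or> i = l"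
  shows "i \<in> reached t j (Suc k)"
proof -
  have nn: "0 \<le> W (t + k) $ i $ l' * transition W t k l' j" for l'
    using stoch[of "t + k"] assms(1) transition_nonneg[of t W k l' j] stoch
    by (auto simp: doubly_stochastic_def)
  have "w * w ^ k \<le> W (t + k) $ i $ l * transition W t k l j"
    using weights[of "t + k" l i] assms w by (intro mult_mono) (auto simp: reached_def)
  also have "\<dots> \<le> transition W t (Suc k) i j"
    unfolding transition.simps by (rule member_le_sum) (use nn in auto)
  finally show ?thesis by (simp add: reached_def)
qed

lemma reached_mono:
  assumes "1 \<le> t" "k \<le> k'"
  shows "reached t j k \<subseteq> reached t j k'"
  using assms(2) by (induction rule: dec_induct) (use reached_step[OF assms(1)] in blast)+

text \<open>A path from \<open>j\<close> out of the reached set uses an edge leaving it, and this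
  edge is present at some time of the window of length \<open>B\<close>. Until then its source stays
  reached, afterwards its target does, both through the own weights.\<close>

lemma reached_grows:
  assumes t: "1 \<le> t" and j: "j \<in> reached t j k" and neq: "reached t j k \<noteq> UNIV"
  shows "reached t j k \<subset> reached t j (k + B)"
proof -
  define S where "S = reached t j k"
  let ?U = "\<Union>l<B. E (t + k + l)"
  obtain b where b: "b \<notin> S" using neq by (auto simp: S_def)
  have "(j, b) \<in> ?U\<^sup>*"
    using conn[of "t + k"] t by (auto simp: strongly_connected_def)
  then have "\<exists>a c. a \<in> S \<and> c \<notin> S \<and> (a, c) \<in> ?U"
    using j[folded S_def] b
  proof (induction rule: converse_rtrancl_induct)
    case (step y z)
    then show ?case by (cases "z \<in> S") auto
  qed simp
  then obtain a c l where ac: "a \<in> S" "c \<notin> S" "l < B" "(a, c) \<in> E (t + (k + l))"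
    by (auto simp: add.assoc)
  have "a \<in> reached t j (k + l)"
    using reached_mono[OF t, of k "k + l" j] ac by (auto simp: S_def)
  then have "c \<in> reached t j (Suc (k + l))"
    using reached_step[OF t] ac by blast
  then have "c \<in> reached t j (k + B)"
    using reached_mono[OF t, of "Suc (k + l)" "k + B" j] ac by auto
  then show ?thesis
    using reached_mono[OF t, of k "k + B" j] ac by (auto simp: S_def)
qed

lemma transition_lower_bound:
  assumes t: "1 \<le> t"
  shows "w ^ (CARD('n) * B) \<le> transition W t (CARD('n) * B) i j"
proof -
  have j: "j \<in> reached t j k" for k
    using reached_mono[OF t, of 0 k j] by (auto simp: reached_def)
  \<comment> \<open>Each window adds an agent until all are reached; the count starts at 1 because
    \<open>j\<close> itself is reached. For k = \<open>CARD('n')\<close> the first alternative is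
    impossible.\<close>
  have "Suc k \<le> card (reached t j (k * B)) \<or> reached t j (k * B) = UNIV" for k
  proof (induction k)
    case 0
    have "0 < card (reached t j 0)" using j[of 0] by (auto simp: card_gt_0_iff)
    then show ?case by simp
  next
    case (Suc k)
    show ?case
    proof (cases "reached t j (k * B) = UNIV")
      case True
      then show ?thesis
        using reached_mono[OF t, of "k * B" "Suc k * B" j] by auto
    next
      case False
      then have "card (reached t j (k * B)) < card (reached t j (k * B + B))"
        by (intro psubset_card_mono reached_grows[OF t j]) auto
      then show ?thesis using Suc False by (simp add: add.commute)
    qed
  qed
  from this[of "CARD('n)"] have "reached t j (CARD('n) * B) = UNIV"
    using card_mono[of UNIV "reached t j (CARD('n) * B)"] by auto
  then show ?thesis by (auto simp: reached_def)
qed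

end

text \<open>The diameter of the agents' values; it compares any two agents without reference to an
  average.\<close>

definition disagreement :: "('n::finite \<Rightarrow> 'a::real_normed_vector) \<Rightarrow> real" where
  "disagreement v = Max ((\<lambda>(i, j). norm (v i - v j)) ` UNIV)"

lemma disagreement_ge: "norm (v i - v j) \<le> disagreement v"
  unfolding disagreement_def by (rule Max_ge) force+

lemma disagreement_le: "(\<And>i j. norm (v i - v j) \<le> C) \<Longrightarrow> disagreement v \<le> C"
  unfolding disagreement_def by (rule Max.boundedI) auto

lemma disagreement_nonneg: "0 \<le> disagreement v"
  using disagreement_ge[of v undefined undefined] by simp

text \<open>Two rows of a positive stochastic matrix share the mass \<open>\<eta>\<close> in every column, which cancels in
  the difference of the two averages.\<close>

lemma disagreement_contraction:
  fixes A :: "'n::finite \<Rightarrow> 'n \<Rightarrow> real" and v :: "'n \<Rightarrow> 'a::real_normed_vector"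
  assumes A: "\<And>i j. \<eta> \<le> A i j" "\<And>i. (\<Sum>j\<in>UNIV. A i j) = 1" and \<eta>: "0 \<le> \<eta>"
  shows "disagreement (\<lambda>i. \<Sum>j\<in>UNIV. A i j *\<^sub>R v j) \<le> (1 - \<eta>) * disagreement v"
proof (rule disagreement_le)
  fix i k
  define n where "n = real CARD('n)"
  have n1: "1 \<le> n" unfolding n_def by (simp add: Suc_leI)
  define c where "c i j = A i j - \<eta>" for i j
  have c: "0 \<le> c i j" "(\<Sum>j\<in>UNIV. c i j) = 1 - n * \<eta>" for i j
    using A by (auto simp: c_def sum_subtractf n_def)
  define \<mu> where "\<mu> = 1 - n * \<eta>"
  have \<mu>: "0 \<le> \<mu>" "\<mu> \<le> 1 - \<eta>"
    using c(2)[of i] sum_nonneg[of UNIV "c i"] c(1) mult_right_mono[OF n1 \<eta>] by (auto simp: \<mu>_def)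
  have "norm ((\<Sum>j\<in>UNIV. A i j *\<^sub>R v j) - (\<Sum>j\<in>UNIV. A k j *\<^sub>R v j)) \<le> \<mu> * disagreement v"
  proof (cases "\<mu> = 0")
    \<comment> \<open>Without residual mass every entry equals \<eta> and the two averages coincide.
      The case is separate because the other one divides by \<open>\<mu>\<close>.\<close>
    case True
    then have "c i j = 0" for i j
      using c(2)[of i] sum_nonneg_eq_0_iff[of UNIV "c i"] c(1) by (auto simp: \<mu>_def)
    then have "A i j = \<eta>" for i j by (simp add: c_def)
    then show ?thesis using True by simp
  next
    case False
    then have \<mu>0: "0 < \<mu>" using \<mu> by simp
    have "\<mu> *\<^sub>R ((\<Sum>j\<in>UNIV. A i j *\<^sub>R v j) - (\<Sum>l\<in>UNIV. A k l *\<^sub>R v l))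
        = \<mu> *\<^sub>R ((\<Sum>j\<in>UNIV. c i j *\<^sub>R v j) - (\<Sum>l\<in>UNIV. c k l *\<^sub>R v l))"
      by (simp add: c_def scaleR_left_diff_distrib sum_subtractf)
    \<comment> \<open>Product weights couple the two averages, so that only differences of two
      agents' values remain, each bounded by the diameter. The total mass is
      \<open>\<mu>\<^sup>2\<close>, of which one factor cancels.\<close>
    also have "\<dots> = (\<Sum>j\<in>UNIV. \<Sum>l\<in>UNIV. (c i j * c k l) *\<^sub>R (v j - v l))"
    proof -
      have "(\<Sum>l\<in>UNIV. (c i j * c k l) *\<^sub>R v j) = \<mu> *\<^sub>R (c i j *\<^sub>R v j)" for j
        using c(2)[of k] by (simp add: \<mu>_def mult.commute flip: scaleR_sum_left sum_distrib_left)
      then have "(\<Sum>j\<in>UNIV. \<Sum>l\<in>UNIV. (c i j * c k l) *\<^sub>R v j) = \<mu> *\<^sub>R (\<Sum>j\<in>UNIV. c i j *\<^sub>R v j)"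
        by (simp only: scaleR_sum_right)
      moreover have "(\<Sum>j\<in>UNIV. (c i j * c k l) *\<^sub>R v l) = \<mu> *\<^sub>R (c k l *\<^sub>R v l)" for l
        using c(2)[of i] by (simp add: \<mu>_def flip: scaleR_sum_left sum_distrib_right)
      then have "(\<Sum>j\<in>UNIV. \<Sum>l\<in>UNIV. (c i j * c k l) *\<^sub>R v l) = \<mu> *\<^sub>R (\<Sum>l\<in>UNIV. c k l *\<^sub>R v l)"
        by (subst sum.swap) (simp only: scaleR_sum_right)
      ultimately show ?thesis
        by (simp add: scaleR_right_diff_distrib sum_subtractf)
    qed
    finally have "\<mu> * norm ((\<Sum>j\<in>UNIV. A i j *\<^sub>R v j) - (\<Sum>l\<in>UNIV. A k l *\<^sub>R v l))
        = norm (\<Sum>j\<in>UNIV. \<Sum>l\<in>UNIV. (c i j * c k l) *\<^sub>R (v j - v l))"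
      using \<mu>0 norm_scaleR[of \<mu> "(\<Sum>j\<in>UNIV. A i j *\<^sub>R v j) - (\<Sum>l\<in>UNIV. A k l *\<^sub>R v l)"] by simp
    also have "\<dots> \<le> (\<Sum>j\<in>UNIV. \<Sum>l\<in>UNIV. (c i j * c k l) * disagreement v)"
      using c(1) by (intro order.trans[OF norm_sum] sum_mono)
        (auto simp: abs_mult intro!: mult_left_mono disagreement_ge)
    also have "\<dots> = \<mu> * (\<mu> * disagreement v)"
    proof -
      have *: "(\<Sum>l\<in>UNIV. (c i j * c k l) * disagreement v) = c i j * (\<mu> * disagreement v)" for j
        using c(2)[of k] by (simp add: \<mu>_def mult.assoc flip: sum_distrib_left sum_distrib_right)
      show ?thesis
        unfolding * using c(2)[of i] by (simp add: \<mu>_def flip: sum_distrib_right)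
    qed
    finally show ?thesis using \<mu>0 by simp
  qed
  also have "\<dots> \<le> (1 - \<eta>) * disagreement v"
    using \<mu> by (intro mult_right_mono disagreement_nonneg) auto
  finally show "norm ((\<Sum>j\<in>UNIV. A i j *\<^sub>R v j) - (\<Sum>j\<in>UNIV. A k j *\<^sub>R v j)) \<le> (1 - \<eta>) * disagreement v" .
qed

text \<open>Averaging with nonnegative rows of sum one does not enlarge earlier perturbations, so
  they merely add up.\<close>

lemma perturbed_consensus:
  fixes v e :: "nat \<Rightarrow> 'n::finite \<Rightarrow> 'a::real_normed_vector"
  assumes stoch: "\<And>s. t \<le> s \<Longrightarrow> doubly_stochastic (W s)"
    and step: "\<And>s i. t \<le> s \<Longrightarrow> v (Suc s) i = (\<Sum>j\<in>UNIV. W s $ i $ j *\<^sub>R v s j) + e s i"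
    and e: "\<And>s i. t \<le> s \<Longrightarrow> norm (e s i) \<le> \<epsilon> s"
  shows "norm (v (t + k) i - (\<Sum>j\<in>UNIV. transition W t k i j *\<^sub>R v t j)) \<le> (\<Sum>s<k. \<epsilon> (t + s))"
proof (induction k arbitrary: i)
  case 0
  have "(\<Sum>j\<in>UNIV. transition W t 0 i j *\<^sub>R v t j) = (\<Sum>j\<in>UNIV. if i = j then v t j else 0)"
    by (intro sum.cong) auto
  then show ?case by simp
next
  case (Suc k)
  let ?W = "W (t + k) $ i"
  have W: "0 \<le> ?W $ j" "(\<Sum>j\<in>UNIV. ?W $ j) = 1" for j
    using stoch[of "t + k"] by (auto simp: doubly_stochastic_def)
  let ?d = "\<lambda>l. v (t + k) l - (\<Sum>j\<in>UNIV. transition W t k l j *\<^sub>R v t j)"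
  have "(\<Sum>j\<in>UNIV. transition W t (Suc k) i j *\<^sub>R v t j)
      = (\<Sum>j\<in>UNIV. \<Sum>l\<in>UNIV. ?W $ l *\<^sub>R transition W t k l j *\<^sub>R v t j)"
    by (simp add: scaleR_sum_left)
  also have "\<dots> = (\<Sum>l\<in>UNIV. ?W $ l *\<^sub>R (\<Sum>j\<in>UNIV. transition W t k l j *\<^sub>R v t j))"
    by (subst sum.swap) (simp only: scaleR_sum_right)
  finally have "v (t + Suc k) i - (\<Sum>j\<in>UNIV. transition W t (Suc k) i j *\<^sub>R v t j)
      = (\<Sum>l\<in>UNIV. ?W $ l *\<^sub>R ?d l) + e (t + k) i"
    using step[of "t + k" i] by (simp only: scaleR_right_diff_distrib sum_subtractf) simp
  then have "norm (v (t + Suc k) i - (\<Sum>j\<in>UNIV. transition W t (Suc k) i j *\<^sub>R v t j))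
      \<le> norm (\<Sum>l\<in>UNIV. ?W $ l *\<^sub>R ?d l) + \<epsilon> (t + k)"
    using e[of "t + k" i] norm_triangle_mono[OF order_refl, of "e (t + k) i" "\<epsilon> (t + k)" "\<Sum>l\<in>UNIV. ?W $ l *\<^sub>R ?d l"]
    by (simp only: le_add1)
  also have "norm (\<Sum>l\<in>UNIV. ?W $ l *\<^sub>R ?d l) \<le> (\<Sum>l\<in>UNIV. ?W $ l * (\<Sum>s<k. \<epsilon> (t + s)))"
    using W(1) Suc by (intro order.trans[OF norm_sum] sum_mono) (auto intro!: mult_left_mono)
  also have "\<dots> = (\<Sum>s<k. \<epsilon> (t + s))"
    using W(2) by (simp flip: sum_distrib_right)
  finally show ?case by simp
qed

lemma norm_diff_via:
  fixes a b c d :: "'a::real_normed_vector"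
  shows "norm (a - b) \<le> norm (a - c) + norm (c - d) + norm (b - d)"
proof -
  have "a - b = (a - c) + (c - d) - (b - d)" by simp
  then have "norm (a - b) \<le> norm ((a - c) + (c - d)) + norm (b - d)"
    by (metis norm_triangle_ineq4)
  also have "norm ((a - c) + (c - d)) \<le> norm (a - c) + norm (c - d)"
    by (rule norm_triangle_ineq)
  finally show ?thesis by simp
qed

text \<open>Over \<open>N\<close> steps the diameter contracts by \<open>1 - \<eta>\<close> and
  gains at most twice the perturbations of the window. Summed over all rounds, each perturbation is
  met in at most \<open>N\<close> windows, and \<eta> times the sum of the diameters remains on the
  left. \<open>C\<close> is fixed before the sequences, so that it can serve all realizations at
  once.\<close>

lemma sum_disagreement_bound:
  fixes W :: "nat \<Rightarrow> real ^ 'n ^ 'n"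
  assumes "mixing_network E W"
  obtains C where "0 \<le> C"
    "\<And>(v :: nat \<Rightarrow> 'n::finite \<Rightarrow> 'a::real_normed_vector) e \<epsilon> D T.
      \<lbrakk>\<And>s i. 1 \<le> s \<Longrightarrow> v (Suc s) i = (\<Sum>j\<in>UNIV. W s $ i $ j *\<^sub>R v s j) + e s i;
       \<And>s i. 1 \<le> s \<Longrightarrow> norm (e s i) \<le> \<epsilon> s; \<And>s. 1 \<le> s \<Longrightarrow> disagreement (v s) \<le> D\<rbrakk>
      \<Longrightarrow> (\<Sum>t=1..T. disagreement (v t)) \<le> C * (D + (\<Sum>t=1..T. \<epsilon> t))"
proof -
  from assms obtain w B where w: "0 < w" "w < 1"
    and weights: "\<And>t i j. 1 \<le> t \<Longrightarrow> (j, i) \<in> E t \<or> i = j \<Longrightarrow> w \<le> W t $ i $ j"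
    and stoch: "\<And>t. 1 \<le> t \<Longrightarrow> doubly_stochastic (W t)"
    and B: "0 < B" "\<And>t. 1 \<le> t \<Longrightarrow> strongly_connected (\<Union>l<B. E (t + l))"
  proof -
    obtain w where w: "0 < w" "w < 1"
        "\<forall>t\<ge>1. \<forall>i j. if (j, i) \<in> E t \<or> i = j then w \<le> W t $ i $ j else W t $ i $ j = 0"
      using assms unfolding mixing_network_def by blast
    obtain B where B: "0 < B" "\<forall>t\<ge>1. strongly_connected (\<Union>l<B. E (t + l))"
      using assms unfolding mixing_network_def by blast
    show thesis
    proof (rule that[OF w(1,2) _ _ B(1)])
      show "w \<le> W t $ i $ j" if "1 \<le> t" "(j, i) \<in> E t \<or> i = j" for t i j
        using w(3)[rule_format, OF that(1), of j i] that(2) by simp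
      show "doubly_stochastic (W t)" if "1 \<le> t" for t
        using assms that unfolding mixing_network_def by blast
      show "strongly_connected (\<Union>l<B. E (t + l))" if "1 \<le> t" for t
        using B(2) that by blast
    qed
  qed
  define N where "N = CARD('n) * B"
  define \<eta> where "\<eta> = w ^ N"
  have \<eta>: "0 < \<eta>" "\<eta> \<le> 1"
    using w by (auto simp: \<eta>_def power_le_one)
  have "(\<Sum>t=1..T. disagreement (v t)) \<le> (2 * real N / \<eta>) * (D + (\<Sum>t=1..T. \<epsilon> t))"
    if step: "\<And>s i. 1 \<le> s \<Longrightarrow> v (Suc s) i = (\<Sum>j\<in>UNIV. W s $ i $ j *\<^sub>R v s j) + e s i"
      and e: "\<And>s i. 1 \<le> s \<Longrightarrow> norm (e s i) \<le> \<epsilon> s"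
      and D: "\<And>s. 1 \<le> s \<Longrightarrow> disagreement (v s) \<le> D"
    for v e :: "nat \<Rightarrow> 'n \<Rightarrow> 'a" and \<epsilon> :: "nat \<Rightarrow> real" and D T
  proof -
    let ?D = "\<lambda>t. disagreement (v t)"
    have \<epsilon>0: "0 \<le> \<epsilon> s" if "1 \<le> s" for s
      using e[OF that, of undefined] norm_ge_zero order_trans by blast
    have D0: "0 \<le> D" using D[of 1] disagreement_nonneg[of "v 1"] by simp
    have contr: "?D (t + N) \<le> (1 - \<eta>) * ?D t + 2 * (\<Sum>s<N. \<epsilon> (t + s))" if t: "1 \<le> t" for t
    proof (rule disagreement_le)
      fix i k
      let ?a = "\<lambda>i. \<Sum>j\<in>UNIV. transition W t N i j *\<^sub>R v t j"
      have pc: "norm (v (t + N) i - ?a i) \<le> (\<Sum>s<N. \<epsilon> (t + s))" for i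
        by (rule perturbed_consensus[where e = e]) (use stoch step e t in auto)
      have "norm (?a i - ?a k) \<le> (1 - \<eta>) * ?D t"
      proof (rule order.trans[OF disagreement_ge[where v = ?a] disagreement_contraction])
        show "\<eta> \<le> transition W t N i j" for i j
          unfolding \<eta>_def N_def by (rule transition_lower_bound[OF w weights stoch B]) (use t in auto)
        show "(\<Sum>j\<in>UNIV. transition W t N i j) = 1" for i
          by (rule transition_row_sum) (use stoch t in auto)
      qed (use \<eta> in simp)
      moreover have "norm (v (t + N) i - v (t + N) k)
          \<le> norm (v (t + N) i - ?a i) + norm (?a i - ?a k) + norm (v (t + N) k - ?a k)"
        by (rule norm_diff_via)
      ultimately show "norm (v (t + N) i - v (t + N) k) \<le> (1 - \<eta>) * ?D t + 2 * (\<Sum>s<N. \<epsilon> (t + s))"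
        using pc[of i] pc[of k] by linarith
    qed
    \<comment> \<open>Padding with zeros after \<open>T\<close> makes the shift by \<open>N\<close>
      possible also for \<open>T < N\<close> and keeps perturbations after \<open>T\<close> out of
      the bound.\<close>
    have "(\<Sum>t=1..T. ?D t) \<le> (\<Sum>t=1..N+T. if t \<le> T then ?D t else 0)"
      by (rule sum_le_included[where i = id]) (auto simp: disagreement_nonneg)
    also have "\<dots> = (\<Sum>t=1..N. if t \<le> T then ?D t else 0) + (\<Sum>t=N+1..N+T. if t \<le> T then ?D t else 0)"
      by (subst sum.ub_add_nat) auto
    also have "(\<Sum>t=N+1..N+T. if t \<le> T then ?D t else 0) = (\<Sum>t=1..T. if t + N \<le> T then ?D (t + N) else 0)"
      using sum.shift_bounds_cl_nat_ivl[of "\<lambda>t. if t \<le> T then ?D t else 0" 1 N T] by (simp add: add.commute)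
    \<comment> \<open>The first \<open>N\<close> rounds have no contraction behind them and cost
      \<open>D\<close> each.\<close>
    also have "(\<Sum>t=1..N. if t \<le> T then ?D t else 0) \<le> (\<Sum>t=1..N. D)"
      using D D0 by (intro sum_mono) auto
    also have "(\<Sum>t=1..T. if t + N \<le> T then ?D (t + N) else 0)
        \<le> (\<Sum>t=1..T. (1 - \<eta>) * ?D t + 2 * (\<Sum>s<N. if t + s \<le> T then \<epsilon> (t + s) else 0))"
    proof (rule sum_mono)
      fix t assume "t \<in> {1..T}"
      then have t: "1 \<le> t" by simp
      have nn: "0 \<le> (1 - \<eta>) * ?D t + 2 * (\<Sum>s<N. if t + s \<le> T then \<epsilon> (t + s) else 0)"
        using \<eta> \<epsilon>0 t by (intro add_nonneg_nonneg mult_nonneg_nonneg sum_nonneg) (auto simp: disagreement_nonneg)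
      show "(if t + N \<le> T then ?D (t + N) else 0)
          \<le> (1 - \<eta>) * ?D t + 2 * (\<Sum>s<N. if t + s \<le> T then \<epsilon> (t + s) else 0)"
        using contr[OF t] nn by (cases "t + N \<le> T") auto
    qed
    also have "\<dots> = (1 - \<eta>) * (\<Sum>t=1..T. ?D t) + 2 * (\<Sum>s<N. \<Sum>t=1..T. if t + s \<le> T then \<epsilon> (t + s) else 0)"
      by (simp add: sum.distrib sum_distrib_left) (rule sum.swap)
    also have "(\<Sum>s<N. \<Sum>t=1..T. if t + s \<le> T then \<epsilon> (t + s) else 0) \<le> (\<Sum>s<N. \<Sum>t=1..T. \<epsilon> t)"
    proof (rule sum_mono)
      fix s
      have "(\<Sum>t=1..T. if t + s \<le> T then \<epsilon> (t + s) else 0) = (\<Sum>t\<in>{t\<in>{1..T}. t + s \<le> T}. \<epsilon> (t + s))"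
        by (rule sum.inter_filter[symmetric]) simp
      also have "\<dots> \<le> (\<Sum>t=1..T. \<epsilon> t)"
        by (rule sum_le_included[where i = "\<lambda>t. t - s"]) (auto simp: \<epsilon>0 intro!: bexI[of _ "_ + s"])
      finally show "(\<Sum>t=1..T. if t + s \<le> T then \<epsilon> (t + s) else 0) \<le> (\<Sum>t=1..T. \<epsilon> t)" .
    qed
    finally have "\<eta> * (\<Sum>t=1..T. ?D t) \<le> real N * D + 2 * (real N * (\<Sum>t=1..T. \<epsilon> t))"
      by (simp add: algebra_simps)
    also have "\<dots> \<le> 2 * real N * (D + (\<Sum>t=1..T. \<epsilon> t))"
      using D0 by (simp add: algebra_simps)
    finally show ?thesis
      using \<eta> by (simp add: field_simps)
  qed
  then show thesis
    using that[of "2 * real N / \<eta>"] \<eta> by simp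
qed

section \<open>Step size sums and the dual recursion\<close>

text \<open>By the mean value theorem each term is at most an increment of
  \<open>x powr a / a\<close>: the exponent \<open>a - 1\<close> is not positive and the term is
  taken at the right end of its interval.\<close>

lemma sum_powr_le:
  fixes a :: real
  assumes a: "0 < a" "a \<le> 1"
  shows "(\<Sum>t=1..T. real t powr (a - 1)) \<le> real T powr a / a"
proof (induction T)
  case (Suc T)
  have "a * real (Suc T) powr (a - 1) \<le> real (Suc T) powr a - real T powr a"
  proof (cases "T = 0")
    case False
    have "\<exists>z::real. z > real T \<and> z < real (Suc T) \<and>
        real (Suc T) powr a - real T powr a = (real (Suc T) - real T) * (a * z powr (a - 1))"
      by (rule MVT2) (use False in \<open>auto intro!: derivative_eq_intros\<close>)
    then obtain z where z: "real T < z" "z < real (Suc T)"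
        "real (Suc T) powr a - real T powr a = a * z powr (a - 1)"
      by auto
    moreover have "real (Suc T) powr (a - 1) \<le> z powr (a - 1)"
      by (rule powr_mono2') (use z a False in auto)
    ultimately show ?thesis using a by simp
  qed (use a in simp)
  then have "real (Suc T) powr (a - 1) \<le> (real (Suc T) powr a - real T powr a) / a"
    using a by (simp add: field_simps)
  then show ?case using Suc by (simp add: diff_divide_distrib)
qed simp

text \<open>With \<open>s\<close> and \<open>s'\<close> the square roots of consecutive partial
  sums, \<tau> is the difference of their squares and thus at most
  \<open>(s' - s) * (2 * s')\<close>; after division by \<open>s'\<close> this telescopes.\<close>

lemma sum_div_sqrt_le:
  fixes \<tau> :: "nat \<Rightarrow> real"
  assumes pos: "\<And>t. 1 \<le> t \<Longrightarrow> 0 < \<tau> t" and Psi: "\<And>t. \<Psi> t = (\<Sum>k=1..t. \<tau> k)"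
  shows "(\<Sum>t=1..T. \<tau> t / sqrt (\<Psi> t)) \<le> 2 * sqrt (\<Psi> T)"
proof (induction T)
  case 0
  then show ?case by (simp add: Psi)
next
  case (Suc T)
  define s s' where "s = sqrt (\<Psi> T)" and "s' = sqrt (\<Psi> (Suc T))"
  have P: "0 \<le> \<Psi> T" "0 < \<tau> (Suc T)" "\<Psi> (Suc T) = \<Psi> T + \<tau> (Suc T)"
    unfolding Psi using pos by (auto intro!: sum_nonneg simp: less_imp_le)
  then have s: "s < s'" "0 \<le> s" "\<tau> (Suc T) = s'\<^sup>2 - s\<^sup>2"
    by (auto simp: s_def s'_def)
  have "\<tau> (Suc T) = (s' - s) * (s' + s)"
    unfolding s by (simp add: power2_eq_square algebra_simps)
  also have "\<dots> \<le> (s' - s) * (2 * s')"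
    using s(1,2) by (intro mult_left_mono) auto
  finally have "\<tau> (Suc T) / s' \<le> 2 * (s' - s)"
    using s(1,2) by (simp add: field_simps)
  then show ?case
    using Suc by (simp add: s_def s'_def)
qed

lemma sum_inverse_sqrt_le: "(\<Sum>t=1..T. 1 / sqrt (real t)) \<le> 2 * sqrt (real T)"
  using sum_div_sqrt_le[of "\<lambda>_. 1" real T] by simp

text \<open>A term of a non-increasing sequence does not exceed the average of its predecessors, so
  appending it lowers the average. This makes \<alpha> non-increasing.\<close>

lemma average_antimono:
  fixes \<tau> :: "nat \<Rightarrow> real"
  assumes mono: "\<And>s t. 1 \<le> s \<Longrightarrow> s \<le> t \<Longrightarrow> \<tau> t \<le> \<tau> s" and Psi: "\<And>t. \<Psi> t = (\<Sum>k=1..t. \<tau> k)"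
    and "1 \<le> s" "s \<le> t"
  shows "\<Psi> t / real t \<le> \<Psi> s / real s"
  using \<open>s \<le> t\<close>
proof (induction rule: dec_induct)
  case (step n)
  have "real n * \<tau> (Suc n) = (\<Sum>k=1..n. \<tau> (Suc n))" by simp
  also have "\<dots> \<le> \<Psi> n"
    unfolding Psi by (intro sum_mono mono) auto
  finally have "\<Psi> (Suc n) / real (Suc n) \<le> \<Psi> n / real n"
    using step \<open>1 \<le> s\<close> by (simp add: Psi field_simps)
  with step.IH show ?case by simp
qed simp

text \<open>A single component of one agent's dual variable along a single realization. Here
  \<open>b\<close> stands for the linearised violation, which is bounded but of either sign.\<close>

locale dual_update =
  fixes \<beta> \<gamma> b q :: "nat \<Rightarrow> real" and B :: real
  assumes beta_pos: "\<And>t. 1 \<le> t \<Longrightarrow> 0 < \<beta> t" and gamma_pos: "\<And>t. 1 \<le> t \<Longrightarrow> 0 < \<gamma> t"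
    and beta_decr: "\<And>t. 1 \<le> t \<Longrightarrow> \<beta> (Suc t) \<le> \<beta> t" and gamma_decr: "\<And>t. 1 \<le> t \<Longrightarrow> \<gamma> (Suc t) \<le> \<gamma> t"
    and beta_gamma: "\<And>t. 1 \<le> t \<Longrightarrow> \<beta> t * \<gamma> t \<le> 1"
    and gamma_growth: "\<And>t. 1 \<le> t \<Longrightarrow> 1 / \<gamma> (Suc t) - 1 / \<gamma> t \<le> \<beta> (Suc t)"
    and q_1: "q 1 = 0"
    and q_Suc: "\<And>t. 1 \<le> t \<Longrightarrow> q (Suc t) = max 0 ((1 - \<beta> (Suc t) * \<gamma> (Suc t)) * q t + \<gamma> (Suc t) * b t)"
    and b_bound: "\<And>t. 1 \<le> t \<Longrightarrow> \<bar>b t\<bar> \<le> B"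
begin

lemma B_nonneg: "0 \<le> B"
  using b_bound[of 1] by simp

text \<open>Multiplied by \<open>\<beta> (Suc t)\<close>, the update is a convex combination of
  \<open>b t\<close> and a quantity that is at most \<open>B\<close> by induction, so the bound
  \<open>B\<close> survives. Thus \<open>q\<close> grows no faster than 1 / \<beta>.\<close>

lemma q_bounds:
  assumes "1 \<le> t"
  shows "0 \<le> q t" "\<beta> t * q t \<le> B"
proof -
  have "0 \<le> q t \<and> \<beta> t * q t \<le> B"
    using assms
  proof (induction rule: dec_induct)
    case base
    then show ?case using q_1 B_nonneg by simp
  next
    case (step t)
    let ?\<beta> = "\<beta> (Suc t)" and ?\<gamma> = "\<gamma> (Suc t)"
    have p: "0 < ?\<beta>" "0 < ?\<gamma>" "?\<beta> * ?\<gamma> \<le> 1"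
      using beta_pos gamma_pos beta_gamma by auto
    have "?\<beta> * q t \<le> \<beta> t * q t"
      using step beta_decr by (intro mult_right_mono) auto
    then have "(1 - ?\<beta> * ?\<gamma>) * (?\<beta> * q t) \<le> (1 - ?\<beta> * ?\<gamma>) * B"
      using step p by (intro mult_left_mono) auto
    moreover have "(?\<beta> * ?\<gamma>) * b t \<le> (?\<beta> * ?\<gamma>) * B"
      using p b_bound[of t] step by (intro mult_left_mono) auto
    ultimately have "?\<beta> * ((1 - ?\<beta> * ?\<gamma>) * q t + ?\<gamma> * b t) \<le> B"
      by (simp add: algebra_simps)
    then show ?case
      using q_Suc[of t] step p B_nonneg by (auto simp: max_def)
  qed
  then show "0 \<le> q t" "\<beta> t * q t \<le> B" by auto
qed

text \<open>Squaring allows the positive part to be dropped. The increment of \<open>q\<close> is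
  then \<gamma> times \<open>d\<close>, and \<open>\<bar>d\<bar> \<le> 2 * B\<close> by
  \<open>q_bounds\<close>, so the squared increment costs \<open>2 * B\<^sup>2 * \<gamma>\<close>
  after division by \<open>2 * \<gamma>\<close>.\<close>

lemma q_step:
  assumes t: "1 \<le> t"
  shows "(q (Suc t))\<^sup>2 / (2 * \<gamma> (Suc t)) + \<beta> (Suc t) * (q t)\<^sup>2 - q t * b t
    \<le> (q t)\<^sup>2 / (2 * \<gamma> (Suc t)) + 2 * B\<^sup>2 * \<gamma> (Suc t)"
proof -
  let ?\<beta> = "\<beta> (Suc t)" and ?\<gamma> = "\<gamma> (Suc t)"
  define d where "d = b t - ?\<beta> * q t"
  have g: "0 < ?\<gamma>" using gamma_pos by simp
  have "?\<beta> * q t \<le> \<beta> t * q t"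
    using q_bounds[OF t] beta_decr[OF t] by (intro mult_right_mono) auto
  then have "0 \<le> ?\<beta> * q t" "?\<beta> * q t \<le> B"
    using q_bounds[OF t] beta_pos[of "Suc t"] by auto
  then have "\<bar>d\<bar> \<le> \<bar>2 * B\<bar>"
    using b_bound[OF t] unfolding d_def by linarith
  then have "d\<^sup>2 \<le> (2 * B)\<^sup>2"
    by (rule abs_le_square_iff[THEN iffD1])
  then have d: "?\<gamma> * d\<^sup>2 \<le> ?\<gamma> * (4 * B\<^sup>2)"
    using g by (simp add: power_mult_distrib)
  have "(q (Suc t))\<^sup>2 \<le> (q t + ?\<gamma> * d)\<^sup>2"
    using q_Suc[OF t] by (auto simp: max_def d_def algebra_simps)
  also have "\<dots> = (q t)\<^sup>2 + ?\<gamma> * (2 * (q t * d) + ?\<gamma> * d\<^sup>2)"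
    by (simp add: power2_eq_square algebra_simps)
  also have "\<dots> \<le> (q t)\<^sup>2 + ?\<gamma> * (2 * (q t * d) + ?\<gamma> * (4 * B\<^sup>2))"
    using d g by (intro add_left_mono mult_left_mono) auto
  finally have "(q (Suc t))\<^sup>2 / (2 * ?\<gamma>) \<le> ((q t)\<^sup>2 + ?\<gamma> * (2 * (q t * d) + ?\<gamma> * (4 * B\<^sup>2))) / (2 * ?\<gamma>)"
    using g by (intro divide_right_mono) auto
  also have "\<dots> = (q t)\<^sup>2 / (2 * ?\<gamma>) + q t * d + 2 * B\<^sup>2 * ?\<gamma>"
    using g by (simp add: field_simps)
  finally show ?thesis
    by (simp add: d_def power2_eq_square algebra_simps)
qed

text \<open>The growth of \<open>1 / \<gamma>\<close> in the telescoping sum of \<open>q\<^sup>2 / (2 \<gamma>)\<close> is paid for by half of the damping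
  \<open>\<beta> q\<^sup>2\<close>.\<close>

lemma dual_energy:
  "(\<Sum>t=1..T. \<beta> (Suc t) * (q t)\<^sup>2 / 2 - q t * b t) + (q (Suc T))\<^sup>2 / (2 * \<gamma> (Suc T))
    \<le> 2 * B\<^sup>2 * (\<Sum>t=1..T. \<gamma> (Suc t))"
proof (induction T)
  case 0
  then show ?case using q_1 by simp
next
  case (Suc T)
  have "(q (Suc T))\<^sup>2 * (1 / \<gamma> (Suc (Suc T)) - 1 / \<gamma> (Suc T)) \<le> (q (Suc T))\<^sup>2 * \<beta> (Suc (Suc T))"
    by (intro mult_left_mono gamma_growth) auto
  then have "(q (Suc T))\<^sup>2 / (2 * \<gamma> (Suc (Suc T))) \<le> (q (Suc T))\<^sup>2 / (2 * \<gamma> (Suc T)) + \<beta> (Suc (Suc T)) * (q (Suc T))\<^sup>2 / 2"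
    by (simp add: field_simps)
  then show ?case
    using Suc q_step[of "Suc T"] by (simp add: distrib_left)
qed

text \<open>Dropping the positive part and dividing by \<gamma> bounds \<open>b t\<close> by an
  increment of q / \<gamma> plus the damping. Since \<open>q\<close> is nonnegative, replacing the
  accumulated weight 1 / \<gamma> by the next, larger one only weakens the bound, and the sum
  telescopes.\<close>

lemma sum_b_le: "(\<Sum>t=1..T. b t) \<le> q (Suc T) / \<gamma> (Suc T) + (\<Sum>t=1..T. \<beta> (Suc t) * q t)"
proof (induction T)
  case 0
  then show ?case using q_1 by simp
next
  case (Suc T)
  let ?\<beta> = "\<beta> (Suc (Suc T))" and ?\<gamma> = "\<gamma> (Suc (Suc T))"
  have g: "0 < ?\<gamma>" using gamma_pos by simp
  have "(1 - ?\<beta> * ?\<gamma>) * q (Suc T) + ?\<gamma> * b (Suc T) \<le> q (Suc (Suc T))"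
    using q_Suc[of "Suc T"] by simp
  then have "?\<gamma> * b (Suc T) \<le> q (Suc (Suc T)) - q (Suc T) + ?\<gamma> * (?\<beta> * q (Suc T))"
    by (simp add: algebra_simps)
  then have "b (Suc T) \<le> q (Suc (Suc T)) / ?\<gamma> - q (Suc T) / ?\<gamma> + ?\<beta> * q (Suc T)"
    using g by (simp add: field_simps)
  moreover have "q (Suc T) / \<gamma> (Suc T) \<le> q (Suc T) / ?\<gamma>"
    using q_bounds[of "Suc T"] gamma_decr[of "Suc T"] g by (intro divide_left_mono) auto
  ultimately show ?case using Suc by simp
qed

end

text \<open>Multiplied by \<open>real (Suc t) powr \<kappa>\<close>, the left side is at most (t +
  1) - t. This supplies \<open>gamma_growth\<close> for the chosen \<beta> and \<gamma>.\<close>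

lemma powr_diff_le:
  assumes "1 \<le> t" "0 < \<kappa>"
  shows "real (Suc t) powr (1 - \<kappa>) - real t powr (1 - \<kappa>) \<le> 1 / real (Suc t) powr \<kappa>"
proof -
  have "real t = real t powr \<kappa> * real t powr (1 - \<kappa>)"
    using assms by (simp flip: powr_add)
  also have "\<dots> \<le> real (Suc t) powr \<kappa> * real t powr (1 - \<kappa>)"
    using assms by (intro mult_right_mono powr_mono2) auto
  finally have "real (Suc t) powr \<kappa> * (real (Suc t) powr (1 - \<kappa>) - real t powr (1 - \<kappa>)) \<le> 1"
    using assms by (simp add: right_diff_distrib flip: powr_add)
  then show ?thesis
    by (simp add: field_simps)
qed

section \<open>Averaging over the current direction\<close>

text \<open>The Lipschitz bound cancels the \<open>1 / d\<close>, so two-point estimates stay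
  bounded however small the radius is.\<close>

lemma grad_est_bound:
  fixes x u :: "real ^ 'p"
  assumes lip: "\<And>v w. v \<in> X \<Longrightarrow> w \<in> X \<Longrightarrow> \<bar>h v - h w\<bar> \<le> L * norm (v - w)"
    and x: "cball x d \<subseteq> X" and d: "0 < d" and u: "norm u = 1"
  shows "norm (grad_est d h x u) \<le> real CARD('p) * L"
proof -
  have "x + d *\<^sub>R u \<in> X" "x \<in> X"
    using x d u by (auto simp: subset_eq dist_norm)
  then have "\<bar>h (x + d *\<^sub>R u) - h x\<bar> \<le> L * d"
    using lip[of "x + d *\<^sub>R u" x] d u by simp
  then have "real CARD('p) / d * \<bar>h (x + d *\<^sub>R u) - h x\<bar> \<le> real CARD('p) / d * (L * d)"
    using d by (intro mult_left_mono) auto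
  then show ?thesis
    using d u by (simp add: grad_est_def abs_mult)
qed

text \<open>Given the past, the point \<open>\<zeta>\<close> and the weight \<open>Q\<close> are
  frozen and only the direction is random, so \<open>integral_grad_est_le\<close> applies in the
  inner integral of Fubini's theorem; the nonnegative weight keeps the inequality. For a loss the
  weight will be 1, for a constraint a dual variable.\<close>

lemma (in prob_space) integral_grad_est_weighted:
  fixes U \<zeta> :: "'a \<Rightarrow> real ^ 'p" and h :: "real ^ 'p \<Rightarrow> real"
  assumes sF: "space F = space M" and F: "(\<lambda>\<omega>. \<omega>) \<in> measurable M F" and U_rv [measurable]: "U \<in> borel_measurable M"
    and indep: "distr M (F \<Otimes>\<^sub>M borel) (\<lambda>\<omega>. (\<omega>, U \<omega>)) = distr M F (\<lambda>\<omega>. \<omega>) \<Otimes>\<^sub>M distr M borel U"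
    and U: "distr M borel U = sphere_uniform"
    and U1: "\<And>\<omega>. \<omega> \<in> space M \<Longrightarrow> norm (U \<omega>) = 1"
    and \<zeta> [measurable]: "\<zeta> \<in> borel_measurable F" and Q [measurable]: "Q \<in> borel_measurable F"
    and Qb: "\<And>\<omega>. \<omega> \<in> space M \<Longrightarrow> 0 \<le> Q \<omega>" "\<And>\<omega>. \<omega> \<in> space M \<Longrightarrow> Q \<omega> \<le> K"
    and X: "convex X" "closed X" "X \<subseteq> cball 0 R" and conv: "convex_on X h"
    and lip: "\<And>v w. v \<in> X \<Longrightarrow> w \<in> X \<Longrightarrow> \<bar>h v - h w\<bar> \<le> L * norm (v - w)"
    and L: "0 \<le> L" and d: "0 < d"
    and balls: "\<And>\<omega>. \<omega> \<in> space M \<Longrightarrow> cball (\<zeta> \<omega>) d \<subseteq> X" "cball c d \<subseteq> X"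
  shows "(\<integral>\<omega>. Q \<omega> * (h (\<zeta> \<omega>) - h c - 2 * L * d) \<partial>M)
    \<le> (\<integral>\<omega>. Q \<omega> * (grad_est d h (\<zeta> \<omega>) (U \<omega>) \<bullet> (\<zeta> \<omega> - c)) \<partial>M)"
proof -
  \<comment> \<open>Outside \<open>X\<close> nothing is known about \<open>h\<close>, not even
    measurability. The extension by 0 is Borel because \<open>h\<close> is continuous on the closed
    set \<open>X\<close>.\<close>
  define h' where "h' x = indicator X x *\<^sub>R h x" for x
  have hX: "h' x = h x" if "x \<in> X" for x
    using that by (simp add: h'_def)
  have "continuous_on X h"
  proof (rule lipschitz_on_continuous_on)
    show "L-lipschitz_on X h"
      by (rule lipschitz_onI[OF _ L]) (unfold dist_norm real_norm_def, rule lip)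
  qed
  then have h' [measurable]: "h' \<in> borel_measurable borel"
    unfolding h'_def[abs_def] using X(2) by (intro borel_measurable_continuous_on_indicator) auto
  have lip': "\<bar>h' v - h' w\<bar> \<le> L * norm (v - w)" if "v \<in> X" "w \<in> X" for v w
    using lip[OF that] that by (simp add: hX)
  have conv': "convex_on X h'"
    unfolding convex_on_def
  proof (intro conjI X(1) ballI allI impI)
    fix v w s t assume *: "v \<in> X" "w \<in> X" "(0::real) \<le> s" "0 \<le> t" "s + t = 1"
    then have "h (s *\<^sub>R v + t *\<^sub>R w) \<le> s * h v + t * h w"
      using conv unfolding convex_on_def by blast
    then show "h' (s *\<^sub>R v + t *\<^sub>R w) \<le> s * h' v + t * h' w"
      using * convexD[OF X(1) *(1,2,3,4,5)] by (simp add: hX)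
  qed
  have c: "c \<in> X" using balls(2) d by auto
  have \<zeta>X: "\<zeta> \<omega> \<in> X" if "\<omega> \<in> space M" for \<omega>
    using balls(1)[OF that] d by auto
  have [measurable]: "\<zeta> \<in> borel_measurable M"
    by (rule measurable_compose[OF F \<zeta>])
  have [measurable]: "Q \<in> borel_measurable M"
    by (rule measurable_compose[OF F Q])
  define N where "N = distr M F (\<lambda>\<omega>. \<omega>)"
  interpret N: prob_space N
    unfolding N_def by (rule prob_space_distr[OF F])
  interpret S: prob_space "sphere_uniform :: (real^'p) measure"
    by (rule prob_space_sphere_uniform)
  interpret P: pair_sigma_finite N "sphere_uniform :: (real^'p) measure" ..
  have joint: "distr M (F \<Otimes>\<^sub>M borel) (\<lambda>\<omega>. (\<omega>, U \<omega>)) = N \<Otimes>\<^sub>M sphere_uniform"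
    by (simp only: indep U N_def)
  define G where "G = (\<lambda>(\<omega>, u). Q \<omega> * (grad_est d h' (\<zeta> \<omega>) u \<bullet> (\<zeta> \<omega> - c)))"
  have [measurable]: "G \<in> borel_measurable (F \<Otimes>\<^sub>M borel)"
    unfolding G_def grad_est_def by measurable
  have pair [measurable]: "(\<lambda>\<omega>. (\<omega>, U \<omega>)) \<in> measurable M (F \<Otimes>\<^sub>M borel)"
    by (rule measurable_Pair[OF F U_rv])
  have nrm: "norm (\<zeta> \<omega> - c) \<le> 2 * R" if "\<omega> \<in> space M" for \<omega>
  proof -
    have "norm (\<zeta> \<omega>) \<le> R" "norm c \<le> R"
      using \<zeta>X[OF that] c X(3) by (auto simp: subset_eq)
    then show ?thesis using norm_triangle_ineq4[of "\<zeta> \<omega>" c] by linarith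
  qed
  have Gb: "\<bar>G (\<omega>, U \<omega>)\<bar> \<le> K * (real CARD('p) * L * (2 * R))" if \<omega>: "\<omega> \<in> space M" for \<omega>
  proof -
    have "\<bar>grad_est d h' (\<zeta> \<omega>) (U \<omega>) \<bullet> (\<zeta> \<omega> - c)\<bar> \<le> norm (grad_est d h' (\<zeta> \<omega>) (U \<omega>)) * norm (\<zeta> \<omega> - c)"
      by (rule Cauchy_Schwarz_ineq2)
    also have "\<dots> \<le> (real CARD('p) * L) * (2 * R)"
      using L by (intro mult_mono grad_est_bound[OF lip' balls(1)[OF \<omega>] d U1[OF \<omega>]] nrm[OF \<omega>]) auto
    finally have "\<bar>Q \<omega>\<bar> * \<bar>grad_est d h' (\<zeta> \<omega>) (U \<omega>) \<bullet> (\<zeta> \<omega> - c)\<bar> \<le> K * (real CARD('p) * L * (2 * R))"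
      by (rule mult_mono[rotated]) (use Qb[OF \<omega>] in linarith)+
    then show ?thesis by (simp add: G_def abs_mult)
  qed
  have intG: "integrable (N \<Otimes>\<^sub>M sphere_uniform) G"
    unfolding joint[symmetric]
  proof (subst integrable_distr_eq[OF pair])
    show "integrable M (\<lambda>\<omega>. G (\<omega>, U \<omega>))"
    proof (rule integrable_const_bound)
      show "AE \<omega> in M. norm (G (\<omega>, U \<omega>)) \<le> K * (real CARD('p) * L * (2 * R))"
        using Gb by (intro AE_I2) simp
    qed measurable
  qed simp
  have "(\<integral>\<omega>. Q \<omega> * (h (\<zeta> \<omega>) - h c - 2 * L * d) \<partial>M) = (\<integral>\<omega>. Q \<omega> * (h' (\<zeta> \<omega>) - h' c - 2 * L * d) \<partial>M)"
    by (rule Bochner_Integration.integral_cong[OF refl]) (simp add: hX \<zeta>X c)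
  also have "\<dots> = (\<integral>\<omega>. Q \<omega> * (h' (\<zeta> \<omega>) - h' c - 2 * L * d) \<partial>N)"
    unfolding N_def by (rule integral_distr[OF F, symmetric]) measurable
  also have "\<dots> \<le> (\<integral>\<omega>. (\<integral>u. G (\<omega>, u) \<partial>sphere_uniform) \<partial>N)"
  proof (rule integral_mono_AE)
    show "integrable N (\<lambda>\<omega>. \<integral>u. G (\<omega>, u) \<partial>sphere_uniform)"
      by (rule P.integrable_fst'[OF intG])
    show "integrable N (\<lambda>\<omega>. Q \<omega> * (h' (\<zeta> \<omega>) - h' c - 2 * L * d))"
    proof (rule N.integrable_const_bound)
      show "AE \<omega> in N. norm (Q \<omega> * (h' (\<zeta> \<omega>) - h' c - 2 * L * d)) \<le> K * (L * (2 * R) + 2 * L * d)"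
      proof (rule AE_I2)
        fix \<omega> assume "\<omega> \<in> space N"
        then have \<omega>: "\<omega> \<in> space M" by (simp add: N_def sF)
        have "\<bar>h' (\<zeta> \<omega>) - h' c\<bar> \<le> L * (2 * R)"
          by (rule order.trans[OF lip'[OF \<zeta>X[OF \<omega>] c] mult_left_mono[OF nrm[OF \<omega>] L]])
        moreover have "0 \<le> 2 * L * d" using L d by simp
        ultimately have *: "\<bar>h' (\<zeta> \<omega>) - h' c - 2 * L * d\<bar> \<le> L * (2 * R) + 2 * L * d"
          by linarith
        have "\<bar>Q \<omega>\<bar> \<le> K" "0 \<le> K"
          using Qb[OF \<omega>] by auto
        then show "norm (Q \<omega> * (h' (\<zeta> \<omega>) - h' c - 2 * L * d)) \<le> K * (L * (2 * R) + 2 * L * d)"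
          unfolding real_norm_def abs_mult by (rule mult_mono[OF _ * _ abs_ge_zero])
      qed
      have "(\<lambda>\<omega>. Q \<omega> * (h' (\<zeta> \<omega>) - h' c - 2 * L * d)) \<in> borel_measurable F"
        by measurable
      then show "(\<lambda>\<omega>. Q \<omega> * (h' (\<zeta> \<omega>) - h' c - 2 * L * d)) \<in> borel_measurable N"
        by (simp only: N_def measurable_distr_eq1)
    qed
    \<comment> \<open>\<open>integral_grad_est_le\<close> bounds the estimate against
      \<open>c - \<zeta> \<omega>\<close> from above; the change of sign turns this into the lower
      bound sought.\<close>
    show "AE \<omega> in N. Q \<omega> * (h' (\<zeta> \<omega>) - h' c - 2 * L * d) \<le> (\<integral>u. G (\<omega>, u) \<partial>sphere_uniform)"
    proof (rule AE_I2)
      fix \<omega> assume "\<omega> \<in> space N"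
      then have \<omega>: "\<omega> \<in> space M" by (simp add: N_def sF)
      let ?I = "\<integral>u. grad_est d h' (\<zeta> \<omega>) u \<bullet> (c - \<zeta> \<omega>) \<partial>sphere_uniform"
      have "G (\<omega>, u) = - Q \<omega> * (grad_est d h' (\<zeta> \<omega>) u \<bullet> (c - \<zeta> \<omega>))" for u
        by (simp add: G_def inner_diff_right right_diff_distrib)
      then have *: "(\<integral>u. G (\<omega>, u) \<partial>sphere_uniform) = - (Q \<omega> * ?I)"
        by simp
      have "?I \<le> h' c - h' (\<zeta> \<omega>) + 2 * L * d"
        by (rule integral_grad_est_le[OF h' X(1) conv' lip' L d balls(1)[OF \<omega>] balls(2)])
      then have "Q \<omega> * ?I \<le> Q \<omega> * (h' c - h' (\<zeta> \<omega>) + 2 * L * d)"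
        using Qb[OF \<omega>] by (intro mult_left_mono) auto
      then show "Q \<omega> * (h' (\<zeta> \<omega>) - h' c - 2 * L * d) \<le> (\<integral>u. G (\<omega>, u) \<partial>sphere_uniform)"
        unfolding * by (simp add: algebra_simps)
    qed
  qed
  also have "\<dots> = integral\<^sup>L (N \<Otimes>\<^sub>M sphere_uniform) G"
    by (rule P.integral_fst'[OF intG])
  also have "\<dots> = (\<integral>\<omega>. G (\<omega>, U \<omega>) \<partial>M)"
    unfolding joint[symmetric] by (rule integral_distr[OF pair]) measurable
  \<comment> \<open>Along a realization the direction has norm one and both evaluation points lie in
    \<open>X\<close>, so the extension can be undone.\<close>
  also have "\<dots> = (\<integral>\<omega>. Q \<omega> * (grad_est d h (\<zeta> \<omega>) (U \<omega>) \<bullet> (\<zeta> \<omega> - c)) \<partial>M)"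
  proof (rule Bochner_Integration.integral_cong[OF refl])
    fix \<omega> assume \<omega>: "\<omega> \<in> space M"
    then have "\<zeta> \<omega> + d *\<^sub>R U \<omega> \<in> X"
      using balls(1)[OF \<omega>] U1[OF \<omega>] d by (auto simp: subset_eq dist_norm)
    then show "G (\<omega>, U \<omega>) = Q \<omega> * (grad_est d h (\<zeta> \<omega>) (U \<omega>) \<bullet> (\<zeta> \<omega> - c))"
      using \<zeta>X[OF \<omega>] by (simp add: G_def grad_est_def hX)
  qed
  finally show ?thesis .
qed

text \<open>The sigma-algebra of all directions drawn in rounds 1 to t - 1; the state at time
  \<open>t\<close> will turn out to be measurable with respect to it. As the preimage algebra of a
  restricted family it fits \<open>indep_var_restrict\<close>.\<close>

definition past :: "('n \<Rightarrow> nat \<Rightarrow> 'w \<Rightarrow> 'b::topological_space) \<Rightarrow> 'w set \<Rightarrow> nat \<Rightarrow> 'w measure" where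
  "past u \<Omega> t = vimage_algebra \<Omega> (\<lambda>\<omega>. restrict (\<lambda>i. (case i of (j, s) \<Rightarrow> u j s) \<omega>) (UNIV \<times> {1..<t}))
     (PiM (UNIV \<times> {1..<t}) (\<lambda>_. borel))"

lemma space_past [simp]: "space (past u \<Omega> t) = \<Omega>"
  by (simp add: past_def)

lemma measurable_past:
  assumes "1 \<le> s" "s < t"
  shows "u j s \<in> measurable (past u \<Omega> t) borel"
proof -
  let ?P = "\<lambda>\<omega>. restrict (\<lambda>i. (case i of (j, s) \<Rightarrow> u j s) \<omega>) (UNIV \<times> {1..<t})"
  have P: "?P \<in> measurable (past u \<Omega> t) (PiM (UNIV \<times> {1..<t}) (\<lambda>_. borel))"
    unfolding past_def by (rule measurable_vimage_algebra1) (simp add: space_PiM)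
  have comp: "(\<lambda>f. f (j, s)) \<in> measurable (PiM (UNIV \<times> {1..<t}) (\<lambda>_. borel)) borel"
    by (rule measurable_component_singleton) (use assms in simp)
  have "(\<lambda>\<omega>. ?P \<omega> (j, s)) \<in> measurable (past u \<Omega> t) borel"
    by (rule measurable_compose[OF P comp])
  moreover have "(\<lambda>\<omega>. ?P \<omega> (j, s)) = u j s"
    using assms by (simp add: fun_eq_iff)
  ultimately show ?thesis by simp
qed

lemma past_mono:
  fixes u :: "'n \<Rightarrow> nat \<Rightarrow> 'w \<Rightarrow> 'b::topological_space"
  assumes "f \<in> measurable (past u \<Omega> s) N" "s \<le> t"
  shows "f \<in> measurable (past u \<Omega> t) N"
proof -
  have "(\<lambda>\<omega>. \<omega>) \<in> measurable (past u \<Omega> t) (past u \<Omega> s)"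
    unfolding past_def[of u \<Omega> s]
  proof (rule measurable_vimage_algebra2)
    show "(\<lambda>\<omega>. restrict (\<lambda>i. (case i of (j, s) \<Rightarrow> u j s) \<omega>) (UNIV \<times> {1..<s}))
        \<in> measurable (past u \<Omega> t) (PiM (UNIV \<times> {1..<s}) (\<lambda>_. borel))"
    proof (rule measurable_restrict)
      fix i :: "'n \<times> nat"
      assume "i \<in> UNIV \<times> {1..<s}"
      then obtain j s' where "i = (j, s')" "1 \<le> s'" "s' < t"
        using assms(2) by (cases i) auto
      then show "(\<lambda>\<omega>. (case i of (j, s) \<Rightarrow> u j s) \<omega>) \<in> measurable (past u \<Omega> t) borel"
        using measurable_past[of s' t u j \<Omega>] by simp
    qed
  qed simp
  from measurable_compose[OF this assms(1)] show ?thesis .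
qed

lemma (in prob_space) measurable_id_past:
  fixes u :: "'n \<Rightarrow> nat \<Rightarrow> 'a \<Rightarrow> 'b::topological_space"
  assumes "\<And>j s. 1 \<le> s \<Longrightarrow> u j s \<in> measurable M borel"
  shows "(\<lambda>\<omega>. \<omega>) \<in> measurable M (past u (space M) t)"
  unfolding past_def
proof (rule measurable_vimage_algebra2)
  show "(\<lambda>\<omega>. restrict (\<lambda>i. (case i of (j, s) \<Rightarrow> u j s) \<omega>) (UNIV \<times> {1..<t}))
      \<in> measurable M (PiM (UNIV \<times> {1..<t}) (\<lambda>_. borel))"
  proof (rule measurable_restrict)
    fix i :: "'n \<times> nat"
    assume "i \<in> UNIV \<times> {1..<t}"
    then obtain j s where "i = (j, s)" "1 \<le> s"
      by (cases i) auto
    then show "(\<lambda>\<omega>. (case i of (j, s) \<Rightarrow> u j s) \<omega>) \<in> measurable M borel"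
      using assms[of s j] by simp
  qed
qed simp

text \<open>Past and current direction are functions of an independent family on disjoint index
  sets. Every set of the past is a preimage under the first of them, so both laws agree on
  rectangles and hence everywhere.\<close>

lemma (in prob_space) distr_past_Pair:
  fixes u :: "'n \<Rightarrow> nat \<Rightarrow> 'a \<Rightarrow> 'b::topological_space"
  assumes indep: "indep_vars (\<lambda>_. borel) (\<lambda>(i, t). u i t) (UNIV \<times> {1..})" and t: "1 \<le> t"
  defines "F \<equiv> past u (space M) t"
  shows "distr M (F \<Otimes>\<^sub>M borel) (\<lambda>\<omega>. (\<omega>, u i t \<omega>)) = distr M F (\<lambda>\<omega>. \<omega>) \<Otimes>\<^sub>M distr M borel (u i t)"
proof -
  define P where "P \<omega> = restrict (\<lambda>i. (case i of (j, s) \<Rightarrow> u j s) \<omega>) (UNIV \<times> {1..<t})" for \<omega>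
  define R where "R \<omega> = restrict (\<lambda>i. (case i of (j, s) \<Rightarrow> u j s) \<omega>) {(i, t)}" for \<omega>
  let ?N = "PiM (UNIV \<times> {1..<t}) (\<lambda>_. borel :: 'b measure)" and ?O = "PiM {(i, t)} (\<lambda>_. borel :: 'b measure)"
  have u: "u j s \<in> measurable M borel" if "1 \<le> s" for j s
    using indep that unfolding indep_vars_def by auto
  have F: "(\<lambda>\<omega>. \<omega>) \<in> measurable M F"
    unfolding F_def by (rule measurable_id_past[OF u])
  have pair: "(\<lambda>\<omega>. (\<omega>, u i t \<omega>)) \<in> measurable M (F \<Otimes>\<^sub>M borel)"
    by (rule measurable_Pair[OF F u[OF t]])
  have ind: "indep_var ?N P ?O R"
    unfolding P_def[abs_def] R_def[abs_def]
    by (rule indep_var_restrict[OF indep]) (use t in auto)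
  have "P \<in> space M \<rightarrow> space ?N"
    by (simp add: space_PiM P_def)
  then have sets_F: "sets F = {P -` A \<inter> space M |A. A \<in> sets ?N}"
    unfolding F_def past_def P_def[abs_def] by (rule sets_vimage_algebra2)
  have "distr M F (\<lambda>\<omega>. \<omega>) \<Otimes>\<^sub>M distr M borel (u i t) = distr M (F \<Otimes>\<^sub>M borel) (\<lambda>\<omega>. (\<omega>, u i t \<omega>))"
  proof (rule pair_measure_eqI)
    show "sigma_finite_measure (distr M F (\<lambda>\<omega>. \<omega>))"
      using prob_space_distr[OF F] by (simp add: prob_space_def finite_measure_def)
    show "sigma_finite_measure (distr M borel (u i t))"
      using prob_space_distr[OF u[OF t]] by (simp add: prob_space_def finite_measure_def)
    show "sets (distr M F (\<lambda>\<omega>. \<omega>) \<Otimes>\<^sub>M distr M borel (u i t)) = sets (distr M (F \<Otimes>\<^sub>M borel) (\<lambda>\<omega>. (\<omega>, u i t \<omega>)))"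
      unfolding sets_distr by (rule sets_pair_measure_cong) simp_all
    fix A B assume "A \<in> sets (distr M F (\<lambda>\<omega>. \<omega>))" "B \<in> sets (distr M borel (u i t))"
    then have A: "A \<in> sets F" and B: "B \<in> sets borel" by simp_all
    from A obtain A' where A': "A' \<in> sets ?N" "A = P -` A' \<inter> space M"
      unfolding sets_F by blast
    \<comment> \<open>\<open>R\<close> takes values in a product over one index; \<open>B'\<close>
      is the cylinder over \<open>B\<close>.\<close>
    define B' where "B' = (\<lambda>f. f (i, t)) -` B \<inter> space ?O"
    have B': "B' \<in> sets ?O"
      unfolding B'_def using measurable_sets[OF measurable_component_singleton[of "(i, t)" "{(i, t)}" "\<lambda>_. borel"] B] by simp
    have RB: "R \<omega> \<in> B' \<longleftrightarrow> u i t \<omega> \<in> B" for \<omega>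
      by (simp add: B'_def space_PiM R_def)
    have key: "prob ((\<lambda>\<omega>. (P \<omega>, R \<omega>)) -` (A' \<times> B') \<inter> space M) = prob (P -` A' \<inter> space M) * prob (R -` B' \<inter> space M)"
      by (rule indep_varD[OF ind A'(1) B'])
    have s1: "(\<lambda>\<omega>. \<omega>) -` A \<inter> space M = P -` A' \<inter> space M"
      using A'(2) by blast
    have s2: "u i t -` B \<inter> space M = R -` B' \<inter> space M"
      using RB by blast
    have s3: "(\<lambda>\<omega>. (\<omega>, u i t \<omega>)) -` (A \<times> B) \<inter> space M = (\<lambda>\<omega>. (P \<omega>, R \<omega>)) -` (A' \<times> B') \<inter> space M"
      using RB A'(2) by blast
    have AB: "A \<times> B \<in> sets (F \<Otimes>\<^sub>M borel)"
      using A B by simp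
    show "emeasure (distr M F (\<lambda>\<omega>. \<omega>)) A * emeasure (distr M borel (u i t)) B
        = emeasure (distr M (F \<Otimes>\<^sub>M borel) (\<lambda>\<omega>. (\<omega>, u i t \<omega>))) (A \<times> B)"
      unfolding emeasure_distr[OF F A] emeasure_distr[OF u[OF t] B] emeasure_distr[OF pair AB] s1 s2 s3
        emeasure_eq_measure key by (simp add: ennreal_mult')
  qed
  then show ?thesis by simp
qed

section \<open>The energy inequality along a realization\<close>

text \<open>A column is the image of a unit vector. In this way the bound on the spectral norm
  becomes a Lipschitz bound for every constraint component.\<close>

lemma norm_column_le_spectral_norm:
  fixes A :: "nat \<Rightarrow> real ^ 'p"
  assumes "k < d"
  shows "norm (A k) \<le> spectral_norm d A"
proof -
  define v :: "nat \<Rightarrow> real" where "v l = (if l = k then 1 else 0)" for l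
  have "mat_apply d A v = (\<Sum>l<d. if l = k then A l else 0)"
    unfolding mat_apply_def v_def by (intro sum.cong) auto
  then have mv: "mat_apply d A v = A k" using assms by simp
  have "(\<Sum>l<d. (v l)\<^sup>2) = (\<Sum>l<d. if l = k then 1 else 0)"
    unfolding v_def by (intro sum.cong) auto
  then have "L2_set v {..<d} \<le> 1" using assms by (simp add: L2_set_def)
  then have v: "v \<in> {v. L2_set v {..<d} \<le> 1}" by simp
  \<comment> \<open>A supremum of reals is known to dominate the members only of a bounded
    set.\<close>
  have "bdd_above ((\<lambda>v. norm (mat_apply d A v)) ` {v. L2_set v {..<d} \<le> 1})"
  proof (rule bdd_aboveI2)
    fix v :: "nat \<Rightarrow> real" assume "v \<in> {v. L2_set v {..<d} \<le> 1}"
    then have 1: "L2_set v {..<d} \<le> 1" by simp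
    show "norm (mat_apply d A v) \<le> (\<Sum>l<d. norm (A l))"
      unfolding mat_apply_def
    proof (rule order.trans[OF norm_sum], rule sum_mono)
      fix l assume "l \<in> {..<d}"
      then have "\<bar>v l\<bar> \<le> L2_set (\<lambda>i. \<bar>v i\<bar>) {..<d}"
        by (intro member_le_L2_set) auto
      moreover have "L2_set (\<lambda>i. \<bar>v i\<bar>) {..<d} = L2_set v {..<d}"
        by (simp add: L2_set_def)
      ultimately have "\<bar>v l\<bar> \<le> 1" using 1 by linarith
      then show "norm (v l *\<^sub>R A l) \<le> norm (A l)"
        using mult_right_mono[of "\<bar>v l\<bar>" 1 "norm (A l)"] by simp
    qed
  qed
  from cSUP_upper[OF v this] show ?thesis
    unfolding spectral_norm_def mv .
qed

text \<open>One bounded subgradient at each of the two points bounds the difference in both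
  directions.\<close>

lemma subgradients_imp_lipschitz:
  assumes "\<And>x. x \<in> X \<Longrightarrow> \<exists>s. subgradient_on X h x s \<and> norm s \<le> L" and "v \<in> X" "w \<in> X"
  shows "\<bar>h v - h w\<bar> \<le> L * norm (v - w)"
proof -
  have *: "h a - h b \<le> L * norm (a - b)" if ab: "a \<in> X" "b \<in> X" for a b
  proof -
    obtain s where s: "subgradient_on X h a s" "norm s \<le> L" using assms(1) ab by blast
    have "h a - h b \<le> - (s \<bullet> (b - a))"
      using s(1) ab(2) unfolding subgradient_on_def by fastforce
    also have "\<dots> \<le> norm s * norm (b - a)"
      using Cauchy_Schwarz_ineq2[of s "b - a"] by linarith
    also have "\<dots> \<le> L * norm (a - b)"
      using s(2) by (simp add: mult_right_mono norm_minus_commute)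
    finally show ?thesis .
  qed
  show ?thesis
    using *[OF assms(2,3)] *[OF assms(3,2)] by (simp add: norm_minus_commute)
qed

lemma convex_on_pos_part:
  assumes "convex_on X h"
  shows "convex_on X (\<lambda>x. max 0 (h x :: real))"
  unfolding convex_on_def
proof (intro conjI ballI allI impI)
  show "convex X" using assms by (rule convex_on_imp_convex)
  fix v w s t assume *: "v \<in> X" "w \<in> X" "(0::real) \<le> s" "0 \<le> t" "s + t = 1"
  then have "h (s *\<^sub>R v + t *\<^sub>R w) \<le> s * h v + t * h w"
    using assms unfolding convex_on_def by blast
  also have "\<dots> \<le> s * max 0 (h v) + t * max 0 (h w)"
    using * by (intro add_mono mult_left_mono) auto
  finally show "max 0 (h (s *\<^sub>R v + t *\<^sub>R w)) \<le> s * max 0 (h v) + t * max 0 (h w)"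
    using * by simp
qed

text \<open>Jensen's inequality for the squared norm, obtained from the nonnegativity of the
  weighted variance.\<close>

lemma weighted_norm_sq_le:
  fixes v :: "'n::finite \<Rightarrow> 'a::real_inner"
  assumes w: "\<And>j. 0 \<le> w j" "(\<Sum>j\<in>UNIV. w j) = 1"
  shows "(norm (\<Sum>j\<in>UNIV. w j *\<^sub>R v j))\<^sup>2 \<le> (\<Sum>j\<in>UNIV. w j * (norm (v j))\<^sup>2)"
proof -
  define b where "b = (\<Sum>j\<in>UNIV. w j *\<^sub>R v j)"
  have "0 \<le> (\<Sum>j\<in>UNIV. w j * (norm (v j - b))\<^sup>2)"
    using w(1) by (intro sum_nonneg) auto
  also have "\<dots> = (\<Sum>j\<in>UNIV. w j * (norm (v j))\<^sup>2 - 2 * ((w j *\<^sub>R v j) \<bullet> b) + w j * (norm b)\<^sup>2)"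
    by (intro sum.cong) (simp_all add: power2_norm_eq_inner inner_diff_left inner_diff_right inner_commute algebra_simps)
  also have "\<dots> = (\<Sum>j\<in>UNIV. w j * (norm (v j))\<^sup>2) - 2 * (b \<bullet> b) + (norm b)\<^sup>2"
    unfolding sum.distrib sum_subtractf sum_distrib_left[symmetric] sum_distrib_right[symmetric] inner_sum_left[symmetric] w(2)
    by (simp add: b_def)
  finally show ?thesis
    by (simp add: b_def power2_norm_eq_inner)
qed

text \<open>Summation by parts with increasing weights. The induction carries \<open>- B T'\<close>
  inside the bracket, which stays nonnegative because \<open>B\<close> is at most \<open>C\<close>;
  hence the weight may be raised at each step. In the application \<open>p\<close> is the price of
  changing the comparator between rounds.\<close>

lemma weighted_telescope:
  fixes w A B p :: "nat \<Rightarrow> real"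
  assumes w: "\<And>t. 1 \<le> t \<Longrightarrow> 0 \<le> w t" "\<And>t. 1 \<le> t \<Longrightarrow> w t \<le> w (Suc t)"
    and A: "A 1 \<le> C" and B: "\<And>t. 1 \<le> t \<Longrightarrow> t \<le> T \<Longrightarrow> 0 \<le> B t" "\<And>t. 1 \<le> t \<Longrightarrow> t \<le> T \<Longrightarrow> B t \<le> C"
    and p: "\<And>t. 1 \<le> t \<Longrightarrow> 0 \<le> p t"
    and succ: "\<And>t. 1 \<le> t \<Longrightarrow> t < T \<Longrightarrow> A (Suc t) \<le> B t + p t"
    and T: "1 \<le> T"
  shows "(\<Sum>t=1..T. w t * (A t - B t)) \<le> w T * (C + (\<Sum>t=1..<T. p t))"
proof -
  have "(\<Sum>t=1..T'. w t * (A t - B t)) \<le> w T' * (C + (\<Sum>t=1..<T'. p t) - B T')"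
    if "1 \<le> T'" "T' \<le> T" for T'
    using that
  proof (induction rule: dec_induct)
    case base
    then show ?case using A w(1)[of 1] by (simp add: mult_left_mono)
  next
    case (step n)
    let ?P = "\<Sum>t=1..<n. p t"
    have P: "0 \<le> ?P" using p by (intro sum_nonneg) auto
    have "w n * (C + ?P - B n) \<le> w (Suc n) * (C + ?P - B n)"
      using step w(2)[of n] B(2)[of n] P by (intro mult_right_mono) auto
    moreover have "w (Suc n) * A (Suc n) \<le> w (Suc n) * (B n + p n)"
      using step w(1)[of "Suc n"] succ[of n] by (intro mult_left_mono) auto
    ultimately have "(\<Sum>t=1..n. w t * (A t - B t)) + w (Suc n) * (A (Suc n) - B (Suc n))
        \<le> w (Suc n) * (C + (?P + p n) - B (Suc n))"
      using step by (simp add: algebra_simps)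
    then show ?case using step by simp
  qed
  from this[OF T order_refl] have "(\<Sum>t=1..T. w t * (A t - B t)) \<le> w T * (C + (\<Sum>t=1..<T. p t) - B T)" .
  also have "\<dots> \<le> w T * (C + (\<Sum>t=1..<T. p t))"
    using w(1)[OF T] B(1)[OF T order_refl] by (intro mult_left_mono) auto
  finally show ?thesis .
qed

lemma L2_set_component_le: "k < d \<Longrightarrow> \<bar>v k\<bar> \<le> L2_set v {..<d :: nat}"
proof -
  assume "k < d"
  then have "(\<lambda>i. \<bar>v i\<bar>) k \<le> L2_set (\<lambda>i. \<bar>v i\<bar>) {..<d}"
    by (intro member_le_L2_set) auto
  then show ?thesis by (simp add: L2_set_def)
qed

text \<open>The assumption \<open>consensus\<close> is the conclusion of \<open>sum_disagreement_bound\<close>; stating it with a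
  parameter \<open>Cd\<close> keeps all later constants independent of the realization.\<close>

locale setting =
  fixes X :: "(real ^ 'p) set" and r R :: real and m :: "'n::finite \<Rightarrow> nat"
    and f :: "'n \<Rightarrow> nat \<Rightarrow> real ^ 'p \<Rightarrow> real"
    and g :: "'n \<Rightarrow> nat \<Rightarrow> real ^ 'p \<Rightarrow> nat \<Rightarrow> real"
    and W :: "nat \<Rightarrow> real ^ 'n ^ 'n"
    and \<tau> \<Psi> \<alpha> \<beta> \<gamma> \<xi> \<delta> :: "nat \<Rightarrow> real" and \<kappa> L F Cd :: real
  assumes X: "convex X" "closed X" and r: "0 < r" and R: "0 < R"
    and ball_X: "cball 0 r \<subseteq> X" and X_ball: "X \<subseteq> cball 0 R"
    and conv_f: "\<And>i t. 1 \<le> t \<Longrightarrow> convex_on X (f i t)"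
    and conv_g: "\<And>i t k. 1 \<le> t \<Longrightarrow> k < m i \<Longrightarrow> convex_on X (\<lambda>x. g i t x k)"
    and f_bound: "\<And>i t v w. 1 \<le> t \<Longrightarrow> v \<in> X \<Longrightarrow> w \<in> X \<Longrightarrow> \<bar>f i t v - f i t w\<bar> \<le> F"
    and g_bound: "\<And>i t v k. 1 \<le> t \<Longrightarrow> v \<in> X \<Longrightarrow> k < m i \<Longrightarrow> \<bar>g i t v k\<bar> \<le> F"
    and lip_f: "\<And>i t v w. 1 \<le> t \<Longrightarrow> v \<in> X \<Longrightarrow> w \<in> X \<Longrightarrow> \<bar>f i t v - f i t w\<bar> \<le> L * norm (v - w)"
    and lip_g: "\<And>i t v w k. 1 \<le> t \<Longrightarrow> v \<in> X \<Longrightarrow> w \<in> X \<Longrightarrow> k < m i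
      \<Longrightarrow> \<bar>g i t v k - g i t w k\<bar> \<le> L * norm (v - w)"
    and L: "0 \<le> L" and F: "0 \<le> F"
    and stoch: "\<And>t. 1 \<le> t \<Longrightarrow> doubly_stochastic (W t)"
    and Cd: "0 \<le> Cd"
    and consensus: "\<And>(v :: nat \<Rightarrow> 'n \<Rightarrow> real ^ 'p) e \<epsilon> D T.
      \<lbrakk>\<And>s i. 1 \<le> s \<Longrightarrow> v (Suc s) i = (\<Sum>j\<in>UNIV. W s $ i $ j *\<^sub>R v s j) + e s i;
       \<And>s i. 1 \<le> s \<Longrightarrow> norm (e s i) \<le> \<epsilon> s; \<And>s. 1 \<le> s \<Longrightarrow> disagreement (v s) \<le> D\<rbrakk>
      \<Longrightarrow> (\<Sum>t=1..T. disagreement (v t)) \<le> Cd * (D + (\<Sum>t=1..T. \<epsilon> t))"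
    and tau_pos: "\<And>t. t \<ge> 1 \<Longrightarrow> \<tau> t > 0"
    and tau_mono: "\<And>s t. 1 \<le> s \<Longrightarrow> s \<le> t \<Longrightarrow> \<tau> t \<le> \<tau> s"
    and Psi: "\<And>t. \<Psi> t = (\<Sum>k=1..t. \<tau> k)"
    and kappa: "0 < \<kappa>" "\<kappa> < 1"
    and alpha: "\<And>t. t \<ge> 1 \<Longrightarrow> \<alpha> t = sqrt (\<Psi> t / real t)"
    and beta: "\<And>t. t \<ge> 1 \<Longrightarrow> \<beta> t = 1 / real t powr \<kappa>"
    and gamma: "\<And>t. t \<ge> 1 \<Longrightarrow> \<gamma> t = 1 / real t powr (1 - \<kappa>)"
    and xi: "\<And>t. t \<ge> 1 \<Longrightarrow> \<xi> t = 1 / (real t + 1)"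
    and delta: "\<And>t. t \<ge> 1 \<Longrightarrow> \<delta> t = r / (real t + 1)"
begin

definition shrunk :: "nat \<Rightarrow> (real ^ 'p) set" where
  "shrunk t = (\<lambda>v. (1 - \<xi> t) *\<^sub>R v) ` X"

definition N :: real where "N = real CARD('n)"
text \<open>By \<open>grad_est_bound\<close> this bounds all two-point estimates.\<close>

definition G :: real where "G = real CARD('p) * L"
text \<open>Bound for the linearised violation: a constraint value plus an estimate of norm at most
  \<open>G\<close> times a move of length at most \<open>2 * R\<close>.\<close>

definition B :: real where "B = F + 2 * R * G"
definition M :: real where "M = (\<Sum>i\<in>UNIV. real (m i))"
text \<open>The factor of the path length in the regret bound; its double dominates
  \<open>1 / \<alpha> (Suc T)\<close>.\<close>

definition path :: "nat \<Rightarrow> real" where "path T = sqrt (inverse (\<Psi> T) * real T)"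
definition rate :: "nat \<Rightarrow> real" where "rate T = sqrt (\<Psi> T * real T)"

lemma N_ge_1: "1 \<le> N" by (simp add: N_def Suc_leI)
lemma G_nonneg: "0 \<le> G" using L by (simp add: G_def)
lemma M_nonneg: "0 \<le> M" by (simp add: M_def sum_nonneg)
lemma B_nonneg: "0 \<le> B" using F R G_nonneg by (simp add: B_def)

lemma zero_X: "0 \<in> X" using ball_X r by auto

lemma norm_X: "v \<in> X \<Longrightarrow> norm v \<le> R" using X_ball by auto

lemma norm_diff_X: "v \<in> X \<Longrightarrow> w \<in> X \<Longrightarrow> norm (v - w) \<le> 2 * R"
  using norm_X[of v] norm_X[of w] norm_triangle_ineq4[of v w] by linarith

lemma xi_bounds: "1 \<le> t \<Longrightarrow> 0 < \<xi> t" "1 \<le> t \<Longrightarrow> \<xi> t < 1"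
  by (auto simp: xi)

lemma xi_antimono: "1 \<le> s \<Longrightarrow> s \<le> t \<Longrightarrow> \<xi> t \<le> \<xi> s"
  by (simp add: xi frac_le)

lemma delta_pos: "1 \<le> t \<Longrightarrow> 0 < \<delta> t"
  using r by (simp add: delta)

lemma delta_eq: "1 \<le> t \<Longrightarrow> \<delta> t = r * \<xi> t"
  by (simp add: delta xi)

lemma shrunk_convex: "convex (shrunk t)"
  unfolding shrunk_def by (rule convex_scaling[OF X(1)])

lemma shrunk_closed: "closed (shrunk t)"
  unfolding shrunk_def by (rule closed_scaling[OF X(2)])

lemma zero_shrunk: "0 \<in> shrunk t"
  unfolding shrunk_def using zero_X by (auto intro!: image_eqI[of _ _ 0])

lemma scale_in_X: "v \<in> X \<Longrightarrow> 0 \<le> c \<Longrightarrow> c \<le> 1 \<Longrightarrow> c *\<^sub>R v \<in> X"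
  using convexD[OF X(1) zero_X, of v "1 - c" c] by simp

lemma shrunk_subset_X: "1 \<le> t \<Longrightarrow> shrunk t \<subseteq> X"
  unfolding shrunk_def using xi_bounds[of t] by (auto intro!: scale_in_X)

text \<open>The projection ending round \<open>t\<close> is onto the next set, while the comparator
  is taken from the current one. The inclusion holds because \<xi> decreases and \<open>X\<close> is
  star-shaped about 0.\<close>

lemma shrunk_mono:
  assumes "1 \<le> s" "s \<le> t"
  shows "shrunk s \<subseteq> shrunk t"
proof
  fix x assume "x \<in> shrunk s"
  then obtain v where v: "v \<in> X" "x = (1 - \<xi> s) *\<^sub>R v" by (auto simp: shrunk_def)
  define c where "c = (1 - \<xi> s) / (1 - \<xi> t)"
  have *: "0 \<le> 1 - \<xi> s" "1 - \<xi> s \<le> 1 - \<xi> t" "0 < 1 - \<xi> t"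
    using xi_bounds[of s] xi_bounds[of t] xi_antimono[OF assms] assms by auto
  then have "0 \<le> c" "c \<le> 1" by (auto simp: c_def)
  then have "c *\<^sub>R v \<in> X" using v by (intro scale_in_X)
  moreover have "x = (1 - \<xi> t) *\<^sub>R (c *\<^sub>R v)" using * v by (simp add: c_def)
  ultimately show "x \<in> shrunk t" unfolding shrunk_def by (rule image_eqI[rotated])
qed

text \<open>A point of the ball is a convex combination, with weight \<xi>, of a point of
  \<open>X\<close> and a point of the ball of radius \<open>r\<close> about 0. Here the relation
  \<open>\<delta> t = r * \<xi> t\<close> is used.\<close>

lemma cball_shrunk:
  assumes t: "1 \<le> t" and x: "x \<in> shrunk t"
  shows "cball x (\<delta> t) \<subseteq> X"
proof
  fix z assume z: "z \<in> cball x (\<delta> t)"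
  obtain v where v: "v \<in> X" "x = (1 - \<xi> t) *\<^sub>R v" using x by (auto simp: shrunk_def)
  have p: "0 < \<xi> t" "\<xi> t < 1" using xi_bounds t by auto
  have "norm (z - x) \<le> r * \<xi> t"
    using z delta_eq[OF t] by (simp add: dist_norm norm_minus_commute)
  then have "norm (z - x) / \<xi> t \<le> r"
    using p by (simp only: pos_divide_le_eq)
  then have "norm ((z - x) /\<^sub>R \<xi> t) \<le> r"
    using p by (simp add: divide_inverse mult.commute)
  then have "(z - x) /\<^sub>R \<xi> t \<in> X" using ball_X by auto
  then have "(1 - \<xi> t) *\<^sub>R v + \<xi> t *\<^sub>R ((z - x) /\<^sub>R \<xi> t) \<in> X"
    using v p by (intro convexD[OF X(1)]) auto
  then show "z \<in> X" using p v by simp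
qed

lemma lip_pos_g:
  "1 \<le> t \<Longrightarrow> v \<in> X \<Longrightarrow> w \<in> X \<Longrightarrow> k < m i
    \<Longrightarrow> \<bar>max 0 (g i t v k) - max 0 (g i t w k)\<bar> \<le> L * norm (v - w)"
  using lip_g[of t v w k i] by linarith

section \<open>Thresholds, step sizes and their sums\<close>

lemma Psi_pos: "1 \<le> t \<Longrightarrow> 0 < \<Psi> t"
  unfolding Psi by (rule sum_pos) (auto intro: tau_pos)

lemma Psi_mono: "s \<le> t \<Longrightarrow> \<Psi> s \<le> \<Psi> t"
  unfolding Psi by (rule sum_mono2) (auto intro!: less_imp_le[OF tau_pos])

lemma Psi_ge_tau_1: "1 \<le> t \<Longrightarrow> \<tau> 1 \<le> \<Psi> t"
  using Psi_mono[of 1 t] by (simp add: Psi)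

lemma Psi_le: "\<Psi> t \<le> \<tau> 1 * real t"
proof -
  have "\<Psi> t \<le> (\<Sum>k=1..t. \<tau> 1)"
    unfolding Psi by (intro sum_mono tau_mono) auto
  then show ?thesis by (simp add: mult.commute)
qed

lemma alpha_pos: "1 \<le> t \<Longrightarrow> 0 < \<alpha> t"
  using Psi_pos[of t] by (simp add: alpha)

lemma alpha_antimono: "1 \<le> s \<Longrightarrow> s \<le> t \<Longrightarrow> \<alpha> t \<le> \<alpha> s"
  using average_antimono[OF tau_mono Psi, of s t] by (simp add: alpha)

lemma rate_nonneg: "0 \<le> rate T"
  using Psi_mono[of 0 T] by (simp add: rate_def Psi[of 0])

lemma path_nonneg: "0 \<le> path T"
  using Psi_mono[of 0 T] by (simp add: path_def Psi[of 0])

lemma sum_tau_le: "\<Psi> T \<le> sqrt (\<tau> 1) * rate T"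
proof -
  have P: "0 \<le> \<Psi> T" using Psi_mono[of 0 T] by (simp add: Psi[of 0])
  have "\<Psi> T = sqrt (\<Psi> T * \<Psi> T)" using P by simp
  also have "\<dots> \<le> sqrt (\<Psi> T * (\<tau> 1 * real T))"
    using P Psi_le by (intro real_sqrt_le_mono mult_left_mono)
  also have "\<dots> = sqrt (\<tau> 1) * rate T"
    by (simp add: rate_def real_sqrt_mult)
  finally show ?thesis .
qed

lemma sum_alpha_le: "(\<Sum>t=1..T. \<alpha> (Suc t)) \<le> 2 * rate T"
proof -
  have "(\<Sum>t=1..T. \<alpha> (Suc t)) \<le> (\<Sum>t=1..T. sqrt (\<Psi> T) * (1 / sqrt (real t)))"
  proof (rule sum_mono)
    fix t assume t: "t \<in> {1..T}"
    then have "\<alpha> (Suc t) \<le> \<alpha> t" by (intro alpha_antimono) auto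
    also have "\<dots> = sqrt (\<Psi> t) * (1 / sqrt (real t))"
      using t by (simp add: alpha real_sqrt_divide)
    also have "\<dots> \<le> sqrt (\<Psi> T) * (1 / sqrt (real t))"
      using t by (intro mult_right_mono real_sqrt_le_mono Psi_mono) auto
    finally show "\<alpha> (Suc t) \<le> sqrt (\<Psi> T) * (1 / sqrt (real t))" .
  qed
  also have "\<dots> = sqrt (\<Psi> T) * (\<Sum>t=1..T. 1 / sqrt (real t))"
    by (simp only: sum_distrib_left)
  also have "\<dots> \<le> sqrt (\<Psi> T) * (2 * sqrt (real T))"
    using Psi_mono[of 0 T] by (intro mult_left_mono sum_inverse_sqrt_le) (simp add: Psi[of 0])
  finally show ?thesis by (simp add: rate_def real_sqrt_mult)
qed

text \<open>The primal step of round \<open>t\<close> uses \<alpha> at time t + 1; the shift costs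
  the factor 2, by \<open>real (Suc t) \<le> 4 * real t\<close>.\<close>

lemma inverse_alpha_le:
  assumes "1 \<le> t"
  shows "1 / \<alpha> (Suc t) \<le> 2 * (sqrt (real t) / sqrt (\<Psi> t))"
proof -
  have P: "0 < \<Psi> t" using Psi_pos[OF assms] .
  have "real (Suc t) / \<Psi> (Suc t) \<le> real (Suc t) / \<Psi> t"
    using P Psi_mono[of t "Suc t"] by (intro divide_left_mono) auto
  also have "\<dots> \<le> 4 * real t / \<Psi> t"
    using P assms by (intro divide_right_mono) auto
  finally have "sqrt (real (Suc t) / \<Psi> (Suc t)) \<le> sqrt (4 * real t / \<Psi> t)"
    by (rule real_sqrt_le_mono)
  also have "sqrt (4 * real t / \<Psi> t) = 2 * (sqrt (real t) / sqrt (\<Psi> t))"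
    by (simp add: real_sqrt_divide real_sqrt_mult)
  finally show ?thesis
    by (simp add: alpha real_sqrt_divide)
qed

lemma inverse_alpha_le_path: "1 \<le> T \<Longrightarrow> 1 / \<alpha> (Suc T) \<le> 2 * path T"
  using inverse_alpha_le[of T] by (simp add: path_def real_sqrt_mult real_sqrt_inverse divide_inverse mult.commute)

text \<open>The cumulative threshold is at least \<open>\<tau> 1\<close>. This absorbs the
  path-independent part of the telescoped distances into \<open>rate\<close>.\<close>

lemma path_le_rate:
  assumes "1 \<le> T"
  shows "path T \<le> rate T / \<tau> 1"
proof -
  have P: "0 < \<Psi> T" using Psi_pos[OF assms] .
  have "path T = rate T / \<Psi> T"
  proof -
    have "inverse (\<Psi> T) * real T = \<Psi> T * real T / (\<Psi> T)\<^sup>2"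
      using P by (simp add: power2_eq_square field_simps)
    then show ?thesis
      using P unfolding path_def rate_def by (simp add: real_sqrt_divide)
  qed
  also have "\<dots> \<le> rate T / \<tau> 1"
    using Psi_ge_tau_1[OF assms] tau_pos[of 1] rate_nonneg[of T] by (intro divide_left_mono) auto
  finally show ?thesis .
qed

text \<open>Division by the step size leaves the terms of \<open>sum_div_sqrt_le\<close> times the
  square root of the time. The outcome has the order of the sum of \<alpha>, which is the balance
  behind this step size.\<close>

lemma sum_tau_div_alpha_le: "(\<Sum>t=1..T. \<tau> t / \<alpha> (Suc t)) \<le> 4 * rate T"
proof -
  have "(\<Sum>t=1..T. \<tau> t / \<alpha> (Suc t)) \<le> (\<Sum>t=1..T. 2 * sqrt (real T) * (\<tau> t / sqrt (\<Psi> t)))"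
  proof (rule sum_mono)
    fix t assume t: "t \<in> {1..T}"
    then have t1: "1 \<le> t" "t \<le> T" by auto
    have "\<tau> t / \<alpha> (Suc t) = \<tau> t * (1 / \<alpha> (Suc t))" by simp
    also have "\<dots> \<le> \<tau> t * (2 * (sqrt (real t) / sqrt (\<Psi> t)))"
      using tau_pos[OF t1(1)] by (intro mult_left_mono inverse_alpha_le t1) auto
    also have "\<dots> = 2 * sqrt (real t) * (\<tau> t / sqrt (\<Psi> t))" by simp
    also have "\<dots> \<le> 2 * sqrt (real T) * (\<tau> t / sqrt (\<Psi> t))"
      using t1 tau_pos[OF t1(1)] Psi_pos[OF t1(1)] by (intro mult_right_mono) auto
    finally show "\<tau> t / \<alpha> (Suc t) \<le> 2 * sqrt (real T) * (\<tau> t / sqrt (\<Psi> t))" .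
  qed
  also have "\<dots> = 2 * sqrt (real T) * (\<Sum>t=1..T. \<tau> t / sqrt (\<Psi> t))"
    by (simp only: sum_distrib_left)
  also have "\<dots> \<le> 2 * sqrt (real T) * (2 * sqrt (\<Psi> T))"
    by (intro mult_left_mono sum_div_sqrt_le[OF tau_pos Psi]) auto
  finally show ?thesis by (simp add: rate_def real_sqrt_mult mult.commute)
qed

lemma gamma_pos: "1 \<le> t \<Longrightarrow> 0 < \<gamma> t" and beta_pos: "1 \<le> t \<Longrightarrow> 0 < \<beta> t"
  by (simp_all add: gamma beta)

lemma gamma_Suc_le: "1 \<le> t \<Longrightarrow> \<gamma> (Suc t) \<le> \<gamma> t"
  using kappa by (simp add: gamma powr_mono2 frac_le)

lemma beta_Suc_le: "1 \<le> t \<Longrightarrow> \<beta> (Suc t) \<le> \<beta> t"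
  using kappa by (simp add: beta powr_mono2 frac_le)

lemma sum_gamma_le: "(\<Sum>t=1..T. \<gamma> (Suc t)) \<le> real T powr \<kappa> / \<kappa>"
proof -
  have "(\<Sum>t=1..T. \<gamma> (Suc t)) \<le> (\<Sum>t=1..T. real t powr (\<kappa> - 1))"
  proof (rule sum_mono)
    fix t assume t: "t \<in> {1..T}"
    then have "\<gamma> (Suc t) \<le> \<gamma> t" by (intro gamma_Suc_le) auto
    also have "\<dots> = real t powr (- (1 - \<kappa>))"
      using t by (simp only: gamma powr_minus_divide atLeastAtMost_iff)
    finally show "\<gamma> (Suc t) \<le> real t powr (\<kappa> - 1)" by simp
  qed
  also have "\<dots> \<le> real T powr \<kappa> / \<kappa>"
    using kappa by (intro sum_powr_le) auto
  finally show ?thesis .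
qed

lemma sum_beta_le: "(\<Sum>t=1..T. \<beta> (Suc t)) \<le> real T powr (1 - \<kappa>) / (1 - \<kappa>)"
proof -
  have "(\<Sum>t=1..T. \<beta> (Suc t)) \<le> (\<Sum>t=1..T. real t powr ((1 - \<kappa>) - 1))"
  proof (rule sum_mono)
    fix t assume t: "t \<in> {1..T}"
    then have "\<beta> (Suc t) \<le> \<beta> t" by (intro beta_Suc_le) auto
    also have "\<dots> = real t powr (- \<kappa>)"
      using t by (simp only: beta powr_minus_divide atLeastAtMost_iff)
    finally show "\<beta> (Suc t) \<le> real t powr ((1 - \<kappa>) - 1)" by simp
  qed
  also have "\<dots> \<le> real T powr (1 - \<kappa>) / (1 - \<kappa>)"
    using kappa by (intro sum_powr_le) auto
  finally show ?thesis .
qed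

text \<open>Total coefficient of the step lengths in the energy estimate: \<open>G\<close> directly,
  the remainder through the disagreement.\<close>

definition A :: real where "A = G + (N * G + N * L) * Cd"

text \<open>The coefficients of \<open>real T powr \<kappa>\<close>, \<open>rate T\<close> and the
  path term that arise in \<open>pathwise_energy\<close>, added up; they are nonnegative, so the sum
  can stand for each of them.\<close>

definition energy_const :: real where
  "energy_const = 2 * B\<^sup>2 * M / \<kappa> + (N * G + N * L) * Cd * (2 * R)
    + (4 * R\<^sup>2 * N / \<tau> 1 + 8 * R * N + 2 * N * A\<^sup>2 + ((N * G + N * L) * Cd + N * G) * sqrt (\<tau> 1)) + 4 * R * N"

definition viol :: "nat \<Rightarrow> real" where
  "viol T = real T powr (1 - \<kappa> / 2) + \<Psi> T powr (1 / 4) * real T powr (3 / 4)"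

text \<open>Chosen to equate \<open>lam T * real T\<close> with
  \<open>real T powr (1 - \<kappa>) / lam T\<close>; likewise \<open>mu\<close> equates
  \<open>mu T * real T\<close> with \<open>rate T / mu T\<close>. The common values are the two
  summands of \<open>viol\<close>.\<close>

definition lam :: "nat \<Rightarrow> real" where "lam T = real T powr (- \<kappa> / 2)"
definition mu :: "nat \<Rightarrow> real" where "mu T = (\<Psi> T / real T) powr (1 / 4)"

lemma lam_pos: "1 \<le> T \<Longrightarrow> 0 < lam T" and mu_pos: "1 \<le> T \<Longrightarrow> 0 < mu T"
  using Psi_pos[of T] by (simp_all add: lam_def mu_def)

lemma lam_mult: "1 \<le> T \<Longrightarrow> lam T * real T = real T powr (1 - \<kappa> / 2)"
  unfolding lam_def by (simp add: powr_mult_base mult.commute)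

lemma mu_mult: "1 \<le> T \<Longrightarrow> mu T * real T = \<Psi> T powr (1 / 4) * real T powr (3 / 4)"
proof -
  assume T: "1 \<le> T"
  have "real T powr (3 / 4) * real T powr (1 / 4) = real T"
    using T by (simp flip: powr_add)
  then have "real T / real T powr (1 / 4) = real T powr (3 / 4)"
    using T by (simp add: field_simps)
  moreover have "mu T * real T = \<Psi> T powr (1 / 4) * (real T / real T powr (1 / 4))"
    using Psi_pos[OF T] by (simp add: mu_def powr_divide)
  ultimately show ?thesis by simp
qed

lemma div_lam: "1 \<le> T \<Longrightarrow> real T powr (1 - \<kappa>) / lam T = real T powr (1 - \<kappa> / 2)"
  unfolding lam_def by (simp flip: powr_diff)

lemma rate_div_mu: "1 \<le> T \<Longrightarrow> rate T / mu T = \<Psi> T powr (1 / 4) * real T powr (3 / 4)"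
proof -
  assume T: "1 \<le> T"
  have P: "0 < \<Psi> T" by (rule Psi_pos[OF T])
  have "rate T = \<Psi> T powr (1 / 2) * real T powr (1 / 2)"
    using P by (simp add: rate_def powr_half_sqrt real_sqrt_mult)
  also have "\<dots> = (\<Psi> T powr (1 / 4) * \<Psi> T powr (1 / 4)) * (real T powr (3 / 4) / real T powr (1 / 4))"
    by (simp flip: powr_add powr_diff)
  also have "\<dots> = (\<Psi> T powr (1 / 4) * real T powr (3 / 4)) * mu T"
    using P by (simp add: mu_def powr_divide)
  finally show ?thesis
    using mu_pos[OF T] by (simp add: field_simps)
qed

text \<open>Three quarters of the exponent of \<open>\<Psi> T\<close> are traded for time by
  \<open>\<Psi> T \<le> \<tau> 1 * real T\<close>.\<close>

lemma Psi_le_viol: "1 \<le> T \<Longrightarrow> \<Psi> T \<le> \<tau> 1 powr (3 / 4) * viol T"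
proof -
  assume T: "1 \<le> T"
  have P: "0 < \<Psi> T" by (rule Psi_pos[OF T])
  have "\<Psi> T = \<Psi> T powr (1 / 4) * \<Psi> T powr (3 / 4)"
    using P by (simp flip: powr_add)
  also have "\<dots> \<le> \<Psi> T powr (1 / 4) * (\<tau> 1 * real T) powr (3 / 4)"
    using P Psi_le by (intro mult_left_mono powr_mono2) auto
  also have "\<dots> = \<tau> 1 powr (3 / 4) * (\<Psi> T powr (1 / 4) * real T powr (3 / 4))"
    using tau_pos[of 1] by (simp add: powr_mult)
  also have "\<dots> \<le> \<tau> 1 powr (3 / 4) * viol T"
    unfolding viol_def by (intro mult_left_mono) auto
  finally show ?thesis .
qed

lemma one_le_viol: "1 \<le> T \<Longrightarrow> 1 \<le> viol T"
proof -
  assume T: "1 \<le> T"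
  have "1 \<le> real T powr (1 - \<kappa> / 2)"
    using T kappa by (intro ge_one_powr_ge_zero) auto
  moreover have "0 \<le> \<Psi> T powr (1 / 4) * real T powr (3 / 4)" by simp
  ultimately show ?thesis unfolding viol_def by linarith
qed

lemma inverse_gamma_le: "1 \<le> T \<Longrightarrow> 1 / \<gamma> (Suc T) \<le> 2 * real T powr (1 - \<kappa>)"
proof -
  assume T: "1 \<le> T"
  have "real (Suc T) powr (1 - \<kappa>) \<le> (2 * real T) powr (1 - \<kappa>)"
    using T kappa by (intro powr_mono2) auto
  also have "\<dots> = 2 powr (1 - \<kappa>) * real T powr (1 - \<kappa>)"
    by (simp add: powr_mult)
  also have "\<dots> \<le> 2 * real T powr (1 - \<kappa>)"
    using kappa powr_mono[of "1 - \<kappa>" 1 2] by (intro mult_right_mono) auto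
  finally show ?thesis by (simp add: gamma)
qed

text \<open>The cost of disagreement for the violation. \<open>drift_const\<close> adds the direct
  effect of the moves and multiplies step lengths and thresholds.\<close>

definition spread_const :: real where "spread_const = (M * G + M * L) * Cd"
definition drift_const :: real where "drift_const = M * G + spread_const"
definition violation_const :: real where
  "violation_const = M * (2 + 1 / (1 - \<kappa>)) / 2 + drift_const * N * 2 + 2 * R * spread_const + drift_const * \<tau> 1 powr (3 / 4)"

lemma spread_const_nonneg: "0 \<le> spread_const" and drift_const_nonneg: "0 \<le> drift_const"
  using M_nonneg G_nonneg L Cd by (simp_all add: spread_const_def drift_const_def)

end

text \<open>A fixed realization, treated deterministically. The constants come from
  \<open>setting\<close> and so are common to all realizations.\<close>

locale run = setting X r R m f g W \<tau> \<Psi> \<alpha> \<beta> \<gamma> \<xi> \<delta> \<kappa> L F Cd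
  for X :: "(real ^ 'p) set" and r R :: real and m :: "'n::finite \<Rightarrow> nat"
    and f :: "'n \<Rightarrow> nat \<Rightarrow> real ^ 'p \<Rightarrow> real"
    and g :: "'n \<Rightarrow> nat \<Rightarrow> real ^ 'p \<Rightarrow> nat \<Rightarrow> real"
    and W :: "nat \<Rightarrow> real ^ 'n ^ 'n"
    and \<tau> \<Psi> \<alpha> \<beta> \<gamma> \<xi> \<delta> :: "nat \<Rightarrow> real" and \<kappa> L F Cd :: real +
  fixes x1 :: "'n \<Rightarrow> real ^ 'p" and u x xh :: "'n \<Rightarrow> nat \<Rightarrow> real ^ 'p" and q :: "'n \<Rightarrow> nat \<Rightarrow> nat \<Rightarrow> real"
  assumes init: "\<And>i. x1 i \<in> shrunk 1"
    and u: "\<And>i t. 1 \<le> t \<Longrightarrow> norm (u i t) = 1"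
    and gen: "generated X m f g W \<alpha> \<beta> \<gamma> \<tau> \<xi> \<delta> x1 u x xh q"
begin

definition df :: "'n \<Rightarrow> nat \<Rightarrow> real ^ 'p" where
  "df i t = grad_est (\<delta> t) (f i t) (x i t) (u i t)"
definition dg :: "'n \<Rightarrow> nat \<Rightarrow> nat \<Rightarrow> real ^ 'p" where
  "dg i t = grad_est_pos (\<delta> t) (g i t) (x i t) (u i t)"
definition om :: "'n \<Rightarrow> nat \<Rightarrow> real ^ 'p" where
  "om i t = df i t + mat_apply (m i) (dg i t) (q i t)"
definition z :: "'n \<Rightarrow> nat \<Rightarrow> real ^ 'p" where
  "z i t = (\<Sum>j\<in>UNIV. W t $ i $ j *\<^sub>R xh j t)"
text \<open>The linearisation at \<open>x i t\<close>, evaluated at the next iterate. The primal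
  step produces the same inner product with \<open>q\<close>, which makes the cancellation
  possible.\<close>

definition b :: "'n \<Rightarrow> nat \<Rightarrow> nat \<Rightarrow> real" where
  "b i t k = max 0 (g i t (x i t) k) + dg i t k \<bullet> (x i (Suc t) - x i t)"
definition eps :: "'n \<Rightarrow> nat \<Rightarrow> real" where
  "eps i t = norm (x i (Suc t) - z i t)"
definition D :: "nat \<Rightarrow> real" where
  "D t = disagreement (\<lambda>i. x i t)"

abbreviation sq_dist :: "nat \<Rightarrow> real ^ 'p \<Rightarrow> real" where
  "sq_dist t c \<equiv> (\<Sum>i\<in>UNIV. (norm (x i t - c))\<^sup>2)"
abbreviation total_eps :: "nat \<Rightarrow> real" where
  "total_eps T \<equiv> (\<Sum>t=1..T. \<Sum>i\<in>UNIV. eps i t)"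

lemma start: "x i 1 = x1 i" "xh i 1 = x i 1" "k < m i \<Longrightarrow> q i 1 k = 0"
  using gen unfolding generated_def by blast+

lemma step:
  assumes "1 \<le> t"
  shows x_Suc: "x i (Suc t) = closest_point (shrunk (Suc t)) (z i t - \<alpha> (Suc t) *\<^sub>R om i t)"
    and q_Suc: "k < m i \<Longrightarrow> q i (Suc t) k
      = max 0 ((1 - \<beta> (Suc t) * \<gamma> (Suc t)) * q i t k + \<gamma> (Suc t) * b i t k)"
    and xh_Suc: "xh i (Suc t) = (if norm (x i (Suc t) - xh i t) \<ge> \<tau> (Suc t) then x i (Suc t) else xh i t)"
proof -
  have "\<forall>t\<ge>1. \<forall>i. x i (t + 1) = closest_point ((\<lambda>v. (1 - \<xi> (t + 1)) *\<^sub>R v) ` X) (z i t - \<alpha> (t + 1) *\<^sub>R om i t) \<and>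
      (\<forall>k<m i. q i (t + 1) k = max 0 ((1 - \<beta> (t + 1) * \<gamma> (t + 1)) * q i t k +
        \<gamma> (t + 1) * (max 0 (g i t (x i t) k) + dg i t k \<bullet> (x i (t + 1) - x i t)))) \<and>
      xh i (t + 1) = (if norm (x i (t + 1) - xh i t) \<ge> \<tau> (t + 1) then x i (t + 1) else xh i t)"
    using gen unfolding generated_def Let_def om_def df_def dg_def z_def by (elim conjE) assumption
  note * = this[rule_format, OF assms, of i, unfolded Suc_eq_plus1[symmetric]]
  show "x i (Suc t) = closest_point (shrunk (Suc t)) (z i t - \<alpha> (Suc t) *\<^sub>R om i t)"
    using * unfolding shrunk_def by blast
  show "k < m i \<Longrightarrow> q i (Suc t) k = max 0 ((1 - \<beta> (Suc t) * \<gamma> (Suc t)) * q i t k + \<gamma> (Suc t) * b i t k)"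
    using * unfolding b_def by blast
  show "xh i (Suc t) = (if norm (x i (Suc t) - xh i t) \<ge> \<tau> (Suc t) then x i (Suc t) else xh i t)"
    using * by blast
qed

lemma shrunk_nonempty: "shrunk t \<noteq> {}"
  using zero_shrunk[of t] by blast

lemma x_shrunk: "1 \<le> t \<Longrightarrow> x i t \<in> shrunk t"
proof (induction rule: dec_induct)
  case base
  then show ?case using init start(1) by simp
next
  case (step n)
  show ?case
    unfolding x_Suc[OF step(1)] by (rule closest_point_in_set[OF shrunk_closed shrunk_nonempty])
qed

lemma xh_shrunk: "1 \<le> t \<Longrightarrow> xh i t \<in> shrunk t"
proof (induction rule: dec_induct)
  case base
  then show ?case using x_shrunk[of 1 i] start(2) by simp
next
  case (step n)
  have "xh i n \<in> shrunk (Suc n)"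
    using step shrunk_mono[of n "Suc n"] by auto
  then show ?case
    unfolding xh_Suc[OF step(1)] using x_shrunk[of "Suc n" i] by simp
qed

lemma x_X: "1 \<le> t \<Longrightarrow> x i t \<in> X" and xh_X: "1 \<le> t \<Longrightarrow> xh i t \<in> X"
  using x_shrunk xh_shrunk shrunk_subset_X by blast+

lemma xh_close: "1 \<le> t \<Longrightarrow> norm (xh i t - x i t) \<le> \<tau> t"
proof (induction rule: dec_induct)
  case base
  then show ?case using start(2)[of i] tau_pos[of 1] by simp
next
  case (step n)
  then show ?case
    unfolding xh_Suc[OF step(1)] using tau_pos[of "Suc n"] by (auto simp: norm_minus_commute)
qed

lemma W_nonneg: "1 \<le> t \<Longrightarrow> 0 \<le> W t $ i $ j"
  and W_row: "1 \<le> t \<Longrightarrow> (\<Sum>j\<in>UNIV. W t $ i $ j) = 1"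
  and W_col: "1 \<le> t \<Longrightarrow> (\<Sum>i\<in>UNIV. W t $ i $ j) = 1"
  using stoch[of t] unfolding doubly_stochastic_def by blast+

lemma z_diff: "1 \<le> t \<Longrightarrow> z i t - c = (\<Sum>j\<in>UNIV. W t $ i $ j *\<^sub>R (xh j t - c))"
  unfolding z_def scaleR_right_diff_distrib sum_subtractf
  using W_row[of t i] by (simp flip: scaleR_sum_left)

text \<open>Rows of sum one give Jensen's inequality, columns of sum one collapse the resulting
  double sum.\<close>

lemma sum_z_dist_le:
  assumes t: "1 \<le> t"
  shows "(\<Sum>i\<in>UNIV. (norm (z i t - c))\<^sup>2) \<le> (\<Sum>j\<in>UNIV. (norm (xh j t - c))\<^sup>2)"
proof -
  have "(\<Sum>i\<in>UNIV. (norm (z i t - c))\<^sup>2) \<le> (\<Sum>i\<in>UNIV. \<Sum>j\<in>UNIV. W t $ i $ j * (norm (xh j t - c))\<^sup>2)"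
    unfolding z_diff[OF t] by (intro sum_mono weighted_norm_sq_le W_nonneg W_row t)
  also have "\<dots> = (\<Sum>j\<in>UNIV. (\<Sum>i\<in>UNIV. W t $ i $ j) * (norm (xh j t - c))\<^sup>2)"
    by (subst sum.swap) (simp only: sum_distrib_right)
  also have "\<dots> = (\<Sum>j\<in>UNIV. (norm (xh j t - c))\<^sup>2)"
    by (simp only: W_col[OF t] mult_1_left)
  finally show ?thesis .
qed

lemma norm_sq_diff_le:
  fixes a a' c :: "real ^ 'p"
  assumes "norm a \<le> R" "norm a' \<le> R" "norm c \<le> R"
  shows "(norm (a - c))\<^sup>2 \<le> (norm (a' - c))\<^sup>2 + 4 * R * norm (a - a')"
proof -
  have "(norm (a - c))\<^sup>2 - (norm (a' - c))\<^sup>2 = (norm (a - c) + norm (a' - c)) * (norm (a - c) - norm (a' - c))"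
    by (simp add: power2_eq_square algebra_simps)
  also have "\<dots> \<le> (norm (a - c) + norm (a' - c)) * norm (a - a')"
    using norm_triangle_ineq2[of "a - c" "a' - c"] by (intro mult_left_mono) auto
  also have "\<dots> \<le> (4 * R) * norm (a - a')"
    using norm_triangle_ineq4[of a c] norm_triangle_ineq4[of a' c] assms by (intro mult_right_mono) auto
  finally show ?thesis by simp
qed

lemma xh_dist_le:
  assumes t: "1 \<le> t" and c: "norm c \<le> R"
  shows "(norm (xh j t - c))\<^sup>2 \<le> (norm (x j t - c))\<^sup>2 + 4 * R * \<tau> t"
proof -
  have "(norm (xh j t - c))\<^sup>2 \<le> (norm (x j t - c))\<^sup>2 + 4 * R * norm (xh j t - x j t)"
    by (intro norm_sq_diff_le norm_X x_X xh_X t c)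
  also have "4 * R * norm (xh j t - x j t) \<le> 4 * R * \<tau> t"
    using R xh_close[OF t, of j] by (intro mult_left_mono) auto
  finally show ?thesis by simp
qed

text \<open>The obtuse angle at a projection onto a convex set, followed by the three-point
  identity. The term with \<open>(eps i t)\<^sup>2\<close> is kept because it pays for everything
  linear in the step lengths.\<close>

lemma om_descent:
  assumes t: "1 \<le> t" and c: "c \<in> shrunk (Suc t)"
  shows "om i t \<bullet> (x i (Suc t) - c)
    \<le> ((norm (z i t - c))\<^sup>2 - (norm (x i (Suc t) - c))\<^sup>2 - (eps i t)\<^sup>2) / (2 * \<alpha> (Suc t))"
proof -
  let ?a = "z i t - \<alpha> (Suc t) *\<^sub>R om i t" and ?x = "x i (Suc t)"
  have a: "0 < \<alpha> (Suc t)" using alpha_pos[of "Suc t"] by simp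
  have "(?a - ?x) \<bullet> (c - ?x) \<le> 0"
    unfolding x_Suc[OF t] by (rule closest_point_dot[OF shrunk_convex shrunk_closed c])
  then have 1: "\<alpha> (Suc t) * (om i t \<bullet> (?x - c)) \<le> (z i t - ?x) \<bullet> (?x - c)"
    by (simp add: inner_diff_left inner_diff_right algebra_simps)
  have 2: "(norm (z i t - c))\<^sup>2 = (norm (?x - c))\<^sup>2 + (eps i t)\<^sup>2 + 2 * ((z i t - ?x) \<bullet> (?x - c))"
    unfolding eps_def power2_norm_eq_inner
    by (simp add: inner_diff_left inner_diff_right inner_commute)
  from 1 2 have "2 * \<alpha> (Suc t) * (om i t \<bullet> (?x - c)) \<le> (norm (z i t - c))\<^sup>2 - (norm (?x - c))\<^sup>2 - (eps i t)\<^sup>2"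
    by linarith
  then show ?thesis
    using a by (simp add: pos_le_divide_eq mult.commute mult.left_commute)
qed

lemma df_bound: "1 \<le> t \<Longrightarrow> norm (df i t) \<le> G"
  unfolding df_def G_def
  by (rule grad_est_bound[OF lip_f]) (assumption | rule cball_shrunk x_shrunk delta_pos u)+

lemma dg_bound: "1 \<le> t \<Longrightarrow> k < m i \<Longrightarrow> norm (dg i t k) \<le> G"
  unfolding dg_def grad_est_pos_def G_def
  by (rule grad_est_bound[OF lip_pos_g]) (assumption | rule cball_shrunk x_shrunk delta_pos u)+

lemma inner_dg_bound:
  assumes "1 \<le> t" "k < m i"
  shows "\<bar>dg i t k \<bullet> (x i (Suc t) - x i t)\<bar> \<le> G * norm (x i (Suc t) - x i t)"
  by (rule order.trans[OF Cauchy_Schwarz_ineq2]) (intro mult_right_mono dg_bound assms norm_ge_zero)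

lemma b_bound:
  assumes t: "1 \<le> t" and k: "k < m i"
  shows "\<bar>b i t k\<bar> \<le> B"
proof -
  have "norm (x i (Suc t) - x i t) \<le> 2 * R"
    using t by (intro norm_diff_X x_X) auto
  then have "G * norm (x i (Suc t) - x i t) \<le> G * (2 * R)"
    by (rule mult_left_mono) (rule G_nonneg)
  with inner_dg_bound[OF t k] g_bound[OF t x_X[OF t, of i] k] F show ?thesis
    unfolding b_def B_def by (simp add: mult.commute mult.left_commute)
qed

lemma dual: "k < m i \<Longrightarrow> dual_update \<beta> \<gamma> (\<lambda>t. b i t k) (\<lambda>t. q i t k) B"
proof (unfold_locales, goal_cases)
  case (5 t)
  have "\<beta> t * \<gamma> t = 1 / real t"
    using 5 by (simp add: beta gamma flip: powr_add)
  then show ?case using 5 by simp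
next
  case (6 t)
  have "1 / \<gamma> (Suc t) - 1 / \<gamma> t = real (Suc t) powr (1 - \<kappa>) - real t powr (1 - \<kappa>)"
    using 6 by (simp add: gamma)
  also have "\<dots> \<le> 1 / real (Suc t) powr \<kappa>"
    by (rule powr_diff_le) (use 6 kappa in auto)
  finally show ?case using 6 by (simp add: beta)
qed (simp_all add: beta_pos gamma_pos beta_Suc_le gamma_Suc_le start(3)[unfolded One_nat_def] q_Suc b_bound)

lemma q_bounds:
  assumes "1 \<le> t" "k < m i"
  shows "0 \<le> q i t k" "q i t k \<le> B * real t powr \<kappa>"
proof -
  interpret dual_update \<beta> \<gamma> "\<lambda>t. b i t k" "\<lambda>t. q i t k" B by (rule dual[OF assms(2)])
  show "0 \<le> q i t k" by (rule q_bounds[OF assms(1)])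
  have "q i t k / real t powr \<kappa> \<le> B"
    using q_bounds(2)[OF assms(1)] assms(1) by (simp add: beta)
  then show "q i t k \<le> B * real t powr \<kappa>"
    using assms(1) by (simp add: pos_divide_le_eq)
qed

lemma x_z_dist:
  assumes t: "1 \<le> t"
  shows "norm (x i t - z i t) \<le> D t + \<tau> t"
proof -
  have "norm (z i t - x i t) \<le> (\<Sum>j\<in>UNIV. W t $ i $ j * (D t + \<tau> t))"
    unfolding z_diff[OF t]
  proof (rule order.trans[OF norm_sum], rule sum_mono)
    fix j
    have "norm (xh j t - x i t) \<le> norm (xh j t - x j t) + norm (x j t - x i t)"
      using norm_triangle_ineq[of "xh j t - x j t" "x j t - x i t"] by simp
    also have "\<dots> \<le> D t + \<tau> t"
      using xh_close[OF t, of j] disagreement_ge[of "\<lambda>i. x i t" j i] unfolding D_def by linarith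
    finally show "norm (W t $ i $ j *\<^sub>R (xh j t - x i t)) \<le> W t $ i $ j * (D t + \<tau> t)"
      using W_nonneg[OF t, of i j] by (simp add: mult_left_mono)
  qed
  also have "\<dots> = D t + \<tau> t"
    using W_row[OF t, of i] by (simp flip: sum_distrib_right)
  finally show ?thesis by (simp add: norm_minus_commute)
qed

lemma x_step_dist:
  assumes t: "1 \<le> t"
  shows "norm (x i (Suc t) - x i t) \<le> eps i t + D t + \<tau> t"
proof -
  have "norm (x i (Suc t) - x i t) \<le> norm (x i (Suc t) - z i t) + norm (x i t - z i t)"
    using norm_triangle_ineq4[of "x i (Suc t) - z i t" "x i t - z i t"] by simp
  then show ?thesis using x_z_dist[OF t, of i] unfolding eps_def by linarith
qed

lemma D_nonneg: "0 \<le> D t"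
  unfolding D_def by (rule disagreement_nonneg)

lemma eps_nonneg: "0 \<le> eps i t"
  by (simp add: eps_def)

text \<open>The iterates follow the consensus recursion up to a perturbation: the primal step plus
  the averaged difference between broadcast and actual values, which is at most \<tau>.\<close>

lemma sum_D_le: "(\<Sum>t=1..T. D t) \<le> Cd * (2 * R + \<Psi> T + total_eps T)"
proof -
  define e where "e s i = x i (Suc s) - (\<Sum>j\<in>UNIV. W s $ i $ j *\<^sub>R x j s)" for s i
  have "(\<Sum>t=1..T. disagreement (\<lambda>i. x i t)) \<le> Cd * (2 * R + (\<Sum>t=1..T. \<tau> t + (\<Sum>i\<in>UNIV. eps i t)))"
  proof (rule consensus[where e = e])
    fix s i assume s: "(1::nat) \<le> s"
    show "x i (Suc s) = (\<Sum>j\<in>UNIV. W s $ i $ j *\<^sub>R x j s) + e s i"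
      by (simp add: e_def)
    have "e s i = (x i (Suc s) - z i s) + (\<Sum>j\<in>UNIV. W s $ i $ j *\<^sub>R (xh j s - x j s))"
      by (simp add: e_def z_def scaleR_right_diff_distrib sum_subtractf)
    then have "norm (e s i) \<le> eps i s + norm (\<Sum>j\<in>UNIV. W s $ i $ j *\<^sub>R (xh j s - x j s))"
      unfolding eps_def by (simp only: norm_triangle_ineq)
    also have "norm (\<Sum>j\<in>UNIV. W s $ i $ j *\<^sub>R (xh j s - x j s)) \<le> (\<Sum>j\<in>UNIV. W s $ i $ j * \<tau> s)"
    proof (rule order.trans[OF norm_sum], rule sum_mono)
      fix j
      show "norm (W s $ i $ j *\<^sub>R (xh j s - x j s)) \<le> W s $ i $ j * \<tau> s"
        using W_nonneg[OF s, of i j] xh_close[OF s, of j] by (simp add: mult_left_mono)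
    qed
    also have "\<dots> = \<tau> s"
      using W_row[OF s, of i] by (simp flip: sum_distrib_right)
    also have "eps i s \<le> (\<Sum>i\<in>UNIV. eps i s)"
      by (rule member_le_sum) (auto simp: eps_nonneg)
    finally show "norm (e s i) \<le> \<tau> s + (\<Sum>i\<in>UNIV. eps i s)" by simp
  next
    fix s :: nat assume s: "1 \<le> s"
    show "disagreement (\<lambda>i. x i s) \<le> 2 * R"
      by (intro disagreement_le norm_diff_X x_X s)
  qed
  then show ?thesis
    by (simp add: D_def sum.distrib Psi add.assoc)
qed

definition Sbeta :: "nat \<Rightarrow> real" where
  "Sbeta T = (\<Sum>i\<in>UNIV. \<Sum>k<m i. \<Sum>t=1..T. \<beta> (Suc t) * (q i t k)\<^sup>2 / 2)"
definition Sq :: "nat \<Rightarrow> real" where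
  "Sq T = (\<Sum>i\<in>UNIV. \<Sum>k<m i. (q i (Suc T) k)\<^sup>2 / (2 * \<gamma> (Suc T)))"
text \<open>Half of the quadratic term of \<open>om_descent\<close>; the other half is consumed by
  Young's inequality in \<open>pathwise_energy\<close>.\<close>

definition Seps :: "nat \<Rightarrow> real" where
  "Seps T = (\<Sum>t=1..T. \<Sum>i\<in>UNIV. (eps i t)\<^sup>2 / (4 * \<alpha> (Suc t)))"
text \<open>The part that has to be averaged. In expectation the constraint part of
  \<open>om\<close> against \<open>x - c\<close> is at least \<open>q\<close> times the difference
  of the positive parts at \<open>x\<close> and at \<open>c\<close>, up to bias; subtracting the
  term at \<open>x\<close> leaves the loss difference and a small remainder.\<close>

definition gap :: "nat \<Rightarrow> (nat \<Rightarrow> real ^ 'p) \<Rightarrow> real" where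
  "gap t c = (\<Sum>i\<in>UNIV. om i t \<bullet> (x i t - c t) - (\<Sum>k<m i. q i t k * max 0 (g i t (x i t) k)))"

lemma dual_sum:
  "(\<Sum>i\<in>UNIV. \<Sum>t=1..T. \<Sum>k<m i. - (q i t k * b i t k)) + Sbeta T + Sq T
    \<le> 2 * B\<^sup>2 * M * (real T powr \<kappa> / \<kappa>)"
proof -
  have "(\<Sum>i\<in>UNIV. \<Sum>t=1..T. \<Sum>k<m i. - (q i t k * b i t k)) + Sbeta T + Sq T
      = (\<Sum>i\<in>UNIV. \<Sum>k<m i. (\<Sum>t=1..T. \<beta> (Suc t) * (q i t k)\<^sup>2 / 2 - q i t k * b i t k)
        + (q i (Suc T) k)\<^sup>2 / (2 * \<gamma> (Suc T)))"
  proof -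
    have "(\<Sum>t=1..T. \<Sum>k<m i. - (q i t k * b i t k)) = (\<Sum>k<m i. \<Sum>t=1..T. - (q i t k * b i t k))" for i
      by (rule sum.swap)
    then show ?thesis
      by (simp add: Sbeta_def Sq_def sum.distrib sum_subtractf sum_negf)
  qed
  also have "\<dots> \<le> (\<Sum>i\<in>UNIV. \<Sum>k<m i. 2 * B\<^sup>2 * (real T powr \<kappa> / \<kappa>))"
  proof (intro sum_mono)
    fix i k assume "k \<in> {..<m i}"
    then interpret dual_update \<beta> \<gamma> "\<lambda>t. b i t k" "\<lambda>t. q i t k" B by (intro dual) simp
    have "2 * B\<^sup>2 * (\<Sum>t=1..T. \<gamma> (Suc t)) \<le> 2 * B\<^sup>2 * (real T powr \<kappa> / \<kappa>)"
      by (intro mult_left_mono sum_gamma_le) simp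
    with dual_energy[of T] show "(\<Sum>t=1..T. \<beta> (Suc t) * (q i t k)\<^sup>2 / 2 - q i t k * b i t k)
        + (q i (Suc T) k)\<^sup>2 / (2 * \<gamma> (Suc T)) \<le> 2 * B\<^sup>2 * (real T powr \<kappa> / \<kappa>)"
      by linarith
  qed
  also have "\<dots> = 2 * B\<^sup>2 * M * (real T powr \<kappa> / \<kappa>)"
    unfolding M_def by (simp add: sum_distrib_left sum_distrib_right mult_ac)
  finally show ?thesis .
qed

text \<open>\<open>x i t - c t\<close> is the next iterate minus \<open>c t\<close>, minus the move.
  \<open>om_descent\<close> handles the first part. In the second, the constraint estimates weighted
  by \<open>q\<close> give \<open>q * b\<close> minus \<open>q\<close> times the positive parts, and
  the latter cancel in \<open>gap\<close>. The surviving \<open>- (q * b)\<close> is what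
  \<open>dual_sum\<close> controls.\<close>

lemma gap_step:
  assumes t: "1 \<le> t" and c: "c t \<in> shrunk t"
  shows "gap t c \<le> 1 / (2 * \<alpha> (Suc t)) * (sq_dist t (c t) - sq_dist (Suc t) (c t))
    + 2 * R * N * (\<tau> t / \<alpha> (Suc t)) - (\<Sum>i\<in>UNIV. (eps i t)\<^sup>2 / (2 * \<alpha> (Suc t)))
    + G * (\<Sum>i\<in>UNIV. eps i t) + N * G * (D t + \<tau> t) + (\<Sum>i\<in>UNIV. \<Sum>k<m i. - (q i t k * b i t k))"
proof -
  let ?a = "\<alpha> (Suc t)"
  have a: "0 < ?a" using alpha_pos[of "Suc t"] by simp
  have c': "c t \<in> shrunk (Suc t)" using c shrunk_mono[of t "Suc t"] t by auto
  have cR: "norm (c t) \<le> R"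
    using c shrunk_subset_X[OF t] norm_X by blast
  have gap_i: "om i t \<bullet> (x i t - c t) - (\<Sum>k<m i. q i t k * max 0 (g i t (x i t) k))
      \<le> ((norm (z i t - c t))\<^sup>2 - (norm (x i (Suc t) - c t))\<^sup>2 - (eps i t)\<^sup>2) / (2 * ?a)
        + G * (eps i t + D t + \<tau> t) + (\<Sum>k<m i. - (q i t k * b i t k))" for i
  proof -
    let ?d = "x i (Suc t) - x i t"
    have "mat_apply (m i) (dg i t) (q i t) \<bullet> ?d = (\<Sum>k<m i. q i t k * (dg i t k \<bullet> ?d))"
      unfolding mat_apply_def by (simp add: inner_sum_left)
    also have "\<dots> = (\<Sum>k<m i. q i t k * b i t k) - (\<Sum>k<m i. q i t k * max 0 (g i t (x i t) k))"
      unfolding b_def by (simp add: distrib_left sum.distrib)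
    finally have 1: "om i t \<bullet> ?d = df i t \<bullet> ?d + (\<Sum>k<m i. q i t k * b i t k)
        - (\<Sum>k<m i. q i t k * max 0 (g i t (x i t) k))"
      unfolding om_def by (simp add: inner_add_left)
    have "- (df i t \<bullet> ?d) \<le> norm (df i t) * norm ?d"
      using Cauchy_Schwarz_ineq2[of "df i t" ?d] by linarith
    also have "\<dots> \<le> G * (eps i t + D t + \<tau> t)"
      by (intro mult_mono df_bound x_step_dist t G_nonneg) simp
    finally have 2: "- (df i t \<bullet> ?d) \<le> G * (eps i t + D t + \<tau> t)" .
    have 3: "om i t \<bullet> (x i t - c t) = om i t \<bullet> (x i (Suc t) - c t) - om i t \<bullet> ?d"
      by (simp add: inner_diff_right)
    show ?thesis
      unfolding 3 1 sum_negf using om_descent[OF t c', of i] 2 by linarith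
  qed
  have "gap t c \<le> (\<Sum>i\<in>UNIV. ((norm (z i t - c t))\<^sup>2 - (norm (x i (Suc t) - c t))\<^sup>2 - (eps i t)\<^sup>2) / (2 * ?a)
        + G * (eps i t + D t + \<tau> t) + (\<Sum>k<m i. - (q i t k * b i t k)))"
    unfolding gap_def by (rule sum_mono) (rule gap_i)
  also have "\<dots> = 1 / (2 * ?a) * ((\<Sum>i\<in>UNIV. (norm (z i t - c t))\<^sup>2) - sq_dist (Suc t) (c t))
      - (\<Sum>i\<in>UNIV. (eps i t)\<^sup>2 / (2 * ?a)) + G * (\<Sum>i\<in>UNIV. eps i t) + N * G * (D t + \<tau> t)
      + (\<Sum>i\<in>UNIV. \<Sum>k<m i. - (q i t k * b i t k))"
    unfolding N_def
    by (simp add: sum.distrib diff_divide_distrib sum_subtractf sum_divide_distrib right_diff_distrib distrib_left sum_distrib_left)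
  finally have 1: "gap t c \<le> \<dots>" .
  have "(\<Sum>i\<in>UNIV. (norm (z i t - c t))\<^sup>2) \<le> (\<Sum>j\<in>UNIV. (norm (xh j t - c t))\<^sup>2)"
    by (rule sum_z_dist_le[OF t])
  also have "\<dots> \<le> (\<Sum>j\<in>UNIV. (norm (x j t - c t))\<^sup>2 + 4 * R * \<tau> t)"
    by (intro sum_mono xh_dist_le t cR)
  also have "\<dots> = sq_dist t (c t) + N * (4 * R * \<tau> t)"
    by (simp add: sum.distrib N_def)
  finally have "1 / (2 * ?a) * ((\<Sum>i\<in>UNIV. (norm (z i t - c t))\<^sup>2) - sq_dist (Suc t) (c t))
      \<le> 1 / (2 * ?a) * ((sq_dist t (c t) + N * (4 * R * \<tau> t)) - sq_dist (Suc t) (c t))"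
    using a by (intro mult_left_mono) auto
  also have "\<dots> = 1 / (2 * ?a) * (sq_dist t (c t) - sq_dist (Suc t) (c t))
      + 2 * R * N * (\<tau> t / ?a)"
    using a by (simp add: field_simps)
  finally show ?thesis using 1 by linarith
qed

text \<open>\<open>weighted_telescope\<close> with weights
  \<open>1 / (2 * \<alpha> (Suc t))\<close>. Distances within \<open>X\<close> are at most
  \<open>2 * R\<close>, which gives the cap, and a move of the comparator changes each squared
  distance by at most \<open>4 * R\<close> times its length.\<close>

lemma distance_telescope:
  assumes T: "1 \<le> T" and c: "\<And>t. t \<in> {1..T} \<Longrightarrow> c t \<in> shrunk t"
  shows "(\<Sum>t=1..T. 1 / (2 * \<alpha> (Suc t)) *
      (sq_dist t (c t) - sq_dist (Suc t) (c t)))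
    \<le> path T * (4 * R\<^sup>2 * N + (\<Sum>t=1..<T. 4 * R * N * norm (c (Suc t) - c t)))"
    (is "?L \<le> path T * (?C + ?P)")
proof -
  have cX: "c t \<in> X" if "t \<in> {1..T}" for t
    using c[OF that] shrunk_subset_X[of t] that by auto
  have bound: "sq_dist s (c t) \<le> ?C" if "1 \<le> s" "t \<in> {1..T}" for s t
  proof -
    have "(norm (x i s - c t))\<^sup>2 \<le> (2 * R)\<^sup>2" for i
      by (intro power_mono norm_diff_X x_X cX that) simp
    then have "sq_dist s (c t) \<le> (\<Sum>i\<in>(UNIV::'n set). (2 * R)\<^sup>2)"
      by (rule sum_mono)
    then show ?thesis by (simp add: N_def power_mult_distrib mult.commute)
  qed
  have P: "0 \<le> ?C" "0 \<le> ?P"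
    using R N_ge_1 by (auto intro!: sum_nonneg)
  have "?L \<le> 1 / (2 * \<alpha> (Suc T)) * (?C + ?P)"
  proof (rule weighted_telescope[OF _ _ _ _ _ _ _ T])
    fix t :: nat assume t: "1 \<le> t"
    show "0 \<le> 1 / (2 * \<alpha> (Suc t))"
      using alpha_pos[of "Suc t"] by simp
    show "1 / (2 * \<alpha> (Suc t)) \<le> 1 / (2 * \<alpha> (Suc (Suc t)))"
      using alpha_pos[of "Suc (Suc t)"] alpha_antimono[of "Suc t" "Suc (Suc t)"] by (intro divide_left_mono) auto
    show "0 \<le> 4 * R * N * norm (c (Suc t) - c t)"
      using R N_ge_1 by simp
  next
    show "sq_dist 1 (c 1) \<le> ?C"
      using T by (intro bound) auto
  next
    fix t assume t: "1 \<le> t" "t \<le> T"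
    show "0 \<le> sq_dist (Suc t) (c t)"
      by (intro sum_nonneg) simp
    show "sq_dist (Suc t) (c t) \<le> ?C"
      using t by (intro bound) auto
  next
    fix t assume t: "1 \<le> t" "t < T"
    have "(norm (x i (Suc t) - c (Suc t)))\<^sup>2 \<le> (norm (x i (Suc t) - c t))\<^sup>2 + 4 * R * norm (c (Suc t) - c t)" for i
    proof -
      have "norm (x i (Suc t)) \<le> R" "norm (c t) \<le> R" "norm (c (Suc t)) \<le> R"
        using t by (auto intro!: norm_X x_X cX)
      from norm_sq_diff_le[OF this(3) this(2) this(1)] show ?thesis
        by (simp add: norm_minus_commute)
    qed
    then have "sq_dist (Suc t) (c (Suc t))
        \<le> (\<Sum>i\<in>UNIV. (norm (x i (Suc t) - c t))\<^sup>2 + 4 * R * norm (c (Suc t) - c t))"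
      by (rule sum_mono)
    then show "sq_dist (Suc t) (c (Suc t))
        \<le> sq_dist (Suc t) (c t) + 4 * R * N * norm (c (Suc t) - c t)"
      by (simp add: sum.distrib N_def mult_ac)
  qed
  also have "1 / (2 * \<alpha> (Suc T)) \<le> path T"
    using inverse_alpha_le_path[OF T] by simp
  then have "1 / (2 * \<alpha> (Suc T)) * (?C + ?P) \<le> path T * (?C + ?P)"
    using P by (intro mult_right_mono) auto
  finally show ?thesis .
qed

lemma pathwise_energy:
  assumes T: "1 \<le> T" and c: "\<And>t. t \<in> {1..T} \<Longrightarrow> c t \<in> shrunk t"
  shows "(\<Sum>t=1..T. gap t c) + N * L * (\<Sum>t=1..T. D t) + Sbeta T + Sq T + Seps T
    \<le> energy_const * (real T powr \<kappa> + rate T + path T * (\<Sum>t=1..<T. norm (c (Suc t) - c t)))"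
proof -
  define P where "P = (\<Sum>t=1..<T. norm (c (Suc t) - c t))"
  \<comment> \<open>Disagreement enters with \<open>N * G\<close> from \<open>gap_step\<close>; the
    extra \<open>N * L\<close> is held in reserve so that the regret can later exchange the points
    of different agents.\<close>
  define J where "J = N * G + N * L"
  have J: "0 \<le> J" using N_ge_1 G_nonneg L by (simp add: J_def)
  have P0: "0 \<le> P" unfolding P_def by (intro sum_nonneg) simp
  let ?E = "\<Sum>t=1..T. \<Sum>i\<in>UNIV. eps i t"
  let ?E2 = "\<Sum>t=1..T. \<Sum>i\<in>UNIV. (eps i t)\<^sup>2 / (2 * \<alpha> (Suc t))"
  let ?Q = "\<Sum>i\<in>UNIV. \<Sum>t=1..T. \<Sum>k<m i. - (q i t k * b i t k)"
  let ?Tel = "\<Sum>t=1..T. 1 / (2 * \<alpha> (Suc t)) *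
      (sq_dist t (c t) - sq_dist (Suc t) (c t))"
  have "(\<Sum>t=1..T. gap t c) \<le> (\<Sum>t=1..T. 1 / (2 * \<alpha> (Suc t)) *
      (sq_dist t (c t) - sq_dist (Suc t) (c t))
    + 2 * R * N * (\<tau> t / \<alpha> (Suc t)) - (\<Sum>i\<in>UNIV. (eps i t)\<^sup>2 / (2 * \<alpha> (Suc t)))
    + G * (\<Sum>i\<in>UNIV. eps i t) + N * G * (D t + \<tau> t) + (\<Sum>i\<in>UNIV. \<Sum>k<m i. - (q i t k * b i t k)))"
    by (rule sum_mono, rule gap_step) (use c in auto)
  also have "\<dots> = ?Tel + 2 * R * N * (\<Sum>t=1..T. \<tau> t / \<alpha> (Suc t)) - ?E2 + G * ?E + N * G * ((\<Sum>t=1..T. D t) + \<Psi> T)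
      + (\<Sum>t=1..T. \<Sum>i\<in>UNIV. \<Sum>k<m i. - (q i t k * b i t k))"
    unfolding sum.distrib sum_subtractf sum_distrib_left[symmetric] Psi by simp
  also have "(\<Sum>t=1..T. \<Sum>i\<in>UNIV. \<Sum>k<m i. - (q i t k * b i t k)) = ?Q"
    by (rule sum.swap)
  finally have 1: "(\<Sum>t=1..T. gap t c) \<le> ?Tel + 2 * R * N * (\<Sum>t=1..T. \<tau> t / \<alpha> (Suc t)) - ?E2 + G * ?E
      + N * G * ((\<Sum>t=1..T. D t) + \<Psi> T) + ?Q" .
  have 2: "?Tel \<le> 4 * R\<^sup>2 * N / \<tau> 1 * rate T + 4 * R * N * (path T * P)"
  proof -
    have "?Tel \<le> path T * (4 * R\<^sup>2 * N + (\<Sum>t=1..<T. 4 * R * N * norm (c (Suc t) - c t)))"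
      by (rule distance_telescope[OF T c])
    also have "(\<Sum>t=1..<T. 4 * R * N * norm (c (Suc t) - c t)) = 4 * R * N * P"
      unfolding P_def by (simp only: sum_distrib_left)
    also have "path T * (4 * R\<^sup>2 * N + 4 * R * N * P) = 4 * R\<^sup>2 * N * path T + 4 * R * N * (path T * P)"
      by (simp add: algebra_simps)
    also have "4 * R\<^sup>2 * N * path T \<le> 4 * R\<^sup>2 * N * (rate T / \<tau> 1)"
      using N_ge_1 by (intro mult_left_mono path_le_rate T) simp
    finally show ?thesis by simp
  qed
  have 3: "2 * R * N * (\<Sum>t=1..T. \<tau> t / \<alpha> (Suc t)) \<le> 2 * R * N * (4 * rate T)"
    using R N_ge_1 by (intro mult_left_mono sum_tau_div_alpha_le) simp
  have 4: "J * (\<Sum>t=1..T. D t) \<le> J * (Cd * (2 * R + \<Psi> T + ?E))"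
    by (intro mult_left_mono sum_D_le J)
  \<comment> \<open>Young's inequality as a completed square: each \<open>A * eps i t\<close> is
    paid for by half of the quadratic term and \<open>A\<^sup>2 * \<alpha> (Suc t)\<close>.\<close>
  have 5: "A * ?E - ?E2 + Seps T \<le> N * A\<^sup>2 * (2 * rate T)"
  proof -
    have "A * ?E - ?E2 + Seps T = (\<Sum>t=1..T. \<Sum>i\<in>UNIV. A * eps i t - (eps i t)\<^sup>2 / (4 * \<alpha> (Suc t)))"
    proof -
      have "(eps i t)\<^sup>2 / (2 * \<alpha> (Suc t)) = (eps i t)\<^sup>2 / (4 * \<alpha> (Suc t)) + (eps i t)\<^sup>2 / (4 * \<alpha> (Suc t))" for i t
        by simp
      then show ?thesis
        unfolding Seps_def sum_subtractf sum_distrib_left[symmetric] by (simp only: sum.distrib)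
    qed
    also have "\<dots> \<le> (\<Sum>t=1..T. \<Sum>i\<in>(UNIV::'n set). A\<^sup>2 * \<alpha> (Suc t))"
    proof (intro sum_mono)
      fix t i
      have a: "0 < \<alpha> (Suc t)" using alpha_pos[of "Suc t"] by simp
      have "0 \<le> (eps i t - 2 * A * \<alpha> (Suc t))\<^sup>2 / (4 * \<alpha> (Suc t))"
        using a by simp
      also have "\<dots> = (eps i t)\<^sup>2 / (4 * \<alpha> (Suc t)) - A * eps i t + A\<^sup>2 * \<alpha> (Suc t)"
        using a by (simp add: power2_eq_square field_simps)
      finally show "A * eps i t - (eps i t)\<^sup>2 / (4 * \<alpha> (Suc t)) \<le> A\<^sup>2 * \<alpha> (Suc t)" by simp
    qed
    also have "\<dots> = N * A\<^sup>2 * (\<Sum>t=1..T. \<alpha> (Suc t))"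
      by (simp add: N_def sum_distrib_left sum_distrib_right mult_ac)
    also have "\<dots> \<le> N * A\<^sup>2 * (2 * rate T)"
      using N_ge_1 by (intro mult_left_mono sum_alpha_le) simp
    finally show ?thesis .
  qed
  have 6: "?Q + Sbeta T + Sq T \<le> 2 * B\<^sup>2 * M * (real T powr \<kappa> / \<kappa>)"
    by (rule dual_sum)
  have 7: "(J * Cd + N * G) * \<Psi> T \<le> (J * Cd + N * G) * (sqrt (\<tau> 1) * rate T)"
    using J Cd N_ge_1 G_nonneg by (intro mult_left_mono sum_tau_le) simp
  have T1: "1 \<le> real T powr \<kappa>"
    using T kappa by (intro ge_one_powr_ge_zero) auto
  have 8: "J * Cd * (2 * R) \<le> J * Cd * (2 * R) * real T powr \<kappa>"
    using T1 J Cd R by (intro mult_right_mono[of 1 _ "J * Cd * (2 * R)", simplified mult_1_left, THEN order.trans]) (auto simp: mult.commute)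
  define C1 where "C1 = 2 * B\<^sup>2 * M / \<kappa> + J * Cd * (2 * R)"
  define C2 where "C2 = 4 * R\<^sup>2 * N / \<tau> 1 + 8 * R * N + 2 * N * A\<^sup>2 + (J * Cd + N * G) * sqrt (\<tau> 1)"
  define C3 where "C3 = 4 * R * N"
  have C: "0 \<le> C1" "0 \<le> C2" "0 \<le> C3" "energy_const = C1 + C2 + C3"
    using J Cd R N_ge_1 M_nonneg kappa G_nonneg tau_pos[of 1] by (auto simp: C1_def C2_def C3_def energy_const_def J_def)
  have AJ: "A * ?E = G * ?E + J * (Cd * ?E)"
    by (simp add: A_def J_def algebra_simps)
  have "(\<Sum>t=1..T. gap t c) + N * L * (\<Sum>t=1..T. D t) + Sbeta T + Sq T + Seps T
      \<le> (4 * R\<^sup>2 * N / \<tau> 1 * rate T + 4 * R * N * (path T * P)) + 2 * R * N * (4 * rate T)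
        + N * A\<^sup>2 * (2 * rate T) + J * Cd * (2 * R) * real T powr \<kappa> + (J * Cd + N * G) * (sqrt (\<tau> 1) * rate T)
        + 2 * B\<^sup>2 * M * (real T powr \<kappa> / \<kappa>)"
  proof -
    have "N * G * ((\<Sum>t=1..T. D t) + \<Psi> T) + N * L * (\<Sum>t=1..T. D t) = J * (\<Sum>t=1..T. D t) + N * G * \<Psi> T"
      by (simp add: J_def algebra_simps)
    moreover have "J * (Cd * (2 * R + \<Psi> T + ?E)) = J * Cd * (2 * R) + J * Cd * \<Psi> T + J * (Cd * ?E)"
      by (simp add: algebra_simps)
    moreover have "(J * Cd + N * G) * \<Psi> T = J * Cd * \<Psi> T + N * G * \<Psi> T"
      by (simp add: algebra_simps)
    ultimately show ?thesis
      using 1 2 3 4 5 6 7 8 AJ by linarith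
  qed
  also have "\<dots> = C1 * real T powr \<kappa> + C2 * rate T + C3 * (path T * P)"
    by (simp add: C1_def C2_def C3_def algebra_simps)
  also have "\<dots> \<le> energy_const * real T powr \<kappa> + energy_const * rate T + energy_const * (path T * P)"
    using C rate_nonneg[of T] path_nonneg[of T] P0 by (intro add_mono mult_right_mono) auto
  finally show ?thesis by (simp add: P_def algebra_simps)
qed

section \<open>The constraint violation in terms of the energy\<close>

definition S :: "nat \<Rightarrow> real" where "S T = Sbeta T + Sq T + Seps T"

lemma S_parts_nonneg: "0 \<le> Sbeta T" "0 \<le> Sq T" "0 \<le> Seps T"
  unfolding Sbeta_def Sq_def Seps_def
  using beta_pos gamma_pos alpha_pos by (auto intro!: sum_nonneg simp: less_imp_le)

text \<open>The Euclidean norm is at most the sum of the components, and constraint \<open>j\<close>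
  is moved from the point of agent \<open>i\<close> to that of \<open>j\<close>, whose dual variable
  tracks it. Each component pays \<open>L\<close> times the disagreement.\<close>

lemma stacked_violation_le:
  assumes t: "1 \<le> t"
  shows "L2_set (\<lambda>(j, k). max 0 (g j t (x i t) k)) (SIGMA j:UNIV. {..<m j})
    \<le> (\<Sum>j\<in>UNIV. \<Sum>k<m j. max 0 (g j t (x j t) k)) + M * L * D t"
proof -
  have "L2_set (\<lambda>(j, k). max 0 (g j t (x i t) k)) (SIGMA j:UNIV. {..<m j})
      \<le> (\<Sum>jk\<in>(SIGMA j:UNIV. {..<m j}). (\<lambda>(j, k). max 0 (g j t (x i t) k)) jk)"
    by (rule L2_set_le_sum) auto
  also have "\<dots> = (\<Sum>j\<in>UNIV. \<Sum>k<m j. max 0 (g j t (x i t) k))"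
    by (subst sum.Sigma[symmetric]) auto
  also have "\<dots> \<le> (\<Sum>j\<in>UNIV. \<Sum>k<m j. max 0 (g j t (x j t) k) + L * D t)"
  proof (intro sum_mono)
    fix j k assume "k \<in> {..<m j}"
    then have "\<bar>max 0 (g j t (x i t) k) - max 0 (g j t (x j t) k)\<bar> \<le> L * norm (x i t - x j t)"
      by (intro lip_pos_g t x_X) simp
    also have "\<dots> \<le> L * D t"
      unfolding D_def by (intro mult_left_mono disagreement_ge[where v = "\<lambda>i. x i t"] L)
    finally show "max 0 (g j t (x i t) k) \<le> max 0 (g j t (x j t) k) + L * D t" by linarith
  qed
  also have "\<dots> = (\<Sum>j\<in>UNIV. \<Sum>k<m j. max 0 (g j t (x j t) k)) + M * L * D t"
    by (simp add: sum.distrib M_def sum_distrib_right mult.assoc)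
  finally show ?thesis .
qed

text \<open>Actual and linearised violation differ by at most \<open>G\<close> times the move.
  \<open>sum_b_le\<close> leaves terms linear in \<open>q\<close>, which \<open>am\<close> splits
  with weight \<open>lam T\<close> into energy terms and multiples of
  \<open>real T powr (1 - \<kappa>) / lam T\<close>: the final dual variable contributes 1 to the
  coefficient, the sum of \<beta> contributes \<open>1 / (2 * (1 - \<kappa>))\<close>.\<close>

lemma component_violation_le:
  assumes T: "1 \<le> T" and k: "k < m j"
  shows "(\<Sum>t=1..T. max 0 (g j t (x j t) k))
    \<le> lam T * ((q j (Suc T) k)\<^sup>2 / (2 * \<gamma> (Suc T)) + (\<Sum>t=1..T. \<beta> (Suc t) * (q j t k)\<^sup>2 / 2))
      + (2 + 1 / (1 - \<kappa>)) / 2 * real T powr (1 - \<kappa> / 2)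
      + G * ((\<Sum>t=1..T. eps j t) + (\<Sum>t=1..T. D t) + \<Psi> T)"
proof -
  interpret dual_update \<beta> \<gamma> "\<lambda>t. b j t k" "\<lambda>t. q j t k" B by (rule dual[OF k])
  have l: "0 < lam T" by (rule lam_pos[OF T])
  have am: "a * v \<le> lam T * (a * v\<^sup>2 / 2) + a / (2 * lam T)" if "0 \<le> a" for a v :: real
  proof -
    have "0 \<le> a * (lam T * v - 1)\<^sup>2 / (2 * lam T)"
      using that l by simp
    also have "\<dots> = lam T * (a * v\<^sup>2 / 2) + a / (2 * lam T) - a * v"
      using l by (simp add: power2_eq_square field_simps)
    finally show ?thesis by simp
  qed
  have "(\<Sum>t=1..T. max 0 (g j t (x j t) k)) \<le> (\<Sum>t=1..T. b j t k + G * (eps j t + D t + \<tau> t))"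
  proof (rule sum_mono)
    fix t assume "t \<in> {1..T}"
    then have t: "1 \<le> t" by simp
    have "\<bar>dg j t k \<bullet> (x j (Suc t) - x j t)\<bar> \<le> G * (eps j t + D t + \<tau> t)"
      by (rule order.trans[OF inner_dg_bound[OF t k] mult_left_mono[OF x_step_dist[OF t] G_nonneg]])
    then show "max 0 (g j t (x j t) k) \<le> b j t k + G * (eps j t + D t + \<tau> t)"
      unfolding b_def by linarith
  qed
  also have "\<dots> = (\<Sum>t=1..T. b j t k) + G * ((\<Sum>t=1..T. eps j t) + (\<Sum>t=1..T. D t) + \<Psi> T)"
    unfolding sum.distrib sum_distrib_left[symmetric] Psi by simp
  also have "(\<Sum>t=1..T. b j t k) \<le> q j (Suc T) k / \<gamma> (Suc T) + (\<Sum>t=1..T. \<beta> (Suc t) * q j t k)"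
    by (rule sum_b_le)
  also have "q j (Suc T) k / \<gamma> (Suc T) \<le> lam T * ((q j (Suc T) k)\<^sup>2 / (2 * \<gamma> (Suc T))) + real T powr (1 - \<kappa>) / lam T"
  proof -
    have "1 / \<gamma> (Suc T) / (2 * lam T) \<le> 2 * real T powr (1 - \<kappa>) / (2 * lam T)"
      using inverse_gamma_le[OF T] l by (intro divide_right_mono) auto
    with am[of "1 / \<gamma> (Suc T)" "q j (Suc T) k"] gamma_pos[of "Suc T"] show ?thesis
      by simp
  qed
  also have "(\<Sum>t=1..T. \<beta> (Suc t) * q j t k)
      \<le> lam T * (\<Sum>t=1..T. \<beta> (Suc t) * (q j t k)\<^sup>2 / 2) + real T powr (1 - \<kappa>) / lam T / (2 * (1 - \<kappa>))"
  proof -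
    have "(\<Sum>t=1..T. \<beta> (Suc t) * q j t k) \<le> (\<Sum>t=1..T. lam T * (\<beta> (Suc t) * (q j t k)\<^sup>2 / 2) + \<beta> (Suc t) / (2 * lam T))"
      by (intro sum_mono am) (simp add: less_imp_le beta_pos)
    also have "\<dots> = lam T * (\<Sum>t=1..T. \<beta> (Suc t) * (q j t k)\<^sup>2 / 2) + (\<Sum>t=1..T. \<beta> (Suc t)) / (2 * lam T)"
      unfolding sum.distrib sum_distrib_left[symmetric] sum_divide_distrib[symmetric] ..
    also have "(\<Sum>t=1..T. \<beta> (Suc t)) / (2 * lam T) \<le> real T powr (1 - \<kappa>) / (1 - \<kappa>) / (2 * lam T)"
      using l by (intro divide_right_mono sum_beta_le) simp
    also have "real T powr (1 - \<kappa>) / (1 - \<kappa>) / (2 * lam T) = real T powr (1 - \<kappa>) / lam T / (2 * (1 - \<kappa>))"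
      by (simp only: divide_divide_eq_left mult.commute mult.left_commute)
    finally show ?thesis by simp
  qed
  finally have *: "(\<Sum>t=1..T. max 0 (g j t (x j t) k))
      \<le> lam T * ((q j (Suc T) k)\<^sup>2 / (2 * \<gamma> (Suc T))) + real T powr (1 - \<kappa>) / lam T
        + (lam T * (\<Sum>t=1..T. \<beta> (Suc t) * (q j t k)\<^sup>2 / 2) + real T powr (1 - \<kappa>) / lam T / (2 * (1 - \<kappa>)))
        + G * ((\<Sum>t=1..T. eps j t) + (\<Sum>t=1..T. D t) + \<Psi> T)" by simp
  have "real T powr (1 - \<kappa>) / lam T + real T powr (1 - \<kappa>) / lam T / (2 * (1 - \<kappa>))
      = (2 + 1 / (1 - \<kappa>)) / 2 * real T powr (1 - \<kappa> / 2)"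
    unfolding div_lam[OF T] using kappa by (simp add: field_simps)
  with * show ?thesis
    unfolding distrib_left[of "lam T"] by linarith
qed

text \<open>A completed square with weight \<open>mu T\<close>; the remainder is the sum of \<alpha>
  divided by \<open>mu T\<close>.\<close>

lemma sum_eps_le:
  assumes T: "1 \<le> T"
  shows "total_eps T \<le> mu T * Seps T + N * (2 * (rate T / mu T))"
proof -
  have u0: "0 < mu T" by (rule mu_pos[OF T])
  have "total_eps T
      \<le> (\<Sum>t=1..T. \<Sum>i\<in>UNIV. mu T * ((eps i t)\<^sup>2 / (4 * \<alpha> (Suc t))) + \<alpha> (Suc t) / mu T)"
  proof (intro sum_mono)
    fix t i
    have a: "0 < \<alpha> (Suc t)" using alpha_pos[of "Suc t"] by simp
    have "0 \<le> (mu T * eps i t - 2 * \<alpha> (Suc t))\<^sup>2 / (4 * \<alpha> (Suc t) * mu T)"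
      using a u0 by simp
    also have "\<dots> = mu T * ((eps i t)\<^sup>2 / (4 * \<alpha> (Suc t))) + \<alpha> (Suc t) / mu T - eps i t"
      using a u0 by (simp add: power2_eq_square field_simps)
    finally show "eps i t \<le> mu T * ((eps i t)\<^sup>2 / (4 * \<alpha> (Suc t))) + \<alpha> (Suc t) / mu T" by simp
  qed
  also have "\<dots> = mu T * Seps T + N * ((\<Sum>t=1..T. \<alpha> (Suc t)) / mu T)"
    unfolding sum.distrib sum_distrib_left[symmetric] Seps_def N_def
    by (simp add: sum_distrib_left sum_divide_distrib)
  also have "\<dots> \<le> mu T * Seps T + N * (2 * rate T / mu T)"
    using u0 N_ge_1 by (intro add_left_mono mult_left_mono divide_right_mono sum_alpha_le) auto
  finally show ?thesis by simp
qed

lemma pathwise_violation: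
  assumes T: "1 \<le> T"
  shows "net_ccv m g T x \<le> violation_const * viol T + (lam T + drift_const * mu T) * S T"
proof -
  \<comment> \<open>A bound that no longer depends on the agent \<open>i\<close>, so the average
    over agents is harmless.\<close>
  define V where "V t = (\<Sum>j\<in>UNIV. \<Sum>k<m j. max 0 (g j t (x j t) k)) + M * L * D t" for t
  have "net_ccv m g T x \<le> 1 / N * (\<Sum>i\<in>(UNIV::'n set). \<Sum>t=1..T. V t)"
    unfolding net_ccv_def N_def V_def
    by (intro mult_left_mono sum_mono stacked_violation_le) auto
  also have "\<dots> = (\<Sum>t=1..T. V t)"
    by (simp add: N_def)
  also have "\<dots> = (\<Sum>j\<in>UNIV. \<Sum>k<m j. \<Sum>t=1..T. max 0 (g j t (x j t) k)) + M * L * (\<Sum>t=1..T. D t)"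
  proof -
    have "(\<Sum>t=1..T. \<Sum>j\<in>UNIV. \<Sum>k<m j. max 0 (g j t (x j t) k)) = (\<Sum>j\<in>UNIV. \<Sum>t=1..T. \<Sum>k<m j. max 0 (g j t (x j t) k))"
      by (rule sum.swap)
    also have "\<dots> = (\<Sum>j\<in>UNIV. \<Sum>k<m j. \<Sum>t=1..T. max 0 (g j t (x j t) k))"
      by (intro sum.cong refl sum.swap)
    finally show ?thesis
      unfolding V_def sum.distrib sum_distrib_left[symmetric] by simp
  qed
  also have "(\<Sum>j\<in>UNIV. \<Sum>k<m j. \<Sum>t=1..T. max 0 (g j t (x j t) k))
      \<le> (\<Sum>j\<in>UNIV. \<Sum>k<m j. lam T * ((q j (Suc T) k)\<^sup>2 / (2 * \<gamma> (Suc T)) + (\<Sum>t=1..T. \<beta> (Suc t) * (q j t k)\<^sup>2 / 2))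
      + (2 + 1 / (1 - \<kappa>)) / 2 * real T powr (1 - \<kappa> / 2)
      + G * (total_eps T + (\<Sum>t=1..T. D t) + \<Psi> T))"
  proof (intro sum_mono)
    fix j k assume "k \<in> {..<m j}"
    then have k: "k < m j" by simp
    have "(\<Sum>t=1..T. eps j t) \<le> total_eps T"
      by (intro sum_mono member_le_sum) (auto simp: eps_nonneg)
    then have "G * ((\<Sum>t=1..T. eps j t) + (\<Sum>t=1..T. D t) + \<Psi> T)
        \<le> G * (total_eps T + (\<Sum>t=1..T. D t) + \<Psi> T)"
      by (intro mult_left_mono G_nonneg) simp
    with component_violation_le[OF T k] show "(\<Sum>t=1..T. max 0 (g j t (x j t) k))
      \<le> lam T * ((q j (Suc T) k)\<^sup>2 / (2 * \<gamma> (Suc T)) + (\<Sum>t=1..T. \<beta> (Suc t) * (q j t k)\<^sup>2 / 2))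
      + (2 + 1 / (1 - \<kappa>)) / 2 * real T powr (1 - \<kappa> / 2)
      + G * (total_eps T + (\<Sum>t=1..T. D t) + \<Psi> T)" by linarith
  qed
  also have "\<dots> = lam T * (Sq T + Sbeta T)
      + M * ((2 + 1 / (1 - \<kappa>)) / 2 * real T powr (1 - \<kappa> / 2)
      + G * (total_eps T + (\<Sum>t=1..T. D t) + \<Psi> T))"
  proof -
    have "(\<Sum>j\<in>UNIV. \<Sum>k<m j. lam T * a j k + c + d) = lam T * (\<Sum>j\<in>UNIV. \<Sum>k<m j. a j k) + M * (c + d)"
      for a :: "'n \<Rightarrow> nat \<Rightarrow> real" and c d
      by (simp add: sum.distrib M_def add.assoc flip: sum_distrib_left sum_distrib_right distrib_left)
    then show ?thesis
      unfolding Sq_def Sbeta_def sum.distrib[symmetric] by simp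
  qed
  finally have 1: "net_ccv m g T x \<le> lam T * (Sq T + Sbeta T)
      + M * ((2 + 1 / (1 - \<kappa>)) / 2 * real T powr (1 - \<kappa> / 2)
      + G * (total_eps T + (\<Sum>t=1..T. D t) + \<Psi> T)) + M * L * (\<Sum>t=1..T. D t)" by simp
  let ?E = "\<Sum>t=1..T. \<Sum>i\<in>UNIV. eps i t"
  have MGL: "0 \<le> M * G + M * L" using M_nonneg G_nonneg L by simp
  have 2: "(M * G + M * L) * (\<Sum>t=1..T. D t) \<le> (M * G + M * L) * (Cd * (2 * R + \<Psi> T + ?E))"
    by (intro mult_left_mono sum_D_le MGL)
  have 3: "drift_const * ?E \<le> drift_const * (mu T * Seps T + N * (2 * (rate T / mu T)))"
    by (intro mult_left_mono sum_eps_le T drift_const_nonneg)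
  have 4: "drift_const * \<Psi> T \<le> drift_const * (\<tau> 1 powr (3 / 4) * viol T)"
    by (intro mult_left_mono Psi_le_viol T drift_const_nonneg)
  have 5: "2 * R * spread_const \<le> 2 * R * spread_const * viol T"
    using R spread_const_nonneg one_le_viol[OF T] mult_left_mono[of 1 "viol T" "2 * R * spread_const"] by simp
  have 6: "drift_const * N * 2 * (rate T / mu T) \<le> drift_const * N * 2 * viol T"
    unfolding rate_div_mu[OF T] viol_def using drift_const_nonneg N_ge_1 by (intro mult_left_mono) auto
  have 7: "M * ((2 + 1 / (1 - \<kappa>)) / 2) * real T powr (1 - \<kappa> / 2) \<le> M * ((2 + 1 / (1 - \<kappa>)) / 2) * viol T"
    unfolding viol_def using M_nonneg kappa by (intro mult_left_mono) auto
  \<comment> \<open>All parts of the energy are nonnegative, so both weights may be applied to the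
    whole of it.\<close>
  have 8: "lam T * (Sq T + Sbeta T) + drift_const * mu T * Seps T \<le> (lam T + drift_const * mu T) * S T"
  proof -
    have "0 \<le> lam T * Seps T" "0 \<le> drift_const * mu T * (Sq T + Sbeta T)"
      using lam_pos[OF T] mu_pos[OF T] drift_const_nonneg S_parts_nonneg by simp_all
    then show ?thesis unfolding S_def by (simp add: algebra_simps)
  qed
  have e1: "M * ((2 + 1 / (1 - \<kappa>)) / 2 * real T powr (1 - \<kappa> / 2) + G * (?E + (\<Sum>t=1..T. D t) + \<Psi> T)) + M * L * (\<Sum>t=1..T. D t)
      = M * ((2 + 1 / (1 - \<kappa>)) / 2) * real T powr (1 - \<kappa> / 2) + M * G * ?E + M * G * \<Psi> T + (M * G + M * L) * (\<Sum>t=1..T. D t)"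
    by (simp only: distrib_left distrib_right mult.assoc add_ac)
  have e2: "(M * G + M * L) * (Cd * (2 * R + \<Psi> T + ?E)) = 2 * R * spread_const + spread_const * \<Psi> T + spread_const * ?E"
    unfolding spread_const_def by (simp add: algebra_simps)
  have e3: "drift_const * ?E = M * G * ?E + spread_const * ?E" "drift_const * \<Psi> T = M * G * \<Psi> T + spread_const * \<Psi> T"
    unfolding drift_const_def by (simp_all only: distrib_right)
  have e4: "drift_const * (mu T * Seps T + N * (2 * (rate T / mu T))) = drift_const * mu T * Seps T + drift_const * N * 2 * (rate T / mu T)"
    by (simp only: distrib_left mult.assoc)
  have e5: "violation_const * viol T = M * ((2 + 1 / (1 - \<kappa>)) / 2) * viol T + drift_const * N * 2 * viol T + 2 * R * spread_const * viol T
      + drift_const * (\<tau> 1 powr (3 / 4) * viol T)"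
    unfolding violation_const_def by (simp only: distrib_right mult.assoc times_divide_eq_right)
  show ?thesis
    using 1 2 3 4 5 6 7 8 unfolding e5 using e1 e2 e3 e4 by linarith
qed

end

section \<open>Expected regret and violation\<close>

text \<open>Losses and constraints are continuous on \<open>X\<close> and unspecified elsewhere; the
  composition is measurable because the inner map stays in \<open>X\<close>.\<close>

lemma measurable_continuous_on_closed:
  fixes h :: "'a::topological_space \<Rightarrow> real"
  assumes "closed X" "continuous_on X h" "Y \<in> borel_measurable \<A>" "\<And>\<omega>. \<omega> \<in> space \<A> \<Longrightarrow> Y \<omega> \<in> X"
  shows "(\<lambda>\<omega>. h (Y \<omega>)) \<in> borel_measurable \<A>"
proof -
  have "(\<lambda>y. indicator X y *\<^sub>R h y) \<in> borel_measurable borel"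
    using assms(1,2) by (intro borel_measurable_continuous_on_indicator) auto
  from measurable_compose[OF assms(3) this]
  have "(\<lambda>\<omega>. indicator X (Y \<omega>) *\<^sub>R h (Y \<omega>)) \<in> borel_measurable \<A>" .
  then show ?thesis
    by (rule measurable_cong[THEN iffD1, rotated]) (simp add: assms(4))
qed

lemma (in prob_space) integrable_bounded:
  fixes Y :: "'a \<Rightarrow> real"
  assumes "Y \<in> borel_measurable M" "\<And>\<omega>. \<omega> \<in> space M \<Longrightarrow> \<bar>Y \<omega>\<bar> \<le> K"
  shows "integrable M Y"
  by (rule integrable_const_bound[of _ K]) (use assms in \<open>auto intro: AE_I2\<close>)

text \<open>Only the directions are assumed to be random variables. The recursion holds at every
  point of the space, and measurability of the states is derived from it.\<close>

locale stochastic_run = setting X r R m f g W \<tau> \<Psi> \<alpha> \<beta> \<gamma> \<xi> \<delta> \<kappa> L F Cd + prob_space \<Omega>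
  for X :: "(real ^ 'p) set" and r R :: real and m :: "'n::finite \<Rightarrow> nat"
    and f :: "'n \<Rightarrow> nat \<Rightarrow> real ^ 'p \<Rightarrow> real"
    and g :: "'n \<Rightarrow> nat \<Rightarrow> real ^ 'p \<Rightarrow> nat \<Rightarrow> real"
    and W :: "nat \<Rightarrow> real ^ 'n ^ 'n"
    and \<tau> \<Psi> \<alpha> \<beta> \<gamma> \<xi> \<delta> :: "nat \<Rightarrow> real" and \<kappa> L F Cd :: real and \<Omega> :: "'w measure" +
  fixes x1 :: "'n \<Rightarrow> real ^ 'p" and u x xh :: "'n \<Rightarrow> nat \<Rightarrow> 'w \<Rightarrow> real ^ 'p"
    and q :: "'n \<Rightarrow> nat \<Rightarrow> 'w \<Rightarrow> nat \<Rightarrow> real"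
  assumes init: "\<And>i. x1 i \<in> shrunk 1"
    and u_sphere: "\<And>i t \<omega>. 1 \<le> t \<Longrightarrow> \<omega> \<in> space \<Omega> \<Longrightarrow> norm (u i t \<omega>) = 1"
    and u_uniform: "\<And>i t. 1 \<le> t \<Longrightarrow> distr \<Omega> borel (u i t) = sphere_uniform"
    and u_indep: "indep_vars (\<lambda>_. borel) (\<lambda>(i, t). u i t) (UNIV \<times> {1..})"
    and gen: "\<And>\<omega>. \<omega> \<in> space \<Omega> \<Longrightarrow> generated X m f g W \<alpha> \<beta> \<gamma> \<tau> \<xi> \<delta> x1
      (\<lambda>i t. u i t \<omega>) (\<lambda>i t. x i t \<omega>) (\<lambda>i t. xh i t \<omega>) (\<lambda>i t. q i t \<omega>)"
begin

lemma run_at: "\<omega> \<in> space \<Omega> \<Longrightarrow> run X r R m f g W \<tau> \<Psi> \<alpha> \<beta> \<gamma> \<xi> \<delta> \<kappa> L F Cd x1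
    (\<lambda>i t. u i t \<omega>) (\<lambda>i t. x i t \<omega>) (\<lambda>i t. xh i t \<omega>) (\<lambda>i t. q i t \<omega>)"
  by (intro run.intro setting_axioms run_axioms.intro init u_sphere gen)

text \<open>This and the following definitions restate quantities of \<open>run\<close> as functions
  on the probability space, as integrals need them; \<open>along_realization\<close> identifies them
  pointwise.\<close>

definition df :: "'n \<Rightarrow> nat \<Rightarrow> 'w \<Rightarrow> real ^ 'p" where
  "df i t \<omega> = grad_est (\<delta> t) (f i t) (x i t \<omega>) (u i t \<omega>)"
definition dg :: "'n \<Rightarrow> nat \<Rightarrow> nat \<Rightarrow> 'w \<Rightarrow> real ^ 'p" where
  "dg i t k \<omega> = grad_est (\<delta> t) (\<lambda>y. max 0 (g i t y k)) (x i t \<omega>) (u i t \<omega>)"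
definition om :: "'n \<Rightarrow> nat \<Rightarrow> 'w \<Rightarrow> real ^ 'p" where
  "om i t \<omega> = df i t \<omega> + (\<Sum>k<m i. q i t \<omega> k *\<^sub>R dg i t k \<omega>)"
definition z :: "'n \<Rightarrow> nat \<Rightarrow> 'w \<Rightarrow> real ^ 'p" where
  "z i t \<omega> = (\<Sum>j\<in>UNIV. W t $ i $ j *\<^sub>R xh j t \<omega>)"
definition gap :: "nat \<Rightarrow> real ^ 'p \<Rightarrow> 'w \<Rightarrow> real" where
  "gap t c \<omega> = (\<Sum>i\<in>UNIV. om i t \<omega> \<bullet> (x i t \<omega> - c) - (\<Sum>k<m i. q i t \<omega> k * max 0 (g i t (x i t \<omega>) k)))"
definition D :: "nat \<Rightarrow> 'w \<Rightarrow> real" where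
  "D t \<omega> = disagreement (\<lambda>i. x i t \<omega>)"
definition S :: "nat \<Rightarrow> 'w \<Rightarrow> real" where
  "S T \<omega> = (\<Sum>i\<in>UNIV. \<Sum>k<m i. \<Sum>t=1..T. \<beta> (Suc t) * (q i t \<omega> k)\<^sup>2 / 2)
    + (\<Sum>i\<in>UNIV. \<Sum>k<m i. (q i (Suc T) \<omega> k)\<^sup>2 / (2 * \<gamma> (Suc T)))
    + (\<Sum>t=1..T. \<Sum>i\<in>UNIV. (norm (x i (Suc t) \<omega> - z i t \<omega>))\<^sup>2 / (4 * \<alpha> (Suc t)))"

lemma along_realization:
  assumes \<omega>: "\<omega> \<in> space \<Omega>"
  shows pathwise_energy: "\<And>T c. \<lbrakk>1 \<le> T; \<And>t. t \<in> {1..T} \<Longrightarrow> c t \<in> shrunk t\<rbrakk> \<Longrightarrow>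
      (\<Sum>t=1..T. gap t (c t) \<omega>) + N * L * (\<Sum>t=1..T. D t \<omega>) + S T \<omega>
      \<le> energy_const * (real T powr \<kappa> + rate T + path T * (\<Sum>t=1..<T. norm (c (Suc t) - c t)))"
    and pathwise_violation: "\<And>T. 1 \<le> T \<Longrightarrow> net_ccv m g T (\<lambda>i t. x i t \<omega>) \<le> violation_const * viol T + (lam T + drift_const * mu T) * S T \<omega>"
    and S_nonneg: "\<And>T. 0 \<le> S T \<omega>"
    and D_nonneg: "\<And>t. 0 \<le> D t \<omega>"
    and x_shrunk: "\<And>i t. 1 \<le> t \<Longrightarrow> x i t \<omega> \<in> shrunk t"
    and x_X: "\<And>i t. 1 \<le> t \<Longrightarrow> x i t \<omega> \<in> X"
    and xh_X: "\<And>i t. 1 \<le> t \<Longrightarrow> xh i t \<omega> \<in> X"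
    and q_nonneg: "\<And>i t k. 1 \<le> t \<Longrightarrow> k < m i \<Longrightarrow> 0 \<le> q i t \<omega> k"
    and q_le: "\<And>i t k. 1 \<le> t \<Longrightarrow> k < m i \<Longrightarrow> q i t \<omega> k \<le> B * real t powr \<kappa>"
    and df_bound: "\<And>i t. 1 \<le> t \<Longrightarrow> norm (df i t \<omega>) \<le> G"
    and dg_bound: "\<And>i t k. 1 \<le> t \<Longrightarrow> k < m i \<Longrightarrow> norm (dg i t k \<omega>) \<le> G"
    and x_1: "\<And>i. x i 1 \<omega> = x1 i" and xh_1: "\<And>i. xh i 1 \<omega> = x i 1 \<omega>"
    and q_1: "\<And>i k. k < m i \<Longrightarrow> q i 1 \<omega> k = 0"
    and x_Suc: "\<And>i t. 1 \<le> t \<Longrightarrow> x i (Suc t) \<omega> = closest_point (shrunk (Suc t)) (z i t \<omega> - \<alpha> (Suc t) *\<^sub>R om i t \<omega>)"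
    and q_Suc: "\<And>i t k. 1 \<le> t \<Longrightarrow> k < m i \<Longrightarrow> q i (Suc t) \<omega> k
      = max 0 ((1 - \<beta> (Suc t) * \<gamma> (Suc t)) * q i t \<omega> k
        + \<gamma> (Suc t) * (max 0 (g i t (x i t \<omega>) k) + dg i t k \<omega> \<bullet> (x i (Suc t) \<omega> - x i t \<omega>)))"
    and xh_Suc: "\<And>i t. 1 \<le> t \<Longrightarrow> xh i (Suc t) \<omega>
      = (if norm (x i (Suc t) \<omega> - xh i t \<omega>) \<ge> \<tau> (Suc t) then x i (Suc t) \<omega> else xh i t \<omega>)"
    and x_z_dist: "\<And>i t. 1 \<le> t \<Longrightarrow> norm (x i (Suc t) \<omega> - z i t \<omega>) \<le> 2 * R"
proof -
  interpret P: run X r R m f g W \<tau> \<Psi> \<alpha> \<beta> \<gamma> \<xi> \<delta> \<kappa> L F Cd x1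
    "\<lambda>i t. u i t \<omega>" "\<lambda>i t. x i t \<omega>" "\<lambda>i t. xh i t \<omega>" "\<lambda>i t. q i t \<omega>"
    by (rule run_at[OF \<omega>])
  have df: "P.df i t = df i t \<omega>" for i t
    by (simp add: P.df_def df_def)
  have dg: "P.dg i t k = dg i t k \<omega>" for i t k
    by (simp add: P.dg_def dg_def grad_est_pos_def)
  have om: "P.om i t = om i t \<omega>" for i t
    by (simp add: P.om_def om_def mat_apply_def df dg)
  have z: "P.z i t = z i t \<omega>" for i t
    by (simp add: P.z_def z_def)
  have gap: "P.gap t c = gap t (c t) \<omega>" for t c
    by (simp add: P.gap_def gap_def om)
  have D: "P.D t = D t \<omega>" for t
    by (simp add: P.D_def D_def)
  have S: "P.S T = S T \<omega>" for T
    by (simp add: P.S_def S_def P.Sbeta_def P.Sq_def P.Seps_def P.eps_def z)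
  show "(\<Sum>t=1..T. gap t (c t) \<omega>) + N * L * (\<Sum>t=1..T. D t \<omega>) + S T \<omega>
      \<le> energy_const * (real T powr \<kappa> + rate T + path T * (\<Sum>t=1..<T. norm (c (Suc t) - c t)))"
    if "1 \<le> T" "\<And>t. t \<in> {1..T} \<Longrightarrow> c t \<in> shrunk t" for T c
    using P.pathwise_energy[OF that] unfolding gap D S[symmetric] P.S_def by simp
  show "net_ccv m g T (\<lambda>i t. x i t \<omega>) \<le> violation_const * viol T + (lam T + drift_const * mu T) * S T \<omega>" if "1 \<le> T" for T
    using P.pathwise_violation[OF that] unfolding S .
  show "0 \<le> S T \<omega>" for T
    unfolding S[symmetric] P.S_def using P.S_parts_nonneg[of T] by simp
  show "0 \<le> D t \<omega>" for t
    unfolding D_def by (rule disagreement_nonneg)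
  show "norm (df i t \<omega>) \<le> G" if "1 \<le> t" for i t
    using P.df_bound[OF that] unfolding df .
  show "norm (dg i t k \<omega>) \<le> G" if "1 \<le> t" "k < m i" for i t k
    using P.dg_bound[OF that] unfolding dg .
  show "x i (Suc t) \<omega> = closest_point (shrunk (Suc t)) (z i t \<omega> - \<alpha> (Suc t) *\<^sub>R om i t \<omega>)" if "1 \<le> t" for i t
    using P.x_Suc[OF that, of i] unfolding z om .
  show "q i (Suc t) \<omega> k = max 0 ((1 - \<beta> (Suc t) * \<gamma> (Suc t)) * q i t \<omega> k
        + \<gamma> (Suc t) * (max 0 (g i t (x i t \<omega>) k) + dg i t k \<omega> \<bullet> (x i (Suc t) \<omega> - x i t \<omega>)))"
    if "1 \<le> t" "k < m i" for i t k
    using P.q_Suc[OF that] unfolding P.b_def dg .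
  show "norm (x i (Suc t) \<omega> - z i t \<omega>) \<le> 2 * R" if t: "1 \<le> t" for i t
  proof -
    have "(\<Sum>j\<in>UNIV. W t $ i $ j *\<^sub>R xh j t \<omega>) \<in> X"
      by (rule convex_sum[OF _ X(1) P.W_row[OF t]]) (auto intro: P.W_nonneg t P.xh_X)
    then have "z i t \<omega> \<in> X" by (simp add: z_def)
    then show ?thesis
      using t by (intro norm_diff_X P.x_X) auto
  qed
qed (simp_all add: run.x_shrunk[OF run_at[OF \<omega>]] run.x_X[OF run_at[OF \<omega>]] run.xh_X[OF run_at[OF \<omega>]]
    run.q_bounds[OF run_at[OF \<omega>]] run.start[OF run_at[OF \<omega>], unfolded One_nat_def] run.xh_Suc[OF run_at[OF \<omega>]])

abbreviation \<F> :: "nat \<Rightarrow> 'w measure" where "\<F> \<equiv> past u (space \<Omega>)"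

lemma u_rv: "1 \<le> t \<Longrightarrow> u i t \<in> borel_measurable \<Omega>"
  using u_indep unfolding indep_vars_def by auto

lemma id_\<F>: "(\<lambda>\<omega>. \<omega>) \<in> measurable \<Omega> (\<F> t)"
  by (rule measurable_id_past[OF u_rv])

lemma from_\<F>: "Y \<in> measurable (\<F> t) \<A> \<Longrightarrow> Y \<in> measurable \<Omega> \<A>"
  by (rule measurable_compose[OF id_\<F>])

lemma cont_f: "1 \<le> t \<Longrightarrow> continuous_on X (f i t)"
  by (rule lipschitz_on_continuous_on[of L], rule lipschitz_onI[OF _ L])
    (unfold dist_norm real_norm_def, rule lip_f)

lemma cont_g: "1 \<le> t \<Longrightarrow> k < m i \<Longrightarrow> continuous_on X (\<lambda>y. g i t y k)"
  by (rule lipschitz_on_continuous_on[of L], rule lipschitz_onI[OF _ L])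
    (unfold dist_norm real_norm_def, rule lip_g)

lemma cont_pos_g: "1 \<le> t \<Longrightarrow> k < m i \<Longrightarrow> continuous_on X (\<lambda>y. max 0 (g i t y k))"
  by (intro continuous_intros cont_g)

lemma query_X:
  assumes "\<omega> \<in> space \<Omega>" "1 \<le> t"
  shows "x i t \<omega> + \<delta> t *\<^sub>R u i t \<omega> \<in> X"
proof -
  have "x i t \<omega> + \<delta> t *\<^sub>R u i t \<omega> \<in> cball (x i t \<omega>) (\<delta> t)"
    using u_sphere[OF assms(2,1)] delta_pos[OF assms(2)] by (simp add: dist_norm)
  then show ?thesis
    using cball_shrunk[OF assms(2) x_shrunk[OF assms]] by blast
qed

lemma grad_est_measurable:
  assumes t: "1 \<le> t" and h: "continuous_on X h"
    and x: "x i t \<in> borel_measurable \<A>" and u: "u i t \<in> borel_measurable \<A>" and s: "space \<A> = space \<Omega>"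
  shows "(\<lambda>\<omega>. grad_est (\<delta> t) h (x i t \<omega>) (u i t \<omega>)) \<in> borel_measurable \<A>"
proof -
  note [measurable] = x u
  have [measurable]: "(\<lambda>\<omega>. h (x i t \<omega> + \<delta> t *\<^sub>R u i t \<omega>)) \<in> borel_measurable \<A>"
    by (rule measurable_continuous_on_closed[OF X(2) h]) (use query_X t s in auto)
  have [measurable]: "(\<lambda>\<omega>. h (x i t \<omega>)) \<in> borel_measurable \<A>"
    by (rule measurable_continuous_on_closed[OF X(2) h]) (use x_X t s in auto)
  show ?thesis unfolding grad_est_def by measurable
qed

text \<open>The components \<open>q i t \<omega> k\<close> with \<open>k \<ge> m i\<close> are arbitrary and need not be measurable.\<close>

lemma state_measurable:
  assumes "1 \<le> t"
  shows "x i t \<in> borel_measurable (\<F> t)" "xh i t \<in> borel_measurable (\<F> t)"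
    "k < m i \<Longrightarrow> (\<lambda>\<omega>. q i t \<omega> k) \<in> borel_measurable (\<F> t)"
proof -
  have "(\<forall>i. x i t \<in> borel_measurable (\<F> t)) \<and> (\<forall>i. xh i t \<in> borel_measurable (\<F> t)) \<and>
      (\<forall>i. \<forall>k<m i. (\<lambda>\<omega>. q i t \<omega> k) \<in> borel_measurable (\<F> t))"
    using assms
  proof (induction rule: dec_induct)
    case base
    have x: "x i 1 \<in> borel_measurable (\<F> 1)" for i
      by (rule measurable_cong[THEN iffD2, of _ _ "\<lambda>_. x1 i"]) (simp_all add: x_1[unfolded One_nat_def])
    have xh: "xh i 1 \<in> borel_measurable (\<F> 1)" for i
      by (rule measurable_cong[THEN iffD2, OF _ x[of i]]) (simp add: xh_1[unfolded One_nat_def])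
    have q: "(\<lambda>\<omega>. q i 1 \<omega> k) \<in> borel_measurable (\<F> 1)" if "k < m i" for i k
      by (rule measurable_cong[THEN iffD2, of _ _ "\<lambda>_. 0"]) (simp_all add: q_1[unfolded One_nat_def] that)
    show ?case using x xh q by blast
  next
    case (step t)
    let ?F = "\<F> (Suc t)"
    have t: "1 \<le> t" by fact
    have [measurable]: "x i t \<in> borel_measurable ?F" "xh i t \<in> borel_measurable ?F" for i
      using step.IH by (auto intro: past_mono[of _ _ _ t])
    have [measurable]: "(\<lambda>\<omega>. q i t \<omega> k) \<in> borel_measurable ?F" if "k < m i" for i k
      using step.IH that by (auto intro: past_mono[of _ _ _ t])
    have u [measurable]: "u i t \<in> borel_measurable ?F" for i
      by (rule measurable_past) (use t in auto)
    have df [measurable]: "df i t \<in> borel_measurable ?F" for i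
      unfolding df_def[abs_def] by (rule grad_est_measurable[OF t cont_f[OF t]]) simp_all
    have dg [measurable]: "dg i t k \<in> borel_measurable ?F" if "k < m i" for i k
      unfolding dg_def[abs_def] by (rule grad_est_measurable[OF t cont_pos_g[OF t that]]) simp_all
    have g [measurable]: "(\<lambda>\<omega>. g i t (x i t \<omega>) k) \<in> borel_measurable ?F" if "k < m i" for i k
      by (rule measurable_continuous_on_closed[OF X(2) cont_g[OF t that]]) (use x_X t in auto)
    have om [measurable]: "om i t \<in> borel_measurable ?F" for i
      unfolding om_def[abs_def]
      by (intro borel_measurable_add df borel_measurable_sum borel_measurable_scaleR) auto
    have z [measurable]: "z i t \<in> borel_measurable ?F" for i
      unfolding z_def[abs_def] by measurable
    \<comment> \<open>Projection onto a nonempty closed convex set is continuous, hence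
      Borel.\<close>
    have cp: "closest_point (shrunk (Suc t)) \<in> borel_measurable borel"
      using zero_shrunk[of "Suc t"]
      by (intro borel_measurable_continuous_onI continuous_on_closest_point shrunk_convex shrunk_closed) auto
    have x' [measurable]: "x i (Suc t) \<in> borel_measurable ?F" for i
    proof -
      have "(\<lambda>\<omega>. z i t \<omega> - \<alpha> (Suc t) *\<^sub>R om i t \<omega>) \<in> borel_measurable ?F"
        by measurable
      from measurable_compose[OF this cp] show ?thesis
        by (rule measurable_cong[THEN iffD2, rotated]) (simp add: x_Suc[OF _ t])
    qed
    have xh': "xh i (Suc t) \<in> borel_measurable ?F" for i
    proof -
      have "(\<lambda>\<omega>. if norm (x i (Suc t) \<omega> - xh i t \<omega>) \<ge> \<tau> (Suc t) then x i (Suc t) \<omega> else xh i t \<omega>)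
          \<in> borel_measurable ?F"
        by measurable
      then show ?thesis
        by (rule measurable_cong[THEN iffD2, rotated]) (simp add: xh_Suc[OF _ t])
    qed
    have q': "(\<lambda>\<omega>. q i (Suc t) \<omega> k) \<in> borel_measurable ?F" if k: "k < m i" for i k
    proof -
      note [measurable] = g[OF k] dg[OF k] \<open>k < m i \<Longrightarrow> (\<lambda>\<omega>. q i t \<omega> k) \<in> borel_measurable ?F\<close>[OF k]
      have "(\<lambda>\<omega>. max 0 ((1 - \<beta> (Suc t) * \<gamma> (Suc t)) * q i t \<omega> k
        + \<gamma> (Suc t) * (max 0 (g i t (x i t \<omega>) k) + dg i t k \<omega> \<bullet> (x i (Suc t) \<omega> - x i t \<omega>))))
          \<in> borel_measurable ?F"
        by measurable
      then show ?thesis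
        by (rule measurable_cong[THEN iffD2, rotated]) (simp add: q_Suc[OF _ t k])
    qed
    show ?case using x' xh' q' by blast
  qed
  then show "x i t \<in> borel_measurable (\<F> t)" "xh i t \<in> borel_measurable (\<F> t)"
    "k < m i \<Longrightarrow> (\<lambda>\<omega>. q i t \<omega> k) \<in> borel_measurable (\<F> t)" by blast+
qed

section \<open>Integrability, from measurability and boundedness\<close>

abbreviation expected_loss :: "'n \<Rightarrow> nat \<Rightarrow> real" where
  "expected_loss i t \<equiv> (\<integral>\<omega>. f i t (x i t \<omega>) \<partial>\<Omega>)"
abbreviation weighted_dg :: "'n \<Rightarrow> nat \<Rightarrow> nat \<Rightarrow> real ^ 'p \<Rightarrow> 'w \<Rightarrow> real" where
  "weighted_dg i t k c \<omega> \<equiv> q i t \<omega> k * (dg i t k \<omega> \<bullet> (x i t \<omega> - c))"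
abbreviation weighted_g :: "'n \<Rightarrow> nat \<Rightarrow> nat \<Rightarrow> 'w \<Rightarrow> real" where
  "weighted_g i t k \<omega> \<equiv> q i t \<omega> k * max 0 (g i t (x i t \<omega>) k)"

lemma x_rv: "1 \<le> t \<Longrightarrow> x i t \<in> borel_measurable \<Omega>"
  and xh_rv: "1 \<le> t \<Longrightarrow> xh i t \<in> borel_measurable \<Omega>"
  and q_rv: "1 \<le> t \<Longrightarrow> k < m i \<Longrightarrow> (\<lambda>\<omega>. q i t \<omega> k) \<in> borel_measurable \<Omega>"
  using from_\<F> state_measurable by blast+

lemma z_rv: "1 \<le> t \<Longrightarrow> z i t \<in> borel_measurable \<Omega>"
  unfolding z_def[abs_def] by (intro borel_measurable_sum borel_measurable_scaleR xh_rv) simp_all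

lemma f_rv: "1 \<le> t \<Longrightarrow> (\<lambda>\<omega>. f j t (x i t \<omega>)) \<in> borel_measurable \<Omega>"
  by (rule measurable_continuous_on_closed[OF X(2) cont_f x_rv x_X])

lemma g_rv: "1 \<le> t \<Longrightarrow> k < m j \<Longrightarrow> (\<lambda>\<omega>. max 0 (g j t (x i t \<omega>) k)) \<in> borel_measurable \<Omega>"
  by (rule measurable_continuous_on_closed[OF X(2) cont_pos_g x_rv x_X])

lemma df_rv: "1 \<le> t \<Longrightarrow> df i t \<in> borel_measurable \<Omega>"
  unfolding df_def[abs_def] by (rule grad_est_measurable[OF _ cont_f x_rv u_rv refl])

lemma dg_rv: "1 \<le> t \<Longrightarrow> k < m i \<Longrightarrow> dg i t k \<in> borel_measurable \<Omega>"
  unfolding dg_def[abs_def] by (rule grad_est_measurable[OF _ cont_pos_g x_rv u_rv refl])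

lemma D_integrable:
  assumes t: "1 \<le> t"
  shows "integrable \<Omega> (D t)"
proof (rule integrable_bounded)
  have "(\<lambda>\<omega>. Max ((\<lambda>ij. norm (x (fst ij) t \<omega> - x (snd ij) t \<omega>)) ` (UNIV :: ('n \<times> 'n) set))) \<in> borel_measurable \<Omega>"
  proof (rule borel_measurable_Max)
    fix ij :: "'n \<times> 'n"
    note [measurable] = x_rv[OF t, of "fst ij"] x_rv[OF t, of "snd ij"]
    show "(\<lambda>\<omega>. norm (x (fst ij) t \<omega> - x (snd ij) t \<omega>)) \<in> borel_measurable \<Omega>"
      by measurable
  qed simp
  then show "D t \<in> borel_measurable \<Omega>"
    unfolding D_def[abs_def] disagreement_def by (simp add: case_prod_beta')
  show "\<bar>D t \<omega>\<bar> \<le> 2 * R" if "\<omega> \<in> space \<Omega>" for \<omega>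
    using D_nonneg[OF that, of t] disagreement_le[of "\<lambda>i. x i t \<omega>" "2 * R"] norm_diff_X x_X[OF that t]
    unfolding D_def by simp
qed

lemma q_sq_integrable:
  assumes "1 \<le> t" "k < m i"
  shows "integrable \<Omega> (\<lambda>\<omega>. (q i t \<omega> k)\<^sup>2)"
proof (rule integrable_bounded)
  show "(\<lambda>\<omega>. (q i t \<omega> k)\<^sup>2) \<in> borel_measurable \<Omega>"
    by (intro borel_measurable_power q_rv assms)
  show "\<bar>(q i t \<omega> k)\<^sup>2\<bar> \<le> (B * real t powr \<kappa>)\<^sup>2" if "\<omega> \<in> space \<Omega>" for \<omega>
    using power_mono[OF q_le[OF that assms] q_nonneg[OF that assms], of 2] by simp
qed

lemma step_sq_integrable:
  assumes t: "1 \<le> t"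
  shows "integrable \<Omega> (\<lambda>\<omega>. (norm (x i (Suc t) \<omega> - z i t \<omega>))\<^sup>2)"
proof (rule integrable_bounded)
  have [measurable]: "x i (Suc t) \<in> borel_measurable \<Omega>" "z i t \<in> borel_measurable \<Omega>"
    by (rule x_rv, simp) (rule z_rv[OF t])
  show "(\<lambda>\<omega>. (norm (x i (Suc t) \<omega> - z i t \<omega>))\<^sup>2) \<in> borel_measurable \<Omega>"
    by measurable
  show "\<bar>(norm (x i (Suc t) \<omega> - z i t \<omega>))\<^sup>2\<bar> \<le> (2 * R)\<^sup>2" if "\<omega> \<in> space \<Omega>" for \<omega>
    using power_mono[OF x_z_dist[OF that t], of i 2] by simp
qed

lemma S_integrable: "integrable \<Omega> (S T)"
  unfolding S_def[abs_def]
  by (intro Bochner_Integration.integrable_add Bochner_Integration.integrable_sum integrable_divide_zero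
      integrable_mult_right q_sq_integrable step_sq_integrable) auto

lemma f_integrable:
  assumes "1 \<le> t"
  shows "integrable \<Omega> (\<lambda>\<omega>. f j t (x i t \<omega>))"
proof (rule integrable_bounded[OF f_rv[OF assms]])
  show "\<bar>f j t (x i t \<omega>)\<bar> \<le> \<bar>f j t 0\<bar> + F" if "\<omega> \<in> space \<Omega>" for \<omega>
    using f_bound[OF assms x_X[OF that assms] zero_X, of j i] by linarith
qed

lemma g_pos_bounds:
  assumes "\<omega> \<in> space \<Omega>" "1 \<le> t" "k < m j"
  shows "0 \<le> max 0 (g j t (x i t \<omega>) k)" "max 0 (g j t (x i t \<omega>) k) \<le> F"
  using g_bound[OF assms(2) x_X[OF assms(1,2), of i] assms(3)] F by auto

lemma qg_integrable:
  assumes t: "1 \<le> t" and k: "k < m i"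
  shows "integrable \<Omega> (\<lambda>\<omega>. weighted_g i t k \<omega>)"
proof (rule integrable_bounded)
  show "(\<lambda>\<omega>. weighted_g i t k \<omega>) \<in> borel_measurable \<Omega>"
    by (intro borel_measurable_times q_rv g_rv t k)
  show "\<bar>weighted_g i t k \<omega>\<bar> \<le> (B * real t powr \<kappa>) * F" if \<omega>: "\<omega> \<in> space \<Omega>" for \<omega>
    unfolding abs_mult using q_nonneg[OF \<omega> t k] q_le[OF \<omega> t k] g_pos_bounds[OF \<omega> t k, of i] F
    by (intro mult_mono) auto
qed

lemma q_integrable:
  assumes t: "1 \<le> t" and k: "k < m i"
  shows "integrable \<Omega> (\<lambda>\<omega>. q i t \<omega> k)"
  by (rule integrable_bounded[OF q_rv[OF t k], where K = "B * real t powr \<kappa>"]) (use q_nonneg q_le t k in auto)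

lemma dist_bound: "\<omega> \<in> space \<Omega> \<Longrightarrow> 1 \<le> t \<Longrightarrow> c \<in> X \<Longrightarrow> norm (x i t \<omega> - c) \<le> 2 * R"
  by (intro norm_diff_X x_X)

lemma df_inner_integrable:
  assumes t: "1 \<le> t" and c: "c \<in> X"
  shows "integrable \<Omega> (\<lambda>\<omega>. df i t \<omega> \<bullet> (x i t \<omega> - c))"
proof (rule integrable_bounded)
  show "(\<lambda>\<omega>. df i t \<omega> \<bullet> (x i t \<omega> - c)) \<in> borel_measurable \<Omega>"
    by (intro borel_measurable_inner borel_measurable_diff df_rv x_rv t borel_measurable_const)
  show "\<bar>df i t \<omega> \<bullet> (x i t \<omega> - c)\<bar> \<le> G * (2 * R)" if \<omega>: "\<omega> \<in> space \<Omega>" for \<omega>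
    by (rule order.trans[OF Cauchy_Schwarz_ineq2]) (intro mult_mono df_bound dist_bound \<omega> t c G_nonneg norm_ge_zero)
qed

lemma dg_inner_integrable:
  assumes t: "1 \<le> t" and k: "k < m i" and c: "c \<in> X"
  shows "integrable \<Omega> (\<lambda>\<omega>. weighted_dg i t k c \<omega>)"
proof (rule integrable_bounded)
  show "(\<lambda>\<omega>. weighted_dg i t k c \<omega>) \<in> borel_measurable \<Omega>"
    by (intro borel_measurable_times borel_measurable_inner borel_measurable_diff q_rv dg_rv x_rv t k borel_measurable_const)
  show "\<bar>weighted_dg i t k c \<omega>\<bar> \<le> (B * real t powr \<kappa>) * (G * (2 * R))"
    if \<omega>: "\<omega> \<in> space \<Omega>" for \<omega>
  proof -
    have "\<bar>dg i t k \<omega> \<bullet> (x i t \<omega> - c)\<bar> \<le> G * (2 * R)"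
      by (rule order.trans[OF Cauchy_Schwarz_ineq2]) (intro mult_mono dg_bound dist_bound \<omega> t k c G_nonneg norm_ge_zero)
    then show ?thesis
      unfolding abs_mult using q_nonneg[OF \<omega> t k] q_le[OF \<omega> t k] by (intro mult_mono) auto
  qed
qed

lemma df_expectation:
  assumes t: "1 \<le> t" and c: "c \<in> shrunk t"
  shows "expected_loss i t - f i t c - 2 * L * \<delta> t \<le> (\<integral>\<omega>. df i t \<omega> \<bullet> (x i t \<omega> - c) \<partial>\<Omega>)"
proof -
  have "(\<integral>\<omega>. 1 * (f i t (x i t \<omega>) - f i t c - 2 * L * \<delta> t) \<partial>\<Omega>)
      \<le> (\<integral>\<omega>. 1 * (grad_est (\<delta> t) (f i t) (x i t \<omega>) (u i t \<omega>) \<bullet> (x i t \<omega> - c)) \<partial>\<Omega>)"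
  proof (rule integral_grad_est_weighted[where F = "\<F> t" and K = 1 and R = R, OF space_past id_\<F> u_rv[OF t]
        distr_past_Pair[OF u_indep t] u_uniform[OF t] u_sphere[OF t] state_measurable(1)[OF t] _ _ _ X X_ball
        conv_f[OF t] lip_f[OF t] L delta_pos[OF t] cball_shrunk[OF t x_shrunk[OF _ t]] cball_shrunk[OF t c]])
  qed simp_all
  then show ?thesis
    using f_integrable[OF t, of i i] by (simp add: df_def prob_space)
qed

text \<open>The weight is the dual variable at time \<open>t\<close>, which is nonnegative and
  depends on directions before \<open>t\<close> only, as \<open>integral_grad_est_weighted\<close>
  requires.\<close>

lemma dg_expectation:
  assumes t: "1 \<le> t" and k: "k < m i" and c: "c \<in> shrunk t"
  shows "(\<integral>\<omega>. q i t \<omega> k * (max 0 (g i t (x i t \<omega>) k) - max 0 (g i t c k) - 2 * L * \<delta> t) \<partial>\<Omega>)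
    \<le> (\<integral>\<omega>. weighted_dg i t k c \<omega> \<partial>\<Omega>)"
  unfolding dg_def
proof (rule integral_grad_est_weighted[where F = "\<F> t" and K = "B * real t powr \<kappa>" and R = R, OF space_past id_\<F> u_rv[OF t]
      distr_past_Pair[OF u_indep t] u_uniform[OF t] u_sphere[OF t] state_measurable(1)[OF t] state_measurable(3)[OF t k]
      q_nonneg[OF _ t k] q_le[OF _ t k] X X_ball
      convex_on_pos_part[OF conv_g[OF t k]] lip_pos_g[OF t _ _ k] L delta_pos[OF t] cball_shrunk[OF t x_shrunk[OF _ t]] cball_shrunk[OF t c]])
qed assumption+

text \<open>Per function, \<open>L * R\<close> is the cost of shrinking the comparator and
  \<open>2 * L * r\<close> that of the positive radius, both in units of \<xi>. Constraints count
  with the factor \<open>B\<close> of their dual weight.\<close>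

definition bias_const :: real where "bias_const = (N + M * B) * (L * R + 2 * L * r)"

lemma bias_const_nonneg: "0 \<le> bias_const"
  unfolding bias_const_def using N_ge_1 M_nonneg B_nonneg L R r by simp

text \<open>The comparator is shrunk for its ball to fit into \<open>X\<close>, so its constraints
  hold only up to \<open>L * R * \<xi> t\<close>. Multiplied by a dual variable of at most
  \<open>B * real t powr \<kappa>\<close>, with \<xi> at most 1 / t, this costs the order
  \<open>real t powr (\<kappa> - 1)\<close>.\<close>

lemma gap_expectation:
  assumes t: "1 \<le> t" and y: "y \<in> X" "\<And>i k. k < m i \<Longrightarrow> g i t y k \<le> 0"
  defines "c \<equiv> (1 - \<xi> t) *\<^sub>R y"
  shows "integrable \<Omega> (gap t c)"
    and "(\<Sum>i\<in>UNIV. expected_loss i t - f i t y) - bias_const * real t powr (\<kappa> - 1) \<le> (\<integral>\<omega>. gap t c \<omega> \<partial>\<Omega>)"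
proof -
  let ?e = "(L * R + 2 * L * r) * \<xi> t"
  have cs: "c \<in> shrunk t" unfolding c_def shrunk_def using y(1) by blast
  have cX: "c \<in> X" using cs shrunk_subset_X[OF t] by blast
  have xi0: "0 < \<xi> t" "\<xi> t < 1" using xi_bounds t by auto
  have LR: "0 \<le> L * R + 2 * L * r" using L R r by simp
  have "norm (c - y) = \<xi> t * norm y"
    using xi0 by (simp add: c_def scaleR_left_diff_distrib)
  also have "\<dots> \<le> \<xi> t * R"
    using xi0 norm_X[OF y(1)] by (intro mult_left_mono) auto
  finally have "L * norm (c - y) \<le> L * (\<xi> t * R)"
    by (rule mult_left_mono) (rule L)
  then have cy: "L * norm (c - y) \<le> L * R * \<xi> t"
    by (simp only: mult_ac)
  have split: "gap t c \<omega> = (\<Sum>i\<in>UNIV. df i t \<omega> \<bullet> (x i t \<omega> - c)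
      + (\<Sum>k<m i. weighted_dg i t k c \<omega> - weighted_g i t k \<omega>))" for \<omega>
    unfolding gap_def om_def
    by (rule sum.cong[OF refl]) (simp add: inner_add_left inner_sum_left sum_subtractf)
  note ints = df_inner_integrable[OF t cX] dg_inner_integrable[OF t _ cX] qg_integrable[OF t]
  show "integrable \<Omega> (gap t c)"
    unfolding split[abs_def]
    by (intro Bochner_Integration.integrable_add Bochner_Integration.integrable_diff Bochner_Integration.integrable_sum ints) auto
  have eq: "(\<integral>\<omega>. gap t c \<omega> \<partial>\<Omega>) = (\<Sum>i\<in>UNIV. (\<integral>\<omega>. df i t \<omega> \<bullet> (x i t \<omega> - c) \<partial>\<Omega>)
      + (\<Sum>k<m i. (\<integral>\<omega>. weighted_dg i t k c \<omega> \<partial>\<Omega>) - (\<integral>\<omega>. weighted_g i t k \<omega> \<partial>\<Omega>)))"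
  proof -
    have in1: "integrable \<Omega> (\<lambda>\<omega>. \<Sum>k<m i. weighted_dg i t k c \<omega> - weighted_g i t k \<omega>)" for i
      by (intro Bochner_Integration.integrable_diff Bochner_Integration.integrable_sum ints) auto
    have "(\<integral>\<omega>. gap t c \<omega> \<partial>\<Omega>) = (\<Sum>i\<in>UNIV. \<integral>\<omega>. df i t \<omega> \<bullet> (x i t \<omega> - c)
      + (\<Sum>k<m i. weighted_dg i t k c \<omega> - weighted_g i t k \<omega>) \<partial>\<Omega>)"
      unfolding split by (rule Bochner_Integration.integral_sum) (intro Bochner_Integration.integrable_add ints in1)
    also have "\<dots> = (\<Sum>i\<in>UNIV. (\<integral>\<omega>. df i t \<omega> \<bullet> (x i t \<omega> - c) \<partial>\<Omega>)
      + (\<integral>\<omega>. (\<Sum>k<m i. weighted_dg i t k c \<omega> - weighted_g i t k \<omega>) \<partial>\<Omega>))"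
      by (intro sum.cong refl Bochner_Integration.integral_add ints in1)
    also have "(\<lambda>i. \<integral>\<omega>. (\<Sum>k<m i. weighted_dg i t k c \<omega> - weighted_g i t k \<omega>) \<partial>\<Omega>)
      = (\<lambda>i. \<Sum>k<m i. (\<integral>\<omega>. weighted_dg i t k c \<omega> \<partial>\<Omega>) - (\<integral>\<omega>. weighted_g i t k \<omega> \<partial>\<Omega>))"
    proof
      fix i
      have "(\<integral>\<omega>. (\<Sum>k<m i. weighted_dg i t k c \<omega> - weighted_g i t k \<omega>) \<partial>\<Omega>)
        = (\<Sum>k<m i. \<integral>\<omega>. weighted_dg i t k c \<omega> - weighted_g i t k \<omega> \<partial>\<Omega>)"
        by (rule Bochner_Integration.integral_sum) (auto intro!: Bochner_Integration.integrable_diff ints)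
      also have "\<dots> = (\<Sum>k<m i. (\<integral>\<omega>. weighted_dg i t k c \<omega> \<partial>\<Omega>) - (\<integral>\<omega>. weighted_g i t k \<omega> \<partial>\<Omega>))"
        by (rule sum.cong[OF refl]) (auto intro!: Bochner_Integration.integral_diff ints)
      finally show "(\<integral>\<omega>. (\<Sum>k<m i. weighted_dg i t k c \<omega> - weighted_g i t k \<omega>) \<partial>\<Omega>)
        = (\<Sum>k<m i. (\<integral>\<omega>. weighted_dg i t k c \<omega> \<partial>\<Omega>) - (\<integral>\<omega>. weighted_g i t k \<omega> \<partial>\<Omega>))" .
    qed
    finally show ?thesis .
  qed
  have dl: "2 * L * \<delta> t = 2 * L * r * \<xi> t" by (simp add: delta_eq[OF t])
  have fi: "expected_loss i t - f i t y - ?e \<le> (\<integral>\<omega>. df i t \<omega> \<bullet> (x i t \<omega> - c) \<partial>\<Omega>)" for i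
  proof -
    have "f i t c \<le> f i t y + L * R * \<xi> t"
      using lip_f[OF t cX y(1), of i] cy by linarith
    moreover have "?e = L * R * \<xi> t + 2 * L * r * \<xi> t" by (simp add: algebra_simps)
    ultimately show ?thesis using df_expectation[OF t cs, of i] dl by linarith
  qed
  have gi: "- (B * real t powr \<kappa> * ?e) \<le> (\<integral>\<omega>. weighted_dg i t k c \<omega> \<partial>\<Omega>) - (\<integral>\<omega>. weighted_g i t k \<omega> \<partial>\<Omega>)"
    if k: "k < m i" for i k
  proof -
    \<comment> \<open>The positive part at the shrunk comparator plus the bias of the estimate,
      together at most \<open>?e\<close>.\<close>
    define a where "a = max 0 (g i t c k) + 2 * L * \<delta> t"
    have "g i t c k \<le> L * R * \<xi> t"
      using lip_g[OF t cX y(1) k] y(2)[OF k] cy by linarith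
    moreover have "0 \<le> L * R * \<xi> t" using L R xi0 by simp
    moreover have "?e = L * R * \<xi> t + 2 * L * r * \<xi> t" by (simp add: algebra_simps)
    moreover have "0 \<le> 2 * L * r * \<xi> t" using L r xi0 by simp
    ultimately have a: "0 \<le> a" "a \<le> ?e"
      unfolding a_def dl by auto
    have "(\<integral>\<omega>. q i t \<omega> k * (max 0 (g i t (x i t \<omega>) k) - max 0 (g i t c k) - 2 * L * \<delta> t) \<partial>\<Omega>)
        = (\<integral>\<omega>. weighted_g i t k \<omega> - a * q i t \<omega> k \<partial>\<Omega>)"
      by (rule Bochner_Integration.integral_cong[OF refl]) (simp add: a_def algebra_simps)
    also have "\<dots> = (\<integral>\<omega>. weighted_g i t k \<omega> \<partial>\<Omega>) - a * (\<integral>\<omega>. q i t \<omega> k \<partial>\<Omega>)"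
      using qg_integrable[OF t k] q_integrable[OF t k] by simp
    finally have 1: "(\<integral>\<omega>. weighted_g i t k \<omega> \<partial>\<Omega>) - a * (\<integral>\<omega>. q i t \<omega> k \<partial>\<Omega>)
        \<le> (\<integral>\<omega>. weighted_dg i t k c \<omega> \<partial>\<Omega>)"
      using dg_expectation[OF t k cs] by simp
    have "(\<integral>\<omega>. q i t \<omega> k \<partial>\<Omega>) \<le> (\<integral>\<omega>. B * real t powr \<kappa> \<partial>\<Omega>)"
      by (rule Bochner_Integration.integral_mono[OF q_integrable[OF t k]]) (use q_le[OF _ t k] in auto)
    then have q1: "(\<integral>\<omega>. q i t \<omega> k \<partial>\<Omega>) \<le> B * real t powr \<kappa>"
      by (simp add: prob_space)
    have "a * (\<integral>\<omega>. q i t \<omega> k \<partial>\<Omega>) \<le> a * (B * real t powr \<kappa>)"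
      by (intro mult_left_mono q1 a)
    also have "\<dots> \<le> ?e * (B * real t powr \<kappa>)"
      using a B_nonneg by (intro mult_right_mono) auto
    finally show ?thesis using 1 by (simp add: mult_ac)
  qed
  have xt: "\<xi> t \<le> real t powr (\<kappa> - 1)" "real t powr \<kappa> * \<xi> t \<le> real t powr (\<kappa> - 1)"
  proof -
    have x1: "\<xi> t \<le> real t powr (-1)"
      using t by (simp add: xi powr_minus_divide frac_le)
    also have "\<dots> \<le> real t powr (\<kappa> - 1)"
      using t kappa by (intro powr_mono) auto
    finally show "\<xi> t \<le> real t powr (\<kappa> - 1)" .
    have "real t powr \<kappa> * \<xi> t \<le> real t powr \<kappa> * real t powr (-1)"
      by (intro mult_left_mono x1) simp
    also have "\<dots> = real t powr (\<kappa> + -1)"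
      by (simp only: powr_add)
    finally show "real t powr \<kappa> * \<xi> t \<le> real t powr (\<kappa> - 1)" by simp
  qed
  have "(\<Sum>i\<in>UNIV. (expected_loss i t - f i t y - ?e) + (\<Sum>k<m i. - (B * real t powr \<kappa> * ?e)))
      \<le> (\<integral>\<omega>. gap t c \<omega> \<partial>\<Omega>)"
    unfolding eq by (intro sum_mono add_mono fi gi) auto
  also have "(\<Sum>i\<in>UNIV. (expected_loss i t - f i t y - ?e) + (\<Sum>k<m i. - (B * real t powr \<kappa> * ?e)))
      = (\<Sum>i\<in>UNIV. expected_loss i t - f i t y) - (N * ?e + M * (B * real t powr \<kappa> * ?e))"
    unfolding sum.distrib sum_subtractf[of _ "\<lambda>_. ?e"] by (simp add: N_def M_def sum_negf flip: sum_distrib_right)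
  finally have *: "(\<Sum>i\<in>UNIV. expected_loss i t - f i t y) - (N * ?e + M * (B * real t powr \<kappa> * ?e)) \<le> (\<integral>\<omega>. gap t c \<omega> \<partial>\<Omega>)" .
  have "N * ?e + M * (B * real t powr \<kappa> * ?e)
      = N * (L * R + 2 * L * r) * \<xi> t + M * B * (L * R + 2 * L * r) * (real t powr \<kappa> * \<xi> t)"
    by (simp only: mult_ac)
  also have "\<dots> \<le> N * (L * R + 2 * L * r) * real t powr (\<kappa> - 1) + M * B * (L * R + 2 * L * r) * real t powr (\<kappa> - 1)"
    using LR N_ge_1 M_nonneg B_nonneg by (intro add_mono mult_left_mono xt) auto
  also have "\<dots> = bias_const * real t powr (\<kappa> - 1)"
    by (simp add: bias_const_def algebra_simps)
  finally show "(\<Sum>i\<in>UNIV. expected_loss i t - f i t y) - bias_const * real t powr (\<kappa> - 1) \<le> (\<integral>\<omega>. gap t c \<omega> \<partial>\<Omega>)"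
    using * by linarith
qed

text \<open>\<open>R / \<tau> 1\<close> stems from the length \<open>R\<close> that shrinking may
  add to the path, \<open>bias_const / \<kappa>\<close> from summing the biases.\<close>

definition regret_const :: real where "regret_const = energy_const * (1 + R / \<tau> 1) + bias_const / \<kappa>"
text \<open>\<open>N * F\<close> limits how far the losses of a round can fall below those of the
  comparator; \<open>1 + sqrt (\<tau> 1)\<close> bounds the static regret rate by a multiple of
  \<open>T\<close>.\<close>

definition growth_const :: real where "growth_const = N * F + regret_const * (1 + sqrt (\<tau> 1))"

lemma energy_const_nonneg: "0 \<le> energy_const"
proof -
  have "0 \<le> A" using N_ge_1 G_nonneg L Cd by (simp add: A_def)
  then show ?thesis
    unfolding energy_const_def using kappa N_ge_1 G_nonneg M_nonneg L Cd R tau_pos[of 1] by simp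
qed

lemma regret_const_nonneg: "0 \<le> regret_const"
  unfolding regret_const_def using energy_const_nonneg bias_const_nonneg R kappa tau_pos[of 1] by simp

text \<open>The change of the scaling factor moves the comparator by at most \<open>R\<close> times
  the decrease of \<xi>, and these decreases telescope to less than 1.\<close>

lemma shrunk_path_le:
  assumes T: "1 \<le> T" and y: "\<And>t. t \<in> {1..T} \<Longrightarrow> y t \<in> X"
  shows "(\<Sum>t=1..<T. norm ((1 - \<xi> (Suc t)) *\<^sub>R y (Suc t) - (1 - \<xi> t) *\<^sub>R y t)) \<le> path_length T y + R"
proof -
  have "(\<Sum>t=1..<T. norm ((1 - \<xi> (Suc t)) *\<^sub>R y (Suc t) - (1 - \<xi> t) *\<^sub>R y t))
      \<le> (\<Sum>t=1..<T. norm (y (t + 1) - y t) + R * (\<xi> t - \<xi> (Suc t)))"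
  proof (rule sum_mono)
    fix t assume t: "t \<in> {1..<T}"
    have x: "0 < \<xi> (Suc t)" "\<xi> (Suc t) < 1" "\<xi> (Suc t) \<le> \<xi> t"
      using xi_bounds[of "Suc t"] xi_antimono[of t "Suc t"] t by auto
    have "(1 - \<xi> (Suc t)) *\<^sub>R y (Suc t) - (1 - \<xi> t) *\<^sub>R y t
        = (1 - \<xi> (Suc t)) *\<^sub>R (y (Suc t) - y t) + (\<xi> t - \<xi> (Suc t)) *\<^sub>R y t"
      by (simp add: algebra_simps)
    then have "norm ((1 - \<xi> (Suc t)) *\<^sub>R y (Suc t) - (1 - \<xi> t) *\<^sub>R y t)
        \<le> (1 - \<xi> (Suc t)) * norm (y (Suc t) - y t) + (\<xi> t - \<xi> (Suc t)) * norm (y t)"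
      using norm_triangle_ineq[of "(1 - \<xi> (Suc t)) *\<^sub>R (y (Suc t) - y t)" "(\<xi> t - \<xi> (Suc t)) *\<^sub>R y t"] x by simp
    also have "\<dots> \<le> 1 * norm (y (Suc t) - y t) + (\<xi> t - \<xi> (Suc t)) * R"
      using x norm_X[OF y[of t]] t by (intro add_mono mult_right_mono mult_left_mono) auto
    finally show "norm ((1 - \<xi> (Suc t)) *\<^sub>R y (Suc t) - (1 - \<xi> t) *\<^sub>R y t)
        \<le> norm (y (t + 1) - y t) + R * (\<xi> t - \<xi> (Suc t))"
      by (simp add: mult.commute)
  qed
  also have "\<dots> = path_length T y + R * (\<Sum>t=1..<T. \<xi> t - \<xi> (Suc t))"
    by (simp only: sum.distrib path_length_def sum_distrib_left)
  also have "(\<Sum>t=1..<T. \<xi> t - \<xi> (Suc t)) = \<xi> 1 - \<xi> T"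
    using T by (induction rule: dec_induct) auto
  also have "R * (\<xi> 1 - \<xi> T) \<le> R * 1"
    using R xi_bounds[of 1] xi_bounds[of T] T by (intro mult_left_mono) auto
  finally show ?thesis by simp
qed

text \<open>The integral of \<open>pathwise_energy\<close> at the shrunk comparators, with
  \<open>gap_expectation\<close> inserted round by round; the biases sum to at most
  \<open>bias_const * (real T powr \<kappa> / \<kappa>)\<close>.\<close>

lemma expected_energy:
  assumes T: "1 \<le> T" and y: "y \<in> feasible_seqs X m g T"
  shows "(\<Sum>t=1..T. \<Sum>i\<in>UNIV. expected_loss i t - f i t (y t))
      + N * L * (\<Sum>t=1..T. (\<integral>\<omega>. D t \<omega> \<partial>\<Omega>)) + (\<integral>\<omega>. S T \<omega> \<partial>\<Omega>)
    \<le> regret_const * (real T powr \<kappa> + rate T + path T * path_length T y)"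
proof -
  define c where "c t = (1 - \<xi> t) *\<^sub>R y t" for t
  define P where "P = (\<Sum>t=1..<T. norm (c (Suc t) - c t))"
  have yX: "y t \<in> X" and yg: "\<And>i k. k < m i \<Longrightarrow> g i t (y t) k \<le> 0" if "t \<in> {1..T}" for t
    using y that unfolding feasible_seqs_def by blast+
  have gap: "integrable \<Omega> (gap t (c t))"
    "(\<Sum>i\<in>UNIV. expected_loss i t - f i t (y t)) - bias_const * real t powr (\<kappa> - 1) \<le> (\<integral>\<omega>. gap t (c t) \<omega> \<partial>\<Omega>)"
    if t: "t \<in> {1..T}" for t
    unfolding c_def using gap_expectation[OF _ yX[OF t] yg[OF t]] t by auto
  have cs: "c t \<in> shrunk t" if "t \<in> {1..T}" for t
    unfolding c_def shrunk_def using yX[OF that] by blast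
  have int1: "integrable \<Omega> (\<lambda>\<omega>. \<Sum>t=1..T. gap t (c t) \<omega>)"
    by (rule Bochner_Integration.integrable_sum) (rule gap(1))
  have int2: "integrable \<Omega> (\<lambda>\<omega>. \<Sum>t=1..T. D t \<omega>)"
    by (rule Bochner_Integration.integrable_sum) (rule D_integrable, simp)
  have "(\<integral>\<omega>. (\<Sum>t=1..T. gap t (c t) \<omega>) + N * L * (\<Sum>t=1..T. D t \<omega>) + S T \<omega> \<partial>\<Omega>)
      \<le> (\<integral>\<omega>. energy_const * (real T powr \<kappa> + rate T + path T * P) \<partial>\<Omega>)"
  proof (rule Bochner_Integration.integral_mono)
    show "integrable \<Omega> (\<lambda>\<omega>. (\<Sum>t=1..T. gap t (c t) \<omega>) + N * L * (\<Sum>t=1..T. D t \<omega>) + S T \<omega>)"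
      by (intro Bochner_Integration.integrable_add integrable_mult_right int1 int2 S_integrable)
    show "(\<Sum>t=1..T. gap t (c t) \<omega>) + N * L * (\<Sum>t=1..T. D t \<omega>) + S T \<omega>
        \<le> energy_const * (real T powr \<kappa> + rate T + path T * P)" if "\<omega> \<in> space \<Omega>" for \<omega>
      unfolding P_def by (rule pathwise_energy[OF that T cs])
  qed simp
  also have "\<dots> = energy_const * (real T powr \<kappa> + rate T + path T * P)"
    by (simp add: prob_space)
  also have "(\<integral>\<omega>. (\<Sum>t=1..T. gap t (c t) \<omega>) + N * L * (\<Sum>t=1..T. D t \<omega>) + S T \<omega> \<partial>\<Omega>)
      = (\<Sum>t=1..T. \<integral>\<omega>. gap t (c t) \<omega> \<partial>\<Omega>) + N * L * (\<Sum>t=1..T. \<integral>\<omega>. D t \<omega> \<partial>\<Omega>) + (\<integral>\<omega>. S T \<omega> \<partial>\<Omega>)"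
  proof -
    have "(\<integral>\<omega>. (\<Sum>t=1..T. gap t (c t) \<omega>) \<partial>\<Omega>) = (\<Sum>t=1..T. \<integral>\<omega>. gap t (c t) \<omega> \<partial>\<Omega>)"
      by (rule Bochner_Integration.integral_sum) (rule gap(1))
    moreover have "(\<integral>\<omega>. (\<Sum>t=1..T. D t \<omega>) \<partial>\<Omega>) = (\<Sum>t=1..T. \<integral>\<omega>. D t \<omega> \<partial>\<Omega>)"
      by (rule Bochner_Integration.integral_sum) (rule D_integrable, simp)
    ultimately show ?thesis
      using int1 int2 S_integrable[of T] by simp
  qed
  finally have 1: "(\<Sum>t=1..T. \<integral>\<omega>. gap t (c t) \<omega> \<partial>\<Omega>) + N * L * (\<Sum>t=1..T. \<integral>\<omega>. D t \<omega> \<partial>\<Omega>) + (\<integral>\<omega>. S T \<omega> \<partial>\<Omega>)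
      \<le> energy_const * (real T powr \<kappa> + rate T + path T * P)" .
  have "(\<Sum>t=1..T. \<Sum>i\<in>UNIV. expected_loss i t - f i t (y t)) - bias_const * (\<Sum>t=1..T. real t powr (\<kappa> - 1))
      = (\<Sum>t=1..T. (\<Sum>i\<in>UNIV. expected_loss i t - f i t (y t)) - bias_const * real t powr (\<kappa> - 1))"
    by (simp only: sum_subtractf sum_distrib_left)
  also have "\<dots> \<le> (\<Sum>t=1..T. \<integral>\<omega>. gap t (c t) \<omega> \<partial>\<Omega>)"
    by (intro sum_mono gap(2))
  finally have 2: "(\<Sum>t=1..T. \<Sum>i\<in>UNIV. expected_loss i t - f i t (y t)) - bias_const * (\<Sum>t=1..T. real t powr (\<kappa> - 1))
      \<le> (\<Sum>t=1..T. \<integral>\<omega>. gap t (c t) \<omega> \<partial>\<Omega>)" .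
  have 3: "bias_const * (\<Sum>t=1..T. real t powr (\<kappa> - 1)) \<le> bias_const * (real T powr \<kappa> / \<kappa>)"
    using kappa by (intro mult_left_mono sum_powr_le bias_const_nonneg) auto
  have pl: "0 \<le> path_length T y"
    unfolding path_length_def by (intro sum_nonneg) simp
  have "path T * P \<le> path T * (path_length T y + R)"
    unfolding P_def c_def by (intro mult_left_mono shrunk_path_le T yX path_nonneg)
  also have "\<dots> = path T * path_length T y + R * path T"
    by (simp add: algebra_simps)
  also have "R * path T \<le> R * (rate T / \<tau> 1)"
    using R by (intro mult_left_mono path_le_rate T) auto
  finally have "real T powr \<kappa> + rate T + path T * P
      \<le> real T powr \<kappa> + rate T + path T * path_length T y + R / \<tau> 1 * rate T"
    by simp
  also have "\<dots> \<le> (1 + R / \<tau> 1) * (real T powr \<kappa> + rate T + path T * path_length T y)"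
  proof -
    have "0 \<le> R / \<tau> 1 * (real T powr \<kappa> + path T * path_length T y)"
      using R tau_pos[of 1] path_nonneg[of T] pl by simp
    then show ?thesis by (simp add: algebra_simps)
  qed
  finally have "energy_const * (real T powr \<kappa> + rate T + path T * P)
      \<le> energy_const * ((1 + R / \<tau> 1) * (real T powr \<kappa> + rate T + path T * path_length T y))"
    by (rule mult_left_mono) (rule energy_const_nonneg)
  moreover have "bias_const * (real T powr \<kappa> / \<kappa>) \<le> bias_const / \<kappa> * (real T powr \<kappa> + rate T + path T * path_length T y)"
  proof -
    have "bias_const / \<kappa> * real T powr \<kappa> \<le> bias_const / \<kappa> * (real T powr \<kappa> + rate T + path T * path_length T y)"
      using bias_const_nonneg kappa rate_nonneg[of T] path_nonneg[of T] pl by (intro mult_left_mono) auto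
    then show ?thesis by simp
  qed
  moreover have "regret_const * (real T powr \<kappa> + rate T + path T * path_length T y)
      = energy_const * ((1 + R / \<tau> 1) * (real T powr \<kappa> + rate T + path T * path_length T y))
        + bias_const / \<kappa> * (real T powr \<kappa> + rate T + path T * path_length T y)"
    unfolding regret_const_def by (simp only: distrib_right mult.assoc)
  ultimately show ?thesis using 1 2 3 by linarith
qed

text \<open>\<open>net_reg\<close> evaluates the loss of agent \<open>j\<close> at the point of
  agent \<open>i\<close>, the energy bound at the point of \<open>j\<close>. The exchange costs
  \<open>L\<close> times the disagreement, for which the term with \<open>N * L\<close> was held in
  reserve.\<close>

lemma expected_regret:
  assumes T: "1 \<le> T" and y: "y \<in> feasible_seqs X m g T"
  shows "integrable \<Omega> (\<lambda>\<omega>. net_reg f T (\<lambda>i t. x i t \<omega>) y)"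
    and "(\<integral>\<omega>. net_reg f T (\<lambda>i t. x i t \<omega>) y \<partial>\<Omega>) \<le> regret_const * (real T powr \<kappa> + rate T + path T * path_length T y)"
proof -
  let ?bound = "regret_const * (real T powr \<kappa> + rate T + path T * path_length T y)"
  define V where "V \<omega> = (\<Sum>t=1..T. \<Sum>j\<in>UNIV. f j t (x j t \<omega>) - f j t (y t)) + N * L * (\<Sum>t=1..T. D t \<omega>)" for \<omega>
  have N0: "0 < N" using N_ge_1 by simp
  show int: "integrable \<Omega> (\<lambda>\<omega>. net_reg f T (\<lambda>i t. x i t \<omega>) y)"
    unfolding net_reg_def global_loss_def
    by (intro Bochner_Integration.integrable_diff integrable_mult_right Bochner_Integration.integrable_sum f_integrable) auto
  have int_f: "integrable \<Omega> (\<lambda>\<omega>. f j t (x j t \<omega>) - f j t (y t))" if "t \<in> {1..T}" for j t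
    using that by (intro Bochner_Integration.integrable_diff f_integrable) auto
  have int1: "integrable \<Omega> (\<lambda>\<omega>. \<Sum>t=1..T. \<Sum>j\<in>UNIV. f j t (x j t \<omega>) - f j t (y t))"
    by (intro Bochner_Integration.integrable_sum int_f)
  have int2: "integrable \<Omega> (\<lambda>\<omega>. \<Sum>t=1..T. D t \<omega>)"
    by (rule Bochner_Integration.integrable_sum) (rule D_integrable, simp)
  have intV: "integrable \<Omega> V"
    unfolding V_def[abs_def] by (intro Bochner_Integration.integrable_add integrable_mult_right int1 int2)
  have "net_reg f T (\<lambda>i t. x i t \<omega>) y \<le> 1 / N * V \<omega>" if \<omega>: "\<omega> \<in> space \<Omega>" for \<omega>
  proof -
    have "net_reg f T (\<lambda>i t. x i t \<omega>) y = 1 / N * (\<Sum>i\<in>UNIV. \<Sum>t=1..T. 1 / N * (\<Sum>j\<in>UNIV. f j t (x i t \<omega>)))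
        - (\<Sum>t=1..T. 1 / N * (\<Sum>j\<in>UNIV. f j t (y t)))"
      unfolding net_reg_def global_loss_def N_def ..
    also have "(\<Sum>i\<in>UNIV. \<Sum>t=1..T. 1 / N * (\<Sum>j\<in>UNIV. f j t (x i t \<omega>)))
        \<le> (\<Sum>i\<in>(UNIV::'n set). \<Sum>t=1..T. 1 / N * (\<Sum>j\<in>UNIV. f j t (x j t \<omega>) + L * D t \<omega>))"
    proof (intro sum_mono mult_left_mono)
      fix i j t assume "t \<in> {1..T}"
      then have t: "1 \<le> t" by simp
      have "\<bar>f j t (x i t \<omega>) - f j t (x j t \<omega>)\<bar> \<le> L * norm (x i t \<omega> - x j t \<omega>)"
        by (intro lip_f t x_X \<omega>)
      also have "\<dots> \<le> L * D t \<omega>"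
        unfolding D_def by (intro mult_left_mono L disagreement_ge[where v = "\<lambda>i. x i t \<omega>"])
      finally show "f j t (x i t \<omega>) \<le> f j t (x j t \<omega>) + L * D t \<omega>" by linarith
    qed (use N0 in simp)
    also have "\<dots> = N * (\<Sum>t=1..T. 1 / N * (\<Sum>j\<in>UNIV. f j t (x j t \<omega>) + L * D t \<omega>))"
      by (simp add: N_def)
    finally have "net_reg f T (\<lambda>i t. x i t \<omega>) y
        \<le> 1 / N * (N * (\<Sum>t=1..T. 1 / N * (\<Sum>j\<in>UNIV. f j t (x j t \<omega>) + L * D t \<omega>)))
        - (\<Sum>t=1..T. 1 / N * (\<Sum>j\<in>UNIV. f j t (y t)))"
      using N0 by (simp add: mult_left_mono divide_right_mono)
    also have "1 / N * (N * (\<Sum>t=1..T. 1 / N * (\<Sum>j\<in>UNIV. f j t (x j t \<omega>) + L * D t \<omega>)))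
        = (\<Sum>t=1..T. 1 / N * (\<Sum>j\<in>UNIV. f j t (x j t \<omega>) + L * D t \<omega>))"
      using N0 by simp
    also have "(\<Sum>t=1..T. 1 / N * (\<Sum>j\<in>UNIV. f j t (x j t \<omega>) + L * D t \<omega>)) - (\<Sum>t=1..T. 1 / N * (\<Sum>j\<in>UNIV. f j t (y t)))
        = 1 / N * V \<omega>"
    proof -
      have e: "(\<Sum>t=1..T. \<Sum>j\<in>(UNIV::'n set). L * D t \<omega>) = N * L * (\<Sum>t=1..T. D t \<omega>)"
        by (simp add: N_def sum_distrib_left mult.assoc)
      have "(\<Sum>t=1..T. \<Sum>j\<in>UNIV. f j t (x j t \<omega>) + L * D t \<omega>) - (\<Sum>t=1..T. \<Sum>j\<in>UNIV. f j t (y t)) = V \<omega>"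
        unfolding V_def sum.distrib sum_subtractf e by simp
      then show ?thesis
        by (simp only: sum_distrib_left[symmetric] right_diff_distrib[symmetric])
    qed
    finally show ?thesis .
  qed
  then have "(\<integral>\<omega>. net_reg f T (\<lambda>i t. x i t \<omega>) y \<partial>\<Omega>) \<le> (\<integral>\<omega>. 1 / N * V \<omega> \<partial>\<Omega>)"
    by (intro Bochner_Integration.integral_mono int integrable_mult_right intV)
  also have "\<dots> = 1 / N * (\<integral>\<omega>. V \<omega> \<partial>\<Omega>)" by simp
  also have "(\<integral>\<omega>. V \<omega> \<partial>\<Omega>) = (\<Sum>t=1..T. \<Sum>j\<in>UNIV. expected_loss j t - f j t (y t))
      + N * L * (\<Sum>t=1..T. \<integral>\<omega>. D t \<omega> \<partial>\<Omega>)"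
  proof -
    have "(\<integral>\<omega>. (\<Sum>t=1..T. \<Sum>j\<in>UNIV. f j t (x j t \<omega>) - f j t (y t)) \<partial>\<Omega>)
        = (\<Sum>t=1..T. \<integral>\<omega>. (\<Sum>j\<in>UNIV. f j t (x j t \<omega>) - f j t (y t)) \<partial>\<Omega>)"
      by (rule Bochner_Integration.integral_sum) (intro Bochner_Integration.integrable_sum int_f)
    also have "\<dots> = (\<Sum>t=1..T. \<Sum>j\<in>UNIV. \<integral>\<omega>. f j t (x j t \<omega>) - f j t (y t) \<partial>\<Omega>)"
      by (intro sum.cong refl Bochner_Integration.integral_sum int_f)
    also have "\<dots> = (\<Sum>t=1..T. \<Sum>j\<in>UNIV. expected_loss j t - f j t (y t))"
    proof (intro sum.cong refl)
      fix t j assume "t \<in> {1..T}"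
      then have "integrable \<Omega> (\<lambda>\<omega>. f j t (x j t \<omega>))" by (intro f_integrable) simp
      then show "(\<integral>\<omega>. f j t (x j t \<omega>) - f j t (y t) \<partial>\<Omega>) = expected_loss j t - f j t (y t)"
        by (simp add: prob_space)
    qed
    moreover have "(\<integral>\<omega>. (\<Sum>t=1..T. D t \<omega>) \<partial>\<Omega>) = (\<Sum>t=1..T. \<integral>\<omega>. D t \<omega> \<partial>\<Omega>)"
      by (rule Bochner_Integration.integral_sum) (rule D_integrable, simp)
    ultimately show ?thesis
      unfolding V_def using int1 int2 by simp
  qed
  also have "\<dots> \<le> ?bound"
  proof -
    have "0 \<le> (\<integral>\<omega>. S T \<omega> \<partial>\<Omega>)"
      by (intro Bochner_Integration.integral_nonneg_AE AE_I2 S_nonneg)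
    then show ?thesis using expected_energy[OF T y] by linarith
  qed
  then have "1 / N * ((\<Sum>t=1..T. \<Sum>j\<in>UNIV. expected_loss j t - f j t (y t))
      + N * L * (\<Sum>t=1..T. \<integral>\<omega>. D t \<omega> \<partial>\<Omega>)) \<le> 1 / N * ?bound"
    using N0 by (intro mult_left_mono) auto
  also have "1 / N * ?bound \<le> 1 * ?bound"
  proof (rule mult_right_mono)
    show "1 / N \<le> 1" using N_ge_1 by simp
    have "0 \<le> path_length T y"
      unfolding path_length_def by (intro sum_nonneg) simp
    then show "0 \<le> ?bound"
      using regret_const_nonneg rate_nonneg[of T] path_nonneg[of T] by simp
  qed
  finally show "(\<integral>\<omega>. net_reg f T (\<lambda>i t. x i t \<omega>) y \<partial>\<Omega>) \<le> ?bound" by simp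
qed

text \<open>Losses vary by at most \<open>F\<close>, so the loss differences are at least
  \<open>- (N * F)\<close> per round and cannot offset a large energy. The path length of a static
  comparator is 0, and the remaining rates are at most linear in \<open>T\<close>.\<close>

lemma expected_S_le:
  assumes T: "1 \<le> T" and y: "(\<lambda>_. y) \<in> feasible_seqs X m g T"
  shows "(\<integral>\<omega>. S T \<omega> \<partial>\<Omega>) \<le> growth_const * real T"
proof -
  have yX: "y \<in> X" using y T unfolding feasible_seqs_def by auto
  have "- F \<le> expected_loss i t - f i t y" if "t \<in> {1..T}" for i t
  proof -
    have t: "1 \<le> t" using that by simp
    have "(\<integral>\<omega>. f i t y - F \<partial>\<Omega>) \<le> expected_loss i t"
    proof (rule Bochner_Integration.integral_mono[OF _ f_integrable[OF t]])
      show "f i t y - F \<le> f i t (x i t \<omega>)" if "\<omega> \<in> space \<Omega>" for \<omega>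
        using f_bound[OF t x_X[OF that t] yX, of i i] by linarith
    qed simp
    then show ?thesis by (simp add: prob_space)
  qed
  then have "(\<Sum>t=1..T. \<Sum>i\<in>(UNIV::'n set). - F) \<le> (\<Sum>t=1..T. \<Sum>i\<in>UNIV. expected_loss i t - f i t y)"
    by (intro sum_mono)
  then have 1: "- (N * F * real T) \<le> (\<Sum>t=1..T. \<Sum>i\<in>UNIV. expected_loss i t - f i t y)"
    by (simp add: N_def mult_ac)
  have 2: "0 \<le> N * L * (\<Sum>t=1..T. \<integral>\<omega>. D t \<omega> \<partial>\<Omega>)"
    using N_ge_1 L by (intro mult_nonneg_nonneg sum_nonneg Bochner_Integration.integral_nonneg_AE AE_I2 D_nonneg) auto
  have 3: "real T powr \<kappa> + rate T \<le> (1 + sqrt (\<tau> 1)) * real T"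
  proof -
    have "real T powr \<kappa> \<le> real T powr 1"
      using T kappa by (intro powr_mono) auto
    moreover have "rate T \<le> sqrt (\<tau> 1 * real T * real T)"
      unfolding rate_def by (intro real_sqrt_le_mono mult_right_mono Psi_le) simp
    then have "rate T \<le> sqrt (\<tau> 1) * real T"
      by (simp add: real_sqrt_mult mult.assoc)
    ultimately show ?thesis
      using T by (simp add: distrib_right)
  qed
  have "path_length T (\<lambda>_. y) = 0" by (simp add: path_length_def)
  then have "- (N * F * real T) + (\<integral>\<omega>. S T \<omega> \<partial>\<Omega>) \<le> regret_const * (real T powr \<kappa> + rate T)"
    using expected_energy[OF T y] 1 2 by simp
  also have "\<dots> \<le> regret_const * ((1 + sqrt (\<tau> 1)) * real T)"
    by (intro mult_left_mono 3 regret_const_nonneg)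
  finally show ?thesis
    by (simp add: growth_const_def algebra_simps)
qed

text \<open>An expected energy of order \<open>T\<close>, multiplied by the weights
  \<open>lam T\<close> and \<open>mu T\<close>, gives the two summands of
  \<open>viol\<close>.\<close>

lemma expected_violation:
  assumes T: "1 \<le> T" and y: "(\<lambda>_. y) \<in> feasible_seqs X m g T"
  shows "integrable \<Omega> (\<lambda>\<omega>. net_ccv m g T (\<lambda>i t. x i t \<omega>))"
    and "(\<integral>\<omega>. net_ccv m g T (\<lambda>i t. x i t \<omega>) \<partial>\<Omega>) \<le> (violation_const + growth_const * (1 + drift_const)) * viol T"
proof -
  let ?J = "SIGMA j:UNIV. {..<m j}"
  have L2: "integrable \<Omega> (\<lambda>\<omega>. L2_set (\<lambda>(j, k). max 0 (g j t (x i t \<omega>) k)) ?J)" if t: "1 \<le> t" for i t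
  proof (rule integrable_bounded)
    have "(\<lambda>\<omega>. sqrt (\<Sum>jk\<in>?J. (max 0 (g (fst jk) t (x i t \<omega>) (snd jk)))\<^sup>2)) \<in> borel_measurable \<Omega>"
    proof (rule measurable_compose[OF _ borel_measurable_sqrt], rule borel_measurable_sum)
      fix jk assume "jk \<in> ?J"
      then show "(\<lambda>\<omega>. (max 0 (g (fst jk) t (x i t \<omega>) (snd jk)))\<^sup>2) \<in> borel_measurable \<Omega>"
        by (intro borel_measurable_power g_rv t) auto
    qed
    then show "(\<lambda>\<omega>. L2_set (\<lambda>(j, k). max 0 (g j t (x i t \<omega>) k)) ?J) \<in> borel_measurable \<Omega>"
      by (simp add: L2_set_def case_prod_beta')
    show "\<bar>L2_set (\<lambda>(j, k). max 0 (g j t (x i t \<omega>) k)) ?J\<bar> \<le> (\<Sum>jk\<in>?J. F)" if \<omega>: "\<omega> \<in> space \<Omega>" for \<omega>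
    proof -
      have "L2_set (\<lambda>(j, k). max 0 (g j t (x i t \<omega>) k)) ?J \<le> (\<Sum>jk\<in>?J. (\<lambda>(j, k). max 0 (g j t (x i t \<omega>) k)) jk)"
        by (rule L2_set_le_sum) auto
      also have "\<dots> \<le> (\<Sum>jk\<in>?J. F)"
      proof (rule sum_mono)
        fix jk assume "jk \<in> ?J"
        then obtain j k where "jk = (j, k)" "k < m j" by auto
        then show "(\<lambda>(j, k). max 0 (g j t (x i t \<omega>) k)) jk \<le> F"
          using g_pos_bounds(2)[OF \<omega> t, of k j i] by simp
      qed
      finally show ?thesis by (simp add: abs_of_nonneg L2_set_nonneg)
    qed
  qed
  show int: "integrable \<Omega> (\<lambda>\<omega>. net_ccv m g T (\<lambda>i t. x i t \<omega>))"
    unfolding net_ccv_def by (intro integrable_mult_right Bochner_Integration.integrable_sum L2) simp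
  have "(\<integral>\<omega>. net_ccv m g T (\<lambda>i t. x i t \<omega>) \<partial>\<Omega>) \<le> (\<integral>\<omega>. violation_const * viol T + (lam T + drift_const * mu T) * S T \<omega> \<partial>\<Omega>)"
    by (rule Bochner_Integration.integral_mono[OF int _ pathwise_violation[OF _ T]])
      (intro Bochner_Integration.integrable_add integrable_mult_right S_integrable, simp_all)
  also have "\<dots> = violation_const * viol T + (lam T + drift_const * mu T) * (\<integral>\<omega>. S T \<omega> \<partial>\<Omega>)"
    using S_integrable[of T] by (simp add: prob_space)
  also have "(lam T + drift_const * mu T) * (\<integral>\<omega>. S T \<omega> \<partial>\<Omega>) \<le> (lam T + drift_const * mu T) * (growth_const * real T)"
    using lam_pos[OF T] mu_pos[OF T] drift_const_nonneg by (intro mult_left_mono expected_S_le[OF T y]) auto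
  also have "\<dots> = growth_const * (lam T * real T + drift_const * (mu T * real T))"
    by (simp add: algebra_simps)
  also have "\<dots> \<le> growth_const * ((1 + drift_const) * viol T)"
  proof (rule mult_left_mono)
    have v: "lam T * real T \<le> viol T" "mu T * real T \<le> viol T"
      unfolding lam_mult[OF T] mu_mult[OF T] viol_def by auto
    then have "drift_const * (mu T * real T) \<le> drift_const * viol T"
      by (intro mult_left_mono drift_const_nonneg)
    with v(1) show "lam T * real T + drift_const * (mu T * real T) \<le> (1 + drift_const) * viol T"
      by (simp add: distrib_right)
    show "0 \<le> growth_const"
      unfolding growth_const_def using N_ge_1 F regret_const_nonneg tau_pos[of 1] by simp
  qed
  finally show "(\<integral>\<omega>. net_ccv m g T (\<lambda>i t. x i t \<omega>) \<partial>\<Omega>) \<le> (violation_const + growth_const * (1 + drift_const)) * viol T"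
    by (simp add: algebra_simps)
qed

end

theorem theorem1:
  fixes X :: "(real ^ 'p) set" and r R :: real
    and m :: "'n::finite \<Rightarrow> nat"
    and f :: "'n \<Rightarrow> nat \<Rightarrow> real ^ 'p \<Rightarrow> real"
    and g :: "'n \<Rightarrow> nat \<Rightarrow> real ^ 'p \<Rightarrow> nat \<Rightarrow> real"
    and E :: "nat \<Rightarrow> ('n \<times> 'n) set" and W :: "nat \<Rightarrow> real ^ 'n ^ 'n"
    and \<tau> \<Psi> \<alpha> \<beta> \<gamma> \<xi> \<delta> :: "nat \<Rightarrow> real" and \<kappa> :: real
    and M :: "'w measure"
    and u x xh :: "'n \<Rightarrow> nat \<Rightarrow> 'w \<Rightarrow> real ^ 'p"
    and q :: "'n \<Rightarrow> nat \<Rightarrow> 'w \<Rightarrow> nat \<Rightarrow> real"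
    and x1 :: "'n \<Rightarrow> real ^ 'p"
  assumes problem: "convex_problem X r R m f g"
    and network: "mixing_network E W"
    and feasible: "feasibility X m g"
    and tau_pos: "\<And>t. t \<ge> 1 \<Longrightarrow> \<tau> t > 0"
    and tau_mono: "\<And>s t. 1 \<le> s \<Longrightarrow> s \<le> t \<Longrightarrow> \<tau> t \<le> \<tau> s"
    and Psi: "\<And>t. \<Psi> t = (\<Sum>k=1..t. \<tau> k)"
    and kappa: "0 < \<kappa>" "\<kappa> < 1"
    and alpha: "\<And>t. t \<ge> 1 \<Longrightarrow> \<alpha> t = sqrt (\<Psi> t / real t)"
    and beta: "\<And>t. t \<ge> 1 \<Longrightarrow> \<beta> t = 1 / real t powr \<kappa>"
    and gamma: "\<And>t. t \<ge> 1 \<Longrightarrow> \<gamma> t = 1 / real t powr (1 - \<kappa>)"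
    and xi: "\<And>t. t \<ge> 1 \<Longrightarrow> \<xi> t = 1 / (real t + 1)"
    and delta: "\<And>t. t \<ge> 1 \<Longrightarrow> \<delta> t = r / (real t + 1)"
    and prob: "prob_space M"
    and u_sphere: "\<And>i t \<omega>. t \<ge> 1 \<Longrightarrow> \<omega> \<in> space M \<Longrightarrow> u i t \<omega> \<in> sphere 0 1"
    and u_uniform: "\<And>i t. t \<ge> 1 \<Longrightarrow> distr M borel (u i t) = sphere_uniform"
    and u_indep: "prob_space.indep_vars M (\<lambda>_. borel) (\<lambda>(i, t). u i t) (UNIV \<times> {1..})"
    and init: "\<And>i. x1 i \<in> (\<lambda>v. (1 - \<xi> 1) *\<^sub>R v) ` X"
    and algorithm: "\<And>\<omega>. \<omega> \<in> space M \<Longrightarrow>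
      generated X m f g W \<alpha> \<beta> \<gamma> \<tau> \<xi> \<delta> x1
        (\<lambda>i t. u i t \<omega>) (\<lambda>i t. x i t \<omega>) (\<lambda>i t. xh i t \<omega>) (\<lambda>i t. q i t \<omega>)"
  shows "(\<exists>C. \<forall>T\<ge>1. \<forall>y\<in>feasible_seqs X m g T.
      integrable M (\<lambda>\<omega>. net_reg f T (\<lambda>i t. x i t \<omega>) y) \<and>
      (\<integral>\<omega>. net_reg f T (\<lambda>i t. x i t \<omega>) y \<partial>M)
        \<le> C * (real T powr \<kappa> + sqrt (\<Psi> T * real T)
               + sqrt (inverse (\<Psi> T) * real T) * path_length T y)) \<and>
    (\<exists>C. \<forall>T\<ge>1.
      integrable M (\<lambda>\<omega>. net_ccv m g T (\<lambda>i t. x i t \<omega>)) \<and>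
      (\<integral>\<omega>. net_ccv m g T (\<lambda>i t. x i t \<omega>) \<partial>M)
        \<le> C * (real T powr (1 - \<kappa> / 2) + \<Psi> T powr (1 / 4) * real T powr (3 / 4)))"
proof -
  from problem have X: "convex X" "closed X" "0 < r" "0 < R" "cball 0 r \<subseteq> X" "X \<subseteq> cball 0 R"
    and conv_f: "\<forall>i. \<forall>t\<ge>1. convex_on X (f i t)"
    and conv_g: "\<forall>i. \<forall>t\<ge>1. \<forall>k<m i. convex_on X (\<lambda>x. g i t x k)"
    unfolding convex_problem_def by blast+
  from problem obtain F1 where F1: "\<forall>i. \<forall>t\<ge>1. \<forall>x\<in>X. \<forall>y\<in>X. \<bar>f i t x - f i t y\<bar> \<le> F1 \<and> L2_set (g i t x) {..<m i} \<le> F1"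
    unfolding convex_problem_def by blast
  from problem obtain L where L: "\<forall>i. \<forall>t\<ge>1. \<forall>x\<in>X. (\<exists>s. subgradient_on X (f i t) x s \<and> norm s \<le> L) \<and>
      (\<exists>G. (\<forall>k<m i. subgradient_on X (\<lambda>y. g i t y k) x (G k)) \<and> spectral_norm (m i) G \<le> L)"
    unfolding convex_problem_def by blast
  have zero: "0 \<in> X" using X by auto
  \<comment> \<open>A bound on the norm of some subgradient is nonnegative; agent and point are
    arbitrary.\<close>
  have L0: "0 \<le> L"
    using L[rule_format, of 1 0 undefined] zero norm_ge_zero order.trans by blast
  have F0: "0 \<le> F1"
    using F1[rule_format, of 1 0 0 undefined] zero by simp
  \<comment> \<open>The consensus constant is fixed here, before any realization is
    considered.\<close>
  obtain Cd where Cd: "0 \<le> Cd"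
    "\<And>(v :: nat \<Rightarrow> 'n \<Rightarrow> real ^ 'p) e \<epsilon> D T.
      \<lbrakk>\<And>s i. 1 \<le> s \<Longrightarrow> v (Suc s) i = (\<Sum>j\<in>UNIV. W s $ i $ j *\<^sub>R v s j) + e s i;
       \<And>s i. 1 \<le> s \<Longrightarrow> norm (e s i) \<le> \<epsilon> s; \<And>s. 1 \<le> s \<Longrightarrow> disagreement (v s) \<le> D\<rbrakk>
      \<Longrightarrow> (\<Sum>t=1..T. disagreement (v t)) \<le> Cd * (D + (\<Sum>t=1..T. \<epsilon> t))"
  proof (rule sum_disagreement_bound[OF network, where 'a = "real ^ 'p"])
    fix C :: real assume C: "0 \<le> C"
      "\<And>(v :: nat \<Rightarrow> 'n \<Rightarrow> real ^ 'p) e \<epsilon> D T.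
        \<lbrakk>\<And>s i. 1 \<le> s \<Longrightarrow> v (Suc s) i = (\<Sum>j\<in>UNIV. W s $ i $ j *\<^sub>R v s j) + e s i;
         \<And>s i. 1 \<le> s \<Longrightarrow> norm (e s i) \<le> \<epsilon> s; \<And>s. 1 \<le> s \<Longrightarrow> disagreement (v s) \<le> D\<rbrakk>
        \<Longrightarrow> (\<Sum>t=1..T. disagreement (v t)) \<le> C * (D + (\<Sum>t=1..T. \<epsilon> t))"
    show thesis by (rule that[OF C])
  qed
  have convf: "convex_on X (f i t)" if "1 \<le> t" for i t
    using conv_f that by blast
  have convg: "convex_on X (\<lambda>x. g i t x k)" if "1 \<le> t" "k < m i" for i t k
    using conv_g that by blast
  have fb: "\<bar>f i t v - f i t w\<bar> \<le> F1" if "1 \<le> t" "v \<in> X" "w \<in> X" for i t v w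
    using F1 that by blast
  have gb: "\<bar>g i t v k\<bar> \<le> F1" if "1 \<le> t" "v \<in> X" "k < m i" for i t v k
    using L2_set_component_le[OF that(3), of "g i t v"] F1[rule_format, OF that(1,2,2), of i] by linarith
  have lf: "\<bar>f i t v - f i t w\<bar> \<le> L * norm (v - w)" if "1 \<le> t" "v \<in> X" "w \<in> X" for i t v w
    by (rule subgradients_imp_lipschitz[OF _ that(2,3)]) (use L that(1) in blast)
  have lg: "\<bar>g i t v k - g i t w k\<bar> \<le> L * norm (v - w)"
    if t: "1 \<le> t" and vw: "v \<in> X" "w \<in> X" and k: "k < m i" for i t v w k
  proof (rule subgradients_imp_lipschitz[where h = "\<lambda>y. g i t y k", OF _ vw])
    fix x assume "x \<in> X"
    then obtain G where G: "\<forall>k<m i. subgradient_on X (\<lambda>y. g i t y k) x (G k)" "spectral_norm (m i) G \<le> L"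
      using L t by blast
    have "norm (G k) \<le> L"
      by (rule order.trans[OF norm_column_le_spectral_norm[OF k] G(2)])
    then show "\<exists>s. subgradient_on X (\<lambda>y. g i t y k) x s \<and> norm s \<le> L"
      using G(1) k by blast
  qed
  have st: "doubly_stochastic (W t)" if "1 \<le> t" for t
    using network that unfolding mixing_network_def by blast
  have S: "setting X r R m f g W \<tau> \<Psi> \<alpha> \<beta> \<gamma> \<xi> \<delta> \<kappa> L F1 Cd"
    by (rule setting.intro[OF X convf convg fb gb lf lg L0 F0 st Cd tau_pos tau_mono Psi kappa alpha beta gamma xi delta])
  then interpret setting X r R m f g W \<tau> \<Psi> \<alpha> \<beta> \<gamma> \<xi> \<delta> \<kappa> L F1 Cd .
  have u1: "norm (u i t \<omega>) = 1" if "1 \<le> t" "\<omega> \<in> space M" for i t \<omega>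
    using u_sphere[OF that, of i] by simp
  interpret R: stochastic_run X r R m f g W \<tau> \<Psi> \<alpha> \<beta> \<gamma> \<xi> \<delta> \<kappa> L F1 Cd M x1 u x xh q
    by (rule stochastic_run.intro[OF S prob stochastic_run_axioms.intro])
      (rule init[folded shrunk_def] u1 u_uniform u_indep algorithm; assumption)+
  have static: "\<exists>x. (\<lambda>_. x) \<in> feasible_seqs X m g T" if "1 \<le> T" for T
    using feasible that unfolding feasibility_def by blast
  show ?thesis
  proof (intro conjI exI allI impI ballI)
    fix T :: nat and y assume T: "1 \<le> T" and y: "y \<in> feasible_seqs X m g T"
    show "integrable M (\<lambda>\<omega>. net_reg f T (\<lambda>i t. x i t \<omega>) y)"
      by (rule R.expected_regret(1)[OF T y])
    show "(\<integral>\<omega>. net_reg f T (\<lambda>i t. x i t \<omega>) y \<partial>M)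
        \<le> R.regret_const * (real T powr \<kappa> + sqrt (\<Psi> T * real T) + sqrt (inverse (\<Psi> T) * real T) * path_length T y)"
      using R.expected_regret(2)[OF T y] unfolding rate_def path_def .
  next
    fix T :: nat assume T: "1 \<le> T"
    \<comment> \<open>The static point may differ for each \<open>T\<close>; the constant does not
      involve it.\<close>
    obtain y where y: "(\<lambda>_. y) \<in> feasible_seqs X m g T" using static[OF T] by blast
    show "integrable M (\<lambda>\<omega>. net_ccv m g T (\<lambda>i t. x i t \<omega>))"
      by (rule R.expected_violation(1)[OF T y])
    show "(\<integral>\<omega>. net_ccv m g T (\<lambda>i t. x i t \<omega>) \<partial>M)
        \<le> (violation_const + R.growth_const * (1 + drift_const)) * (real T powr (1 - \<kappa> / 2) + \<Psi> T powr (1 / 4) * real T powr (3 / 4))"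
      using R.expected_violation(2)[OF T y] unfolding viol_def .
  qed
qed

end
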